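(* Let $M$ be a smooth paracompact manifold of dimension $n\ge 3$, let $\Gamma$ be a spray on $T^\circ M$, and let $\omega$ be a 2-form on $T^\circ M$ such that 1. the characteristic distribution of $\omega$ contains $\mathcal{D}$, the distribution spanned by $\Delta$ and any spray of the projective class of $\Gamma$; 2. $\mathcal{L}_\Gamma\omega=0$; 3. for any pair of vertical vector fields $V_1,V_2$, $\omega(V_1,V_2)=0$; 4. for any horizontal vector field $H$ and any pair of vertical vector fields $V_1,V_2$, $d\omega(H,V_1,V_2)=0$. Then over any coordinate neighbourhood $U\subset M$, $\omega=h_{ij}\,dx^i\wedge\phi^j$ where $h_{ij}$ satisfies the Helmholtz conditions. Conversely, if $h_{ij}$ satisfies the Helmholtz conditions (over a coordinate neighbourhood $U$), then for any spray $\Gamma$ in the projective class the 2-form $\omega=h_{ij}\,dx^i\wedge\phi^j$ on $\tau^{-1}U$ has the properties 1--4.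
   Context: $\tau:T^\circ M\to M$ is the tangent bundle with the zero section removed, with coordinates $(x^i,y^i)$; $\Delta=y^i\partial/\partial y^i$. A spray is a vector field $\Gamma=y^i\frac{\partial}{\partial x^i}-2\Gamma^i\frac{\partial}{\partial y^i}$ on $T^\circ M$ with $[\Delta,\Gamma]=\Gamma$. Its projective class consists of all sprays $\Gamma-2P\Delta$ with $\Delta(P)=P$; $\mathcal{D}$ is the involutive two-dimensional distribution spanned by $\Delta$ and any spray of the class. Put $\Gamma^i_j=\partial\Gamma^i/\partial y^j$, $V_i=\partial/\partial y^i$, $H_i=\partial/\partial x^i-\Gamma^j_iV_j$; the horizontal distribution of $\Gamma$ is spanned by the $H_i$, and $\{dx^i,\phi^i\}$, $\phi^i=dy^i+\Gamma^i_jdx^j$, is the basis of 1-forms dual to $\{H_i,V_i\}$. The characteristic distribution of a 2-form $\omega$ consists of the vectors $Z$ with $i_Z\omega=0$. Curvature: $[H_i,H_j]=-R^l_{ij}V_l$; $R^k_j=R^k_{jl}y^l$; Weyl tensor $W^i_j=A^i_j-\frac1{n+1}\frac{\partial A^m_j}{\partial y^m}y^i$, where $A^i_j=R^i_j-\frac{1}{n-1}R^m_m\delta^i_j$ (projectively invariant). A $(0,2)$ tensor field along $\tau$ with components $h_{ij}(x,y)$ satisfies the Helmholtz conditions if: $h_{ji}=h_{ij}$; $h_{ij}y^j=0$; $\partial h_{ij}/\partial y^k=\partial h_{ik}/\partial y^j$; $(\nabla h)_{ij}:=\Gamma(h_{ij})-\Gamma^k_ih_{kj}-\Gamma^k_jh_{ik}=0$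 (for any choice of spray $\Gamma$ in the class); $h_{ik}W^k_j=h_{jk}W^k_i$. (Given the other conditions, the last is equivalent to $h_{ik}R^k_j=h_{jk}R^k_i$, and to the vanishing of the cyclic sum of $R^l_{jk}h_{il}$ over $i,j,k$.) *)

theory Defs
  imports "HOL-Analysis.Analysis"
begin

section \<open>Smooth maps between open sets of vector spaces\<close>

text \<open>Intended for open \<open>S\<close>; differentiability is two-sided at every point of \<open>S\<close>.\<close>

primrec Ck_on :: "nat \<Rightarrow> 'e::euclidean_space set \<Rightarrow> ('e \<Rightarrow> 'f::real_normed_vector) \<Rightarrow> bool" where
  "Ck_on 0 S f \<longleftrightarrow> continuous_on S f"
| "Ck_on (Suc m) S f \<longleftrightarrow>
     (\<forall>x\<in>S. f differentiable (at x)) \<and>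
     (\<forall>v. Ck_on m S (\<lambda>x. frechet_derivative f (at x) v))"

definition smooth_on :: "'e::euclidean_space set \<Rightarrow> ('e \<Rightarrow> 'f::real_normed_vector) \<Rightarrow> bool" where
  "smooth_on S f \<longleftrightarrow> (\<forall>m. Ck_on m S f)"


section \<open>Smooth manifolds\<close>

text \<open>A chart is a domain together with a map; only the values on the domain matter.\<close>

type_synonym ('a, 'e) chart = "'a set \<times> ('a \<Rightarrow> 'e)"

definition cinv :: "('a, 'e) chart \<Rightarrow> 'e \<Rightarrow> 'a" where
  "cinv k = inv_into (fst k) (snd k)"

definition transition :: "('a, 'e) chart \<Rightarrow> ('a, 'e) chart \<Rightarrow> 'e \<Rightarrow> 'e" where
  "transition k l = snd l \<circ> cinv k"

definition is_chart :: "'a topology \<Rightarrow> ('a, 'e::euclidean_space) chart \<Rightarrow> bool" where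
  "is_chart M k \<longleftrightarrow>
     openin M (fst k) \<and> open (snd k ` fst k) \<and>
     homeomorphic_map (subtopology M (fst k)) (top_of_set (snd k ` fst k)) (snd k)"

definition smoothly_compatible ::
    "('a, 'e::euclidean_space) chart \<Rightarrow> ('a, 'e) chart \<Rightarrow> bool" where
  "smoothly_compatible k l \<longleftrightarrow>
     smooth_on (snd k ` (fst k \<inter> fst l)) (transition k l) \<and>
     smooth_on (snd l ` (fst k \<inter> fst l)) (transition l k)"

definition paracompact_space :: "'a topology \<Rightarrow> bool" where
  "paracompact_space M \<longleftrightarrow>
     (\<forall>\<U>. (\<forall>U\<in>\<U>. openin M U) \<and> \<Union>\<U> = topspace M \<longrightarrow>
        (\<exists>\<V>. (\<forall>V\<in>\<V>. openin M V \<and> (\<exists>U\<in>\<U>. V \<subseteq> U)) \<and> \<Union>\<V> = topspace M \<and>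
             locally_finite_in M \<V>))"

text \<open>The atlas is maximal, so its members are precisely the coordinate neighbourhoods.\<close>

definition paracompact_manifold :: "'a topology \<Rightarrow> ('a, 'e::euclidean_space) chart set \<Rightarrow> bool" where
  "paracompact_manifold M A \<longleftrightarrow>
     Hausdorff_space M \<and> paracompact_space M \<and>
     (\<forall>k\<in>A. is_chart M k) \<and> (\<Union>k\<in>A. fst k) = topspace M \<and>
     (\<forall>k\<in>A. \<forall>l\<in>A. smoothly_compatible k l) \<and>
     (\<forall>k. is_chart M k \<and> (\<forall>l\<in>A. smoothly_compatible k l) \<longrightarrow> k \<in> A)"


section \<open>Tangent vectors, vector fields and 2-forms relative to an atlas\<close>

text \<open>
  A tangent vector at \<open>p\<close> is the family of its components in all charts around \<open>p\<close>, related by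
  the Jacobians of the transition maps. Components with respect to charts that are not in the
  atlas or not defined at \<open>p\<close> are set to 0, so that equality of tangent vectors is equality.
\<close>

definition tangent_space ::
    "('a, 'e::euclidean_space) chart set \<Rightarrow> 'a \<Rightarrow> (('a, 'e) chart \<Rightarrow> 'e) set" where
  "tangent_space A p =
     {v. (\<forall>k\<in>A. \<forall>l\<in>A. p \<in> fst k \<and> p \<in> fst l \<longrightarrow>
            v l = frechet_derivative (transition k l) (at (snd k p)) (v k)) \<and>
         (\<forall>k. k \<notin> A \<or> p \<notin> fst k \<longrightarrow> v k = 0)}"

text \<open>The tangent vector at \<open>p\<close> with components \<open>u\<close> in the chart \<open>k\<close>.\<close>

definition tangent_of ::
    "('a, 'e::euclidean_space) chart set \<Rightarrow> ('a, 'e) chart \<Rightarrow> 'a \<Rightarrow> 'e \<Rightarrow> (('a, 'e) chart \<Rightarrow> 'e)" where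
  "tangent_of A k p u =
     (\<lambda>l. if l \<in> A \<and> p \<in> fst l
          then frechet_derivative (transition k l) (at (snd k p)) u else 0)"

definition function_rep :: "('a, 'e) chart \<Rightarrow> ('a \<Rightarrow> 'b) \<Rightarrow> 'e \<Rightarrow> 'b" where
  "function_rep k f z = f (cinv k z)"

definition field_rep :: "('a, 'e) chart \<Rightarrow> ('a \<Rightarrow> ('a, 'e) chart \<Rightarrow> 'e) \<Rightarrow> 'e \<Rightarrow> 'e" where
  "field_rep k X z = X (cinv k z) k"

definition form_rep ::
    "('a, 'e::euclidean_space) chart set \<Rightarrow> ('a, 'e) chart \<Rightarrow>
     ('a \<Rightarrow> (('a, 'e) chart \<Rightarrow> 'e) \<Rightarrow> (('a, 'e) chart \<Rightarrow> 'e) \<Rightarrow> real) \<Rightarrow> 'e \<Rightarrow> 'e \<Rightarrow> 'e \<Rightarrow> real" where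
  "form_rep A k \<omega> z u v =
     \<omega> (cinv k z) (tangent_of A k (cinv k z) u) (tangent_of A k (cinv k z) v)"

text \<open>In the following \<open>W\<close> is an open subset of the manifold with atlas \<open>A\<close>.\<close>

definition smooth_function ::
    "('a, 'e::euclidean_space) chart set \<Rightarrow> 'a set \<Rightarrow> ('a \<Rightarrow> real) \<Rightarrow> bool" where
  "smooth_function A W f \<longleftrightarrow> (\<forall>k\<in>A. smooth_on (snd k ` (fst k \<inter> W)) (function_rep k f))"

definition vector_field ::
    "('a, 'e::euclidean_space) chart set \<Rightarrow> 'a set \<Rightarrow> ('a \<Rightarrow> ('a, 'e) chart \<Rightarrow> 'e) \<Rightarrow> bool" where
  "vector_field A W X \<longleftrightarrow>
     (\<forall>p\<in>W. X p \<in> tangent_space A p) \<and>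
     (\<forall>k\<in>A. smooth_on (snd k ` (fst k \<inter> W)) (field_rep k X))"

definition two_form ::
    "('a, 'e::euclidean_space) chart set \<Rightarrow> 'a set \<Rightarrow>
     ('a \<Rightarrow> (('a, 'e) chart \<Rightarrow> 'e) \<Rightarrow> (('a, 'e) chart \<Rightarrow> 'e) \<Rightarrow> real) \<Rightarrow> bool" where
  "two_form A W \<omega> \<longleftrightarrow>
     (\<forall>k\<in>A.
        (\<forall>z\<in>snd k ` (fst k \<inter> W).
           bilinear (form_rep A k \<omega> z) \<and> (\<forall>u. form_rep A k \<omega> z u u = 0)) \<and>
        (\<forall>u v. smooth_on (snd k ` (fst k \<inter> W)) (\<lambda>z. form_rep A k \<omega> z u v)))"

definition characteristic_space ::
    "('a, 'e::euclidean_space) chart set \<Rightarrow>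
     ('a \<Rightarrow> (('a, 'e) chart \<Rightarrow> 'e) \<Rightarrow> (('a, 'e) chart \<Rightarrow> 'e) \<Rightarrow> real) \<Rightarrow>
     'a \<Rightarrow> (('a, 'e) chart \<Rightarrow> 'e) set" where
  "characteristic_space A \<omega> p =
     {Z \<in> tangent_space A p. \<forall>Y\<in>tangent_space A p. \<omega> p Z Y = 0}"


subsection \<open>Differential operators in a single chart\<close>

definition lie_bracket ::
    "('e::euclidean_space \<Rightarrow> 'e) \<Rightarrow> ('e \<Rightarrow> 'e) \<Rightarrow> 'e \<Rightarrow> 'e" where
  "lie_bracket X Y z =
     frechet_derivative Y (at z) (X z) - frechet_derivative X (at z) (Y z)"

definition lie_derivative_form ::
    "('e::euclidean_space \<Rightarrow> 'e) \<Rightarrow> ('e \<Rightarrow> 'e \<Rightarrow> 'e \<Rightarrow> real) \<Rightarrow> 'e \<Rightarrow> 'e \<Rightarrow> 'e \<Rightarrow> real" where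
  "lie_derivative_form X \<omega> z u v =
     frechet_derivative (\<lambda>z. \<omega> z u v) (at z) (X z)
     + \<omega> z (frechet_derivative X (at z) u) v
     + \<omega> z u (frechet_derivative X (at z) v)"

definition exterior_derivative ::
    "('e::euclidean_space \<Rightarrow> 'e \<Rightarrow> 'e \<Rightarrow> real) \<Rightarrow> 'e \<Rightarrow> 'e \<Rightarrow> 'e \<Rightarrow> 'e \<Rightarrow> real" where
  "exterior_derivative \<omega> z u v w =
     frechet_derivative (\<lambda>z. \<omega> z v w) (at z) u
     - frechet_derivative (\<lambda>z. \<omega> z u w) (at z) v
     + frechet_derivative (\<lambda>z. \<omega> z u v) (at z) w"


section \<open>The slit tangent bundle\<close>

type_synonym ('a, 'n) mchart = "('a, (real, 'n) vec) chart"

type_synonym ('a, 'n) tpoint = "'a \<times> (('a, 'n) mchart \<Rightarrow> (real, 'n) vec)"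

type_synonym 'n coords = "(real, 'n) vec \<times> (real, 'n) vec"

type_synonym ('a, 'n) tchart = "(('a, 'n) tpoint, 'n coords) chart"

type_synonym ('a, 'n) tvector = "('a, 'n) tchart \<Rightarrow> 'n coords"

text \<open>\<open>slit_tangent A U\<close> is the part over \<open>U\<close> of the tangent bundle without its zero section.\<close>

definition slit_tangent :: "('a, 'n::finite) mchart set \<Rightarrow> 'a set \<Rightarrow> ('a, 'n) tpoint set" where
  "slit_tangent A U = {(p, v). p \<in> U \<and> v \<in> tangent_space A p \<and> v \<noteq> (\<lambda>_. 0)}"

text \<open>The induced coordinates \<open>(x, y)\<close>: if \<open>z = (x, y)\<close> then \<open>x = fst z\<close> and \<open>y = snd z\<close>.\<close>

definition slit_chart :: "('a, 'n::finite) mchart set \<Rightarrow> ('a, 'n) mchart \<Rightarrow> ('a, 'n) tchart" where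
  "slit_chart A k = (slit_tangent A (fst k), \<lambda>(p, v). (snd k p, v k))"

definition slit_atlas :: "('a, 'n::finite) mchart set \<Rightarrow> ('a, 'n) tchart set" where
  "slit_atlas A = slit_chart A ` A"

text \<open>The field \<open>\<Delta>\<close> has components \<open>(0, y)\<close> in every induced chart.\<close>

definition liouville :: "('a, 'n::finite) mchart set \<Rightarrow> ('a, 'n) tpoint \<Rightarrow> ('a, 'n) tvector" where
  "liouville A q = (\<lambda>K. if K \<in> slit_atlas A \<and> q \<in> fst K then (0, snd (snd K q)) else 0)"


section \<open>Sprays\<close>

definition spray ::
    "'a topology \<Rightarrow> ('a, 'n::finite) mchart set \<Rightarrow> (('a, 'n) tpoint \<Rightarrow> ('a, 'n) tvector) \<Rightarrow> bool" where
  "spray M A \<Gamma> \<longleftrightarrow>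
     vector_field (slit_atlas A) (slit_tangent A (topspace M)) \<Gamma> \<and>
     (\<forall>K\<in>slit_atlas A. \<forall>z\<in>snd K ` fst K.
        fst (field_rep K \<Gamma> z) = snd z \<and>
        lie_bracket (field_rep K (liouville A)) (field_rep K \<Gamma>) z = field_rep K \<Gamma> z)"

definition projective_class ::
    "'a topology \<Rightarrow> ('a, 'n::finite) mchart set \<Rightarrow> (('a, 'n) tpoint \<Rightarrow> ('a, 'n) tvector) \<Rightarrow>
     (('a, 'n) tpoint \<Rightarrow> ('a, 'n) tvector) set" where
  "projective_class M A \<Gamma> =
     {\<Gamma>'. spray M A \<Gamma>' \<and>
        (\<exists>P. smooth_function (slit_atlas A) (slit_tangent A (topspace M)) P \<and>
             (\<forall>K\<in>slit_atlas A. \<forall>z\<in>snd K ` fst K.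
                frechet_derivative (function_rep K P) (at z) (field_rep K (liouville A) z)
                  = function_rep K P z) \<and>
             (\<forall>q\<in>slit_tangent A (topspace M). \<forall>K\<in>slit_atlas A.
                \<Gamma>' q K = \<Gamma> q K - (2 * P q) *\<^sub>R liouville A q K))}"

text \<open>The distribution \<open>\<D>\<close>; it is the same for every spray of the projective class.\<close>

definition projective_distribution ::
    "('a, 'n::finite) mchart set \<Rightarrow> (('a, 'n) tpoint \<Rightarrow> ('a, 'n) tvector) \<Rightarrow>
     ('a, 'n) tpoint \<Rightarrow> ('a, 'n) tvector set" where
  "projective_distribution A \<Gamma> q =
     {Z \<in> tangent_space (slit_atlas A) q.
        \<exists>a b. \<forall>K\<in>slit_atlas A. Z K = a *\<^sub>R liouville A q K + b *\<^sub>R \<Gamma> q K}"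


subsection \<open>Coordinate expressions\<close>

text \<open>
  Here \<open>S\<close> is the representative \<open>(y, -2\<Gamma>\<^sup>i)\<close> of a spray in an induced chart, as a
  function of \<open>z = (x, y)\<close>. In \<open>conn S i j\<close>, \<open>riem S i j\<close>, \<open>trfree S i j\<close> and \<open>weyl S i j\<close> the first
  index is the upper one; in \<open>curv S l i j\<close> it is \<open>l\<close>.
\<close>

definition spray_coeff ::
    "('n::finite coords \<Rightarrow> 'n coords) \<Rightarrow>
     'n \<Rightarrow> 'n coords \<Rightarrow> real" where
  "spray_coeff S i z = - (1 / 2) * snd (S z) $ i"

definition dy ::
    "'n::finite \<Rightarrow> ('n coords \<Rightarrow> real) \<Rightarrow>
     'n coords \<Rightarrow> real" where
  "dy j f z = frechet_derivative f (at z) (0, axis j 1)"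

definition conn ::
    "('n::finite coords \<Rightarrow> 'n coords) \<Rightarrow>
     'n \<Rightarrow> 'n \<Rightarrow> 'n coords \<Rightarrow> real" where
  "conn S i j z = dy j (spray_coeff S i) z"

definition V_field ::
    "'n::finite \<Rightarrow> 'n coords \<Rightarrow> 'n coords" where
  "V_field i z = (0, axis i 1)"

definition H_field ::
    "('n::finite coords \<Rightarrow> 'n coords) \<Rightarrow>
     'n \<Rightarrow> 'n coords \<Rightarrow> 'n coords" where
  "H_field S i z = (axis i 1, 0) - (\<Sum>j\<in>UNIV. conn S j i z *\<^sub>R V_field j z)"

definition dx_form :: "'n::finite \<Rightarrow> 'n coords \<Rightarrow> real" where
  "dx_form i u = fst u $ i"

definition phi_form ::
    "('n::finite coords \<Rightarrow> 'n coords) \<Rightarrow>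
     'n \<Rightarrow> 'n coords \<Rightarrow> 'n coords \<Rightarrow> real" where
  "phi_form S i z u = snd u $ i + (\<Sum>j\<in>UNIV. conn S i j z * dx_form j u)"

text \<open>\<open>[H\<^sub>i, H\<^sub>j]\<close> is vertical, so its second component gives \<open>-R\<^sup>l\<^sub>i\<^sub>j\<close>.\<close>

definition curv ::
    "('n::finite coords \<Rightarrow> 'n coords) \<Rightarrow>
     'n \<Rightarrow> 'n \<Rightarrow> 'n \<Rightarrow> 'n coords \<Rightarrow> real" where
  "curv S l i j z = - snd (lie_bracket (H_field S i) (H_field S j) z) $ l"

definition riem ::
    "('n::finite coords \<Rightarrow> 'n coords) \<Rightarrow>
     'n \<Rightarrow> 'n \<Rightarrow> 'n coords \<Rightarrow> real" where
  "riem S k j z = (\<Sum>l\<in>UNIV. curv S k j l z * snd z $ l)"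

definition trfree ::
    "('n::finite coords \<Rightarrow> 'n coords) \<Rightarrow>
     'n \<Rightarrow> 'n \<Rightarrow> 'n coords \<Rightarrow> real" where
  "trfree S i j z =
     riem S i j z - 1 / (real CARD('n) - 1) * (\<Sum>m\<in>UNIV. riem S m m z) * (if i = j then 1 else 0)"

definition weyl ::
    "('n::finite coords \<Rightarrow> 'n coords) \<Rightarrow>
     'n \<Rightarrow> 'n \<Rightarrow> 'n coords \<Rightarrow> real" where
  "weyl S i j z =
     trfree S i j z
     - 1 / (real CARD('n) + 1) * (\<Sum>m\<in>UNIV. dy m (trfree S m j) z) * snd z $ i"

definition nabla ::
    "('n::finite coords \<Rightarrow> 'n coords) \<Rightarrow>
     ('n \<Rightarrow> 'n \<Rightarrow> 'n coords \<Rightarrow> real) \<Rightarrow>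
     'n \<Rightarrow> 'n \<Rightarrow> 'n coords \<Rightarrow> real" where
  "nabla S h i j z =
     frechet_derivative (h i j) (at z) (S z)
     - (\<Sum>k\<in>UNIV. conn S k i z * h k j z) - (\<Sum>k\<in>UNIV. conn S k j z * h i k z)"


section \<open>Helmholtz conditions and the associated 2-form\<close>

text \<open>
  Over the coordinate neighbourhood of \<open>k\<close> a \<open>(0, 2)\<close> tensor field along the projection is given
  by its smooth components \<open>h i j\<close> as functions of the induced coordinates.
\<close>

definition helmholtz ::
    "'a topology \<Rightarrow> ('a, 'n::finite) mchart set \<Rightarrow> (('a, 'n) tpoint \<Rightarrow> ('a, 'n) tvector) \<Rightarrow>
     ('a, 'n) mchart \<Rightarrow> ('n \<Rightarrow> 'n \<Rightarrow> 'n coords \<Rightarrow> real) \<Rightarrow> bool" where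
  "helmholtz M A \<Gamma> k h \<longleftrightarrow>
     (let K = slit_chart A k; D = snd K ` fst K in
        (\<forall>i j. smooth_on D (h i j)) \<and>
        (\<forall>z\<in>D. \<forall>i j. h j i z = h i j z) \<and>
        (\<forall>z\<in>D. \<forall>i. (\<Sum>j\<in>UNIV. h i j z * snd z $ j) = 0) \<and>
        (\<forall>z\<in>D. \<forall>i j l. dy l (h i j) z = dy j (h i l) z) \<and>
        (\<forall>\<Gamma>'\<in>projective_class M A \<Gamma>. \<forall>z\<in>D. \<forall>i j. nabla (field_rep K \<Gamma>') h i j z = 0) \<and>
        (\<forall>z\<in>D. \<forall>i j. (\<Sum>l\<in>UNIV. h i l z * weyl (field_rep K \<Gamma>) l j z)
                    = (\<Sum>l\<in>UNIV. h j l z * weyl (field_rep K \<Gamma>) l i z)))"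

text \<open>The 2-form \<open>h\<^sub>i\<^sub>j dx\<^sup>i \<and> \<phi>\<^sup>j\<close>, with \<open>(\<alpha> \<and> \<beta>)(X, Y) = \<alpha>(X) \<beta>(Y) - \<alpha>(Y) \<beta>(X)\<close>.\<close>

definition helmholtz_form ::
    "('a, 'n::finite) mchart set \<Rightarrow> (('a, 'n) tpoint \<Rightarrow> ('a, 'n) tvector) \<Rightarrow>
     ('a, 'n) mchart \<Rightarrow> ('n \<Rightarrow> 'n \<Rightarrow> 'n coords \<Rightarrow> real) \<Rightarrow>
     ('a, 'n) tpoint \<Rightarrow> ('a, 'n) tvector \<Rightarrow> ('a, 'n) tvector \<Rightarrow> real" where
  "helmholtz_form A \<Gamma> k h q X Y =
     (let K = slit_chart A k; S = field_rep K \<Gamma>; z = snd K q in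
        \<Sum>i\<in>UNIV. \<Sum>j\<in>UNIV. h i j z *
          (dx_form i (X K) * phi_form S j z (Y K) - dx_form i (Y K) * phi_form S j z (X K)))"


section \<open>The four properties of a 2-form\<close>

text \<open>
  Being vertical or horizontal at a point does not depend on the induced chart used, so it is
  enough to ask for it in one of them.
\<close>

definition vertical_space ::
    "('a, 'n::finite) mchart set \<Rightarrow> ('a, 'n) tpoint \<Rightarrow> ('a, 'n) tvector set" where
  "vertical_space A q =
     {X \<in> tangent_space (slit_atlas A) q.
        \<exists>K\<in>slit_atlas A. q \<in> fst K \<and> X K \<in> span (range (\<lambda>i. V_field i (snd K q)))}"

definition horizontal_space ::
    "('a, 'n::finite) mchart set \<Rightarrow> (('a, 'n) tpoint \<Rightarrow> ('a, 'n) tvector) \<Rightarrow>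
     ('a, 'n) tpoint \<Rightarrow> ('a, 'n) tvector set" where
  "horizontal_space A \<Gamma> q =
     {X \<in> tangent_space (slit_atlas A) q.
        \<exists>K\<in>slit_atlas A. q \<in> fst K \<and>
          X K \<in> span (range (\<lambda>i. H_field (field_rep K \<Gamma>) i (snd K q)))}"

definition vertical_field ::
    "('a, 'n::finite) mchart set \<Rightarrow> 'a set \<Rightarrow> (('a, 'n) tpoint \<Rightarrow> ('a, 'n) tvector) \<Rightarrow> bool" where
  "vertical_field A U X \<longleftrightarrow>
     vector_field (slit_atlas A) (slit_tangent A U) X \<and>
     (\<forall>q\<in>slit_tangent A U. X q \<in> vertical_space A q)"

definition horizontal_field ::
    "('a, 'n::finite) mchart set \<Rightarrow> (('a, 'n) tpoint \<Rightarrow> ('a, 'n) tvector) \<Rightarrow> 'a set \<Rightarrow>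
     (('a, 'n) tpoint \<Rightarrow> ('a, 'n) tvector) \<Rightarrow> bool" where
  "horizontal_field A \<Gamma> U X \<longleftrightarrow>
     vector_field (slit_atlas A) (slit_tangent A U) X \<and>
     (\<forall>q\<in>slit_tangent A U. X q \<in> horizontal_space A \<Gamma> q)"

text \<open>
  For a 2-form \<open>\<omega>\<close> on the part of the slit tangent bundle over the open set \<open>U\<close>: the distribution
  \<open>\<D>\<close> is characteristic, the Lie derivative along \<open>\<Gamma>\<close> vanishes, \<open>\<omega>(V\<^sub>1, V\<^sub>2) = 0\<close> and
  \<open>d\<omega>(H, V\<^sub>1, V\<^sub>2) = 0\<close>. The Lie and exterior derivatives are tensors; their vanishing
  is expressed in every induced chart.
\<close>

definition helmholtz_properties ::
    "('a, 'n::finite) mchart set \<Rightarrow> (('a, 'n) tpoint \<Rightarrow> ('a, 'n) tvector) \<Rightarrow> 'a set \<Rightarrow>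
     (('a, 'n) tpoint \<Rightarrow> ('a, 'n) tvector \<Rightarrow> ('a, 'n) tvector \<Rightarrow> real) \<Rightarrow> bool" where
  "helmholtz_properties A \<Gamma> U \<omega> \<longleftrightarrow>
     (\<forall>q\<in>slit_tangent A U.
        projective_distribution A \<Gamma> q \<subseteq> characteristic_space (slit_atlas A) \<omega> q) \<and>
     (\<forall>K\<in>slit_atlas A. \<forall>z\<in>snd K ` (fst K \<inter> slit_tangent A U). \<forall>u v.
        lie_derivative_form (field_rep K \<Gamma>) (form_rep (slit_atlas A) K \<omega>) z u v = 0) \<and>
     (\<forall>V\<^sub>1 V\<^sub>2. vertical_field A U V\<^sub>1 \<and> vertical_field A U V\<^sub>2 \<longrightarrow>
        (\<forall>q\<in>slit_tangent A U. \<omega> q (V\<^sub>1 q) (V\<^sub>2 q) = 0)) \<and>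
     (\<forall>H V\<^sub>1 V\<^sub>2. horizontal_field A \<Gamma> U H \<and> vertical_field A U V\<^sub>1 \<and> vertical_field A U V\<^sub>2 \<longrightarrow>
        (\<forall>K\<in>slit_atlas A. \<forall>z\<in>snd K ` (fst K \<inter> slit_tangent A U).
           exterior_derivative (form_rep (slit_atlas A) K \<omega>) z
             (field_rep K H z) (field_rep K V\<^sub>1 z) (field_rep K V\<^sub>2 z) = 0))"

end

theory Submission
  imports Defs
begin

text \<open>
  In an induced chart, a 2-form \<open>\<omega>\<close> that vanishes on vertical pairs is given by
  \<open>h\<^sub>i\<^sub>j = \<omega>(\<partial>/\<partial>x\<^sup>i, V\<^sub>j)\<close> and the antisymmetric \<open>m\<^sub>i\<^sub>j = \<omega>(\<partial>/\<partial>x\<^sup>i, \<partial>/\<partial>x\<^sup>j)\<close>. It equals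
  \<open>h\<^sub>i\<^sub>j dx\<^sup>i \<and> \<phi>\<^sup>j\<close> precisely if \<open>m\<^sub>i\<^sub>j = h\<^sub>i\<^sub>k \<Gamma>\<^sup>k\<^sub>j - h\<^sub>j\<^sub>k \<Gamma>\<^sup>k\<^sub>i\<close>, that is, if it vanishes on horizontal
  pairs. The components of \<open>\<L>\<^sub>\<Gamma>\<omega>\<close> in the coordinate frame are of three kinds:
  \<^item> on \<open>(V\<^sub>i, V\<^sub>j)\<close> it is \<open>h\<^sub>i\<^sub>j - h\<^sub>j\<^sub>i\<close>;
  \<^item> on \<open>(\<partial>/\<partial>x\<^sup>i, V\<^sub>j)\<close> it is \<open>\<Gamma>(h\<^sub>i\<^sub>j) + m\<^sub>i\<^sub>j - 2 h\<^sub>i\<^sub>k \<Gamma>\<^sup>k\<^sub>j\<close>; for symmetric \<open>h\<close> its symmetric part is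
    \<open>(\<nabla>h)\<^sub>i\<^sub>j\<close> and its antisymmetric part the difference of the two sides of the formula for \<open>m\<^sub>i\<^sub>j\<close>;
  \<^item> on \<open>(\<partial>/\<partial>x\<^sup>i, \<partial>/\<partial>x\<^sup>j)\<close> it is, if the others vanish, \<open>h\<^sub>j\<^sub>l R\<^sup>l\<^sub>i - h\<^sub>i\<^sub>l R\<^sup>l\<^sub>j\<close>.

  Since \<open>h\<close> annihilates \<open>y\<close>, the symmetry of \<open>h\<^sub>i\<^sub>l R\<^sup>l\<^sub>j\<close> is that of \<open>h\<^sub>i\<^sub>l W\<^sup>l\<^sub>j\<close>. Moreover
  \<open>d\<omega>(H\<^sub>i, V\<^sub>j, V\<^sub>l)\<close> is \<open>\<partial>h\<^sub>i\<^sub>j / \<partial>y\<^sup>l - \<partial>h\<^sub>i\<^sub>l / \<partial>y\<^sup>j\<close>, and \<open>\<Delta>\<close> is characteristic precisely if \<open>h\<^sub>i\<^sub>j y\<^sup>j = 0\<close>; for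
  \<open>h\<^sub>i\<^sub>j dx\<^sup>i \<and> \<phi>\<^sup>j\<close> this condition makes all of \<open>\<D>\<close> characteristic. So for the spray \<open>\<Gamma>\<close> itself the four
  properties and the Helmholtz conditions correspond to each other term by term; this is
  \<open>helmholtz_of_form\<close> in one direction, \<open>lie_derivative_hform\<close>, \<open>hform_liouville\<close>, \<open>hform_spray\<close> and
  \<open>exterior_derivative_vertical\<close> in the other.

  The change to another spray \<open>\<Gamma> - 2P\<Delta>\<close> of the class rests on homogeneity: \<open>h\<close> has degree \<open>-1\<close> in \<open>y\<close>
  and \<open>\<Gamma>\<^sup>i\<^sub>j\<close> has degree 1. Hence \<open>\<nabla>h\<close> and the form are unchanged (\<open>nabla_change\<close>, \<open>hform_change\<close>), and as
  \<open>\<Delta>\<close> is characteristic with \<open>\<L>\<^sub>\<Delta>\<omega> = 0\<close>, so is the Lie derivative (\<open>lie_derivative_change\<close>).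

  Between the manifold and a chart two things are needed. Properties stated for vector fields on the
  whole slit tangent bundle are read at a point by extending vectors with bump functions
  (\<open>vector_field_extension\<close>). Conversely, what has been verified in the chart of \<open>k\<close> holds in every chart
  because the Lie and exterior derivatives commute with pull-back
  (\<open>lie_derivative_form_pulled_back\<close>, \<open>exterior_derivative_pulled_back\<close>), which follows from the symmetry
  of second derivatives.
\<close>

section \<open>Calculus of smooth maps\<close>

lemma frechet_derivative_eqI:
  "(f has_derivative f') (at x) \<Longrightarrow> frechet_derivative f (at x) = f'"
  by (metis frechet_derivative_at)

text \<open>
  Differentiability in \<open>Ck_on\<close> is two-sided at each point, so that on an open set the values of the
  function on that set decide.
\<close>

lemma Ck_on_cong:
  assumes "open S" "\<And>x. x \<in> S \<Longrightarrow> f x = g x" "Ck_on m S f"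
  shows "Ck_on m S g"
  using assms
proof (induction m arbitrary: f g)
  case 0
  then show ?case by (simp cong: continuous_on_cong)
next
  case (Suc m)
  have *: "(g has_derivative frechet_derivative f (at x)) (at x)" if "x \<in> S" for x
    using Suc.prems that
    by (auto intro: has_derivative_transform_within_open[of f _ x _ S g]
        simp: frechet_derivative_works[symmetric])
  have "Ck_on m S (\<lambda>x. frechet_derivative g (at x) v)" for v
  proof (rule Suc.IH)
    show "frechet_derivative f (at x) v = frechet_derivative g (at x) v" if "x \<in> S" for x
      using *[OF that] frechet_derivative_eqI by metis
  qed (use Suc.prems in auto)
  with * show ?case by (auto simp: differentiable_def)
qed

lemma Ck_on_SucI:
  assumes "open S" "\<And>x. x \<in> S \<Longrightarrow> (f has_derivative f' x) (at x)"
    and "\<And>v. Ck_on m S (\<lambda>x. f' x v)"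
  shows "Ck_on (Suc m) S f"
proof -
  have "Ck_on m S (\<lambda>x. frechet_derivative f (at x) v)" for v
    by (rule Ck_on_cong[OF assms(1) _ assms(3)[of v]])
      (simp add: frechet_derivative_eqI[OF assms(2)])
  then show ?thesis using assms(2) by (auto simp: differentiable_def)
qed

lemma Ck_on_SucD: "Ck_on (Suc m) S f \<Longrightarrow> Ck_on m S f"
proof (induction m arbitrary: f)
  case 0
  then show ?case
    by (auto intro!: continuous_at_imp_continuous_on differentiable_imp_continuous_within)
qed auto

lemma Ck_on_has_derivative:
  "Ck_on (Suc m) S f \<Longrightarrow> x \<in> S \<Longrightarrow> (f has_derivative frechet_derivative f (at x)) (at x)"
  by (simp add: frechet_derivative_works[symmetric])

lemma Ck_on_const: "Ck_on m S (\<lambda>x. c)"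
  by (induction m arbitrary: c) auto

lemma Ck_on_bounded_linear:
  assumes "open S" "bounded_linear L" "Ck_on m S f"
  shows "Ck_on m S (\<lambda>x. L (f x))"
  using assms(3)
proof (induction m arbitrary: f)
  case 0
  then show ?case using bounded_linear.continuous_on[OF assms(2)] by auto
next
  case (Suc m)
  show ?case
    by (rule Ck_on_SucI[where f' = "\<lambda>x v. L (frechet_derivative f (at x) v)"])
      (use Suc assms Ck_on_has_derivative[OF Suc.prems]
        in \<open>auto intro: bounded_linear.has_derivative\<close>)
qed

lemma Ck_on_add:
  assumes "open S" "Ck_on m S f" "Ck_on m S g"
  shows "Ck_on m S (\<lambda>x. f x + g x)"
  using assms(2,3)
proof (induction m arbitrary: f g)
  case 0
  then show ?case by (auto intro: continuous_intros)
next
  case (Suc m)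
  show ?case
    by (rule Ck_on_SucI
        [where f' = "\<lambda>x v. frechet_derivative f (at x) v + frechet_derivative g (at x) v"])
      (use Suc assms Ck_on_has_derivative[OF Suc.prems(1)] Ck_on_has_derivative[OF Suc.prems(2)]
        in \<open>auto intro: has_derivative_add\<close>)
qed

lemma Ck_on_sum:
  assumes "open S" "\<And>i. i \<in> I \<Longrightarrow> Ck_on m S (f i)"
  shows "Ck_on m S (\<lambda>x. \<Sum>i\<in>I. f i x)"
  using assms(2)
  by (induction I rule: infinite_finite_induct) (auto intro: Ck_on_add[OF assms(1)] Ck_on_const)

lemma Ck_on_bounded_bilinear:
  assumes "open S" "bounded_bilinear p" "Ck_on m S f" "Ck_on m S g"
  shows "Ck_on m S (\<lambda>x. p (f x) (g x))"
  using assms(3,4)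
proof (induction m arbitrary: f g)
  case 0
  then show ?case using bounded_bilinear.continuous_on[OF assms(2)] by auto
next
  case (Suc m)
  show ?case
  proof (rule Ck_on_SucI[OF assms(1) bounded_bilinear.FDERIV[OF assms(2)]])
    show "(f has_derivative frechet_derivative f (at x)) (at x)"
         "(g has_derivative frechet_derivative g (at x)) (at x)" if "x \<in> S" for x
      using that Suc.prems Ck_on_has_derivative by blast+
    show "Ck_on m S (\<lambda>x. p (f x) (frechet_derivative g (at x) v) +
                           p (frechet_derivative f (at x) v) (g x))" for v
      by (intro Ck_on_add[OF assms(1)] Suc.IH)
        (use Suc.prems Ck_on_SucD in auto)
  qed
qed

lemma linear_basis_expansion:
  fixes L :: "'e::euclidean_space \<Rightarrow> 'f::real_vector"
  assumes "linear L"
  shows "L v = (\<Sum>b\<in>Basis. (v \<bullet> b) *\<^sub>R L b)"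
  by (metis (mono_tags, lifting) assms euclidean_representation linear_cmul linear_sum sum.cong)

text \<open>
  The derivative of a composite in a fixed direction is a sum of products of functions of one
  order of smoothness less; expanding the inner derivative in a basis brings the
  composite \<open>(\<lambda>y. frechet_derivative f (at y) b) \<circ> g\<close> within reach of the induction hypothesis.
\<close>

lemma Ck_on_compose:
  fixes f :: "'e::euclidean_space \<Rightarrow> 'f::real_normed_vector"
  assumes "open S" "open T" "g ` S \<subseteq> T" "Ck_on m S g" "Ck_on m T f"
  shows "Ck_on m S (\<lambda>x. f (g x))"
  using assms(4,5)
proof (induction m arbitrary: f)
  case 0
  then show ?case using assms(3) continuous_on_compose2 by auto
next
  case (Suc m)
  have lin: "linear (frechet_derivative f (at (g x)))" if "x \<in> S" for x
    using Suc.prems that assms(3) by (auto simp: image_subset_iff intro!: linear_frechet_derivative)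
  show ?case
  proof (rule Ck_on_SucI[OF assms(1)])
    fix x assume x: "x \<in> S"
    show "((\<lambda>x. f (g x)) has_derivative
           (\<lambda>v. \<Sum>b\<in>Basis. (frechet_derivative g (at x) v \<bullet> b) *\<^sub>R
                             frechet_derivative f (at (g x)) b)) (at x)"
      unfolding linear_basis_expansion[OF lin[OF x], symmetric]
      using has_derivative_compose[of g "frechet_derivative g (at x)" x UNIV f]
        Ck_on_has_derivative[OF Suc.prems(1) x] Ck_on_has_derivative[OF Suc.prems(2)] x assms(3)
      by blast
  next
    fix v
    show "Ck_on m S (\<lambda>x. \<Sum>b\<in>Basis. (frechet_derivative g (at x) v \<bullet> b) *\<^sub>R
                                   frechet_derivative f (at (g x)) b)"
      by (intro Ck_on_sum Ck_on_bounded_bilinear[OF _ bounded_bilinear_scaleR]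
          Ck_on_bounded_linear[OF _ bounded_linear_inner_left] Suc.IH Ck_on_SucD[OF Suc.prems(1)])
        (use Suc.prems assms(1) in auto)
  qed
qed

lemma smooth_on_cong:
  "open S \<Longrightarrow> (\<And>x. x \<in> S \<Longrightarrow> f x = g x) \<Longrightarrow> smooth_on S f \<Longrightarrow> smooth_on S g"
  unfolding smooth_on_def using Ck_on_cong by blast

lemma smooth_on_subset: "T \<subseteq> S \<Longrightarrow> smooth_on S f \<Longrightarrow> smooth_on T f"
proof -
  have "T \<subseteq> S \<Longrightarrow> Ck_on m S f \<Longrightarrow> Ck_on m T f" for m
    by (induction m arbitrary: f) (auto intro: continuous_on_subset)
  then show "T \<subseteq> S \<Longrightarrow> smooth_on S f \<Longrightarrow> smooth_on T f"
    unfolding smooth_on_def by blast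
qed

lemma smooth_on_Un:
  assumes "open S" "open T" "smooth_on S f" "smooth_on T f"
  shows "smooth_on (S \<union> T) f"
proof -
  have "Ck_on m S f \<Longrightarrow> Ck_on m T f \<Longrightarrow> Ck_on m (S \<union> T) f" for m
    by (induction m arbitrary: f) (auto intro: continuous_on_open_Un assms)
  then show ?thesis using assms unfolding smooth_on_def by blast
qed

lemma smooth_on_differentiable: "smooth_on S f \<Longrightarrow> x \<in> S \<Longrightarrow> f differentiable (at x)"
  unfolding smooth_on_def by (metis Ck_on.simps(2))

lemma smooth_on_has_derivative:
  "smooth_on S f \<Longrightarrow> x \<in> S \<Longrightarrow> (f has_derivative frechet_derivative f (at x)) (at x)"
  using smooth_on_differentiable frechet_derivative_works by blast

lemma smooth_on_linear_derivative:
  "smooth_on S f \<Longrightarrow> x \<in> S \<Longrightarrow> linear (frechet_derivative f (at x))"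
  using smooth_on_differentiable linear_frechet_derivative by blast

lemma smooth_on_continuous: "smooth_on S f \<Longrightarrow> continuous_on S f"
  unfolding smooth_on_def by (metis Ck_on.simps(1))

lemma smooth_on_frechet:
  "smooth_on S f \<Longrightarrow> smooth_on S (\<lambda>x. frechet_derivative f (at x) v)"
  unfolding smooth_on_def by (metis Ck_on.simps(2))

lemma smooth_on_const: "smooth_on S (\<lambda>x. c)"
  unfolding smooth_on_def using Ck_on_const by blast

lemma smooth_on_bounded_linear:
  "open S \<Longrightarrow> bounded_linear L \<Longrightarrow> smooth_on S f \<Longrightarrow> smooth_on S (\<lambda>x. L (f x))"
  unfolding smooth_on_def using Ck_on_bounded_linear by blast

lemma smooth_on_ident: "smooth_on S (\<lambda>x. x)"
proof -
  have "Ck_on m S (\<lambda>x::'a. x)" for m by (cases m) (auto simp: Ck_on_const)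
  then show ?thesis by (simp add: smooth_on_def)
qed

lemma smooth_on_add:
  "open S \<Longrightarrow> smooth_on S f \<Longrightarrow> smooth_on S g \<Longrightarrow> smooth_on S (\<lambda>x. f x + g x)"
  unfolding smooth_on_def using Ck_on_add by blast

lemma smooth_on_uminus: "open S \<Longrightarrow> smooth_on S f \<Longrightarrow> smooth_on S (\<lambda>x. - f x)"
  using smooth_on_bounded_linear[OF _ bounded_linear_minus[OF bounded_linear_ident]] .

lemma smooth_on_diff:
  "open S \<Longrightarrow> smooth_on S f \<Longrightarrow> smooth_on S g \<Longrightarrow> smooth_on S (\<lambda>x. f x - g x)"
  using smooth_on_add[of S f "\<lambda>x. - g x"] smooth_on_uminus[of S g] by simp

lemma smooth_on_sum:
  "open S \<Longrightarrow> (\<And>i. i \<in> I \<Longrightarrow> smooth_on S (f i)) \<Longrightarrow> smooth_on S (\<lambda>x. \<Sum>i\<in>I. f i x)"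
  unfolding smooth_on_def by (intro allI Ck_on_sum) auto

lemma smooth_on_scaleR:
  "open S \<Longrightarrow> smooth_on S f \<Longrightarrow> smooth_on S g \<Longrightarrow> smooth_on S (\<lambda>x. f x *\<^sub>R g x)"
  unfolding smooth_on_def using Ck_on_bounded_bilinear[OF _ bounded_bilinear_scaleR] by blast

lemma smooth_on_mult:
  fixes f g :: "'e::euclidean_space \<Rightarrow> real"
  shows "open S \<Longrightarrow> smooth_on S f \<Longrightarrow> smooth_on S g \<Longrightarrow> smooth_on S (\<lambda>x. f x * g x)"
  using smooth_on_scaleR[of S f g] by simp

lemma smooth_on_compose:
  fixes f :: "'e::euclidean_space \<Rightarrow> 'f::real_normed_vector"
  shows "open S \<Longrightarrow> open T \<Longrightarrow> g ` S \<subseteq> T \<Longrightarrow> smooth_on S g \<Longrightarrow> smooth_on T f \<Longrightarrow>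
    smooth_on S (\<lambda>x. f (g x))"
  unfolding smooth_on_def using Ck_on_compose by blast

lemma smooth_on_fst: "open S \<Longrightarrow> smooth_on S f \<Longrightarrow> smooth_on S (\<lambda>x. fst (f x))"
  using smooth_on_bounded_linear[OF _ bounded_linear_fst] .

lemma smooth_on_snd: "open S \<Longrightarrow> smooth_on S f \<Longrightarrow> smooth_on S (\<lambda>x. snd (f x))"
  using smooth_on_bounded_linear[OF _ bounded_linear_snd] .

lemma smooth_on_nth: "open S \<Longrightarrow> smooth_on S f \<Longrightarrow> smooth_on S (\<lambda>x. f x $ i)"
  using smooth_on_bounded_linear[OF _ bounded_linear_vec_nth] .

lemma smooth_on_Pair:
  assumes "open S" "smooth_on S f" "smooth_on S g"
  shows "smooth_on S (\<lambda>x. (f x, g x))"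
proof -
  have "smooth_on S (\<lambda>x. (f x, 0) + (0, g x))"
    by (intro smooth_on_add smooth_on_bounded_linear[where L = "\<lambda>a. (a, 0)"]
        smooth_on_bounded_linear[where L = "\<lambda>a. (0, a)"] assms
        bounded_linear_Pair bounded_linear_ident bounded_linear_zero)
  then show ?thesis by simp
qed

lemma smooth_on_frechet_apply:
  fixes f :: "'e::euclidean_space \<Rightarrow> 'f::real_normed_vector"
  assumes "open S" "smooth_on S f" "smooth_on S g"
  shows "smooth_on S (\<lambda>x. frechet_derivative f (at x) (g x))"
proof (rule smooth_on_cong[OF assms(1)])
  show "smooth_on S (\<lambda>x. \<Sum>b\<in>Basis. (g x \<bullet> b) *\<^sub>R frechet_derivative f (at x) b)"
    by (intro smooth_on_sum smooth_on_scaleR smooth_on_frechet assms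
        smooth_on_bounded_linear[OF _ bounded_linear_inner_left])
  show "(\<Sum>b\<in>Basis. (g x \<bullet> b) *\<^sub>R frechet_derivative f (at x) b) = frechet_derivative f (at x) (g x)"
    if "x \<in> S" for x
    using linear_basis_expansion[OF smooth_on_linear_derivative[OF assms(2) that], symmetric] .
qed

lemmas smooth_intros =
  smooth_on_const smooth_on_ident smooth_on_add smooth_on_diff smooth_on_uminus smooth_on_sum
  smooth_on_scaleR smooth_on_mult smooth_on_fst smooth_on_snd smooth_on_nth smooth_on_Pair

lemma smooth_on_dy: "smooth_on S f \<Longrightarrow> smooth_on S (dy j f)"
  unfolding dy_def[abs_def] by (rule smooth_on_frechet)

lemma has_derivative_dir:
  fixes f :: "'a::real_normed_vector \<Rightarrow> real"
  assumes "(f has_derivative f') (at (x + t *\<^sub>R u))"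
  shows "((\<lambda>t. f (x + t *\<^sub>R u)) has_real_derivative f' u) (at t)"
proof -
  have "((\<lambda>t. f (x + t *\<^sub>R u)) has_derivative (\<lambda>h. f' (h *\<^sub>R u))) (at t)"
    by (rule has_derivative_compose[of "\<lambda>t. x + t *\<^sub>R u" "\<lambda>h. h *\<^sub>R u" t UNIV f f'])
       (auto intro!: derivative_eq_intros assms)
  moreover have "f' (h *\<^sub>R u) = h * f' u" for h
    using assms by (metis has_derivative_linear linear_cmul real_scaleR_def)
  ultimately show ?thesis by (simp add: has_field_derivative_def mult.commute[of _ "f' u"])
qed

text \<open>
  The second difference of \<open>f\<close> over the parallelogram with sides \<open>s u\<close> and \<open>s v\<close> is, by two
  applications of the mean value theorem, \<open>s\<^sup>2\<close> times a value of the mixed second derivative.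
\<close>

lemma second_difference:
  fixes f :: "'e::euclidean_space \<Rightarrow> real"
  assumes f: "smooth_on S f" and s: "0 < s"
    and sub: "\<And>a b. 0 \<le> a \<Longrightarrow> a \<le> s \<Longrightarrow> 0 \<le> b \<Longrightarrow> b \<le> s \<Longrightarrow> x + a *\<^sub>R u + b *\<^sub>R v \<in> S"
  shows "\<exists>a b. 0 \<le> a \<and> a \<le> s \<and> 0 \<le> b \<and> b \<le> s \<and>
    f (x + s *\<^sub>R u + s *\<^sub>R v) - f (x + s *\<^sub>R u) - f (x + s *\<^sub>R v) + f x =
    s * s * frechet_derivative (\<lambda>z. frechet_derivative f (at z) u) (at (x + a *\<^sub>R u + b *\<^sub>R v)) v"
proof -
  let ?D = "\<lambda>z. frechet_derivative f (at z) u"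
  let ?g = "\<lambda>t. f (x + s *\<^sub>R v + t *\<^sub>R u) - f (x + t *\<^sub>R u)"
  \<comment> \<open>the difference in direction \<open>v\<close>, as a function of the displacement along \<open>u\<close>\<close>
  have "\<exists>a>0. a < s \<and> ?g s - ?g 0 = (s - 0) * (?D (x + s *\<^sub>R v + a *\<^sub>R u) - ?D (x + a *\<^sub>R u))"
  proof (rule MVT2[OF s])
    fix a assume a: "0 \<le> a" "a \<le> s"
    show "(?g has_real_derivative (?D (x + s *\<^sub>R v + a *\<^sub>R u) - ?D (x + a *\<^sub>R u))) (at a)"
      by (intro DERIV_diff has_derivative_dir smooth_on_has_derivative[OF f])
        (use sub[of a s] sub[of a 0] a s in \<open>auto simp: algebra_simps\<close>)
  qed
  then obtain a where a: "0 < a" "a < s"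
    "?g s - ?g 0 = s * (?D (x + a *\<^sub>R u + s *\<^sub>R v) - ?D (x + a *\<^sub>R u))"
    by (auto simp: algebra_simps)
  have "\<exists>b>0. b < s \<and> ?D (x + a *\<^sub>R u + s *\<^sub>R v) - ?D (x + a *\<^sub>R u + 0 *\<^sub>R v) =
           (s - 0) * frechet_derivative ?D (at (x + a *\<^sub>R u + b *\<^sub>R v)) v"
    by (rule MVT2[OF s])
      (intro has_derivative_dir smooth_on_has_derivative[OF smooth_on_frechet[OF f]] sub,
        use a in auto)
  then obtain b where "0 < b" "b < s" "?D (x + a *\<^sub>R u + s *\<^sub>R v) - ?D (x + a *\<^sub>R u) =
           s * frechet_derivative ?D (at (x + a *\<^sub>R u + b *\<^sub>R v)) v" by auto
  with a show ?thesis
    by (intro exI[of _ a] exI[of _ b]) (auto simp: algebra_simps)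
qed

lemma symmetric_second_derivative_real:
  fixes f :: "'e::euclidean_space \<Rightarrow> real"
  assumes "open S" "smooth_on S f" "x \<in> S"
  shows "frechet_derivative (\<lambda>z. frechet_derivative f (at z) u) (at x) v =
         frechet_derivative (\<lambda>z. frechet_derivative f (at z) v) (at x) u" (is "?F x = ?G x")
proof (rule ccontr)
  assume ne: "?F x \<noteq> ?G x"
  define e where "e = \<bar>?F x - ?G x\<bar> / 2"
  have e: "e > 0" using ne by (simp add: e_def)
  have "smooth_on S ?F" "smooth_on S ?G"
    by (intro smooth_on_frechet assms)+
  then have "isCont ?F x" "isCont ?G x"
    using assms smooth_on_continuous continuous_on_eq_continuous_at by blast+
  then obtain d1 d2 where d: "d1 > 0" "d2 > 0"
      "\<And>y. dist y x < d1 \<Longrightarrow> \<bar>?F y - ?F x\<bar> < e" "\<And>y. dist y x < d2 \<Longrightarrow> \<bar>?G y - ?G x\<bar> < e"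
    using e unfolding continuous_at_eps_delta dist_real_def by metis
  obtain d3 where d3: "d3 > 0" "ball x d3 \<subseteq> S" using assms open_contains_ball by blast
  define d where "d = min d1 (min d2 d3)"
  \<comment> \<open>small enough that the whole parallelogram stays where both derivatives are \<open>e\<close>-close to their values at \<open>x\<close>\<close>
  define N where "N = norm u + norm v + 1"
  define s where "s = d / (2 * N)"
  have dp: "d > 0" using d d3 by (simp add: d_def)
  have pos: "N > 0" by (simp add: N_def add_nonneg_pos)
  have s: "s > 0" using dp pos by (simp add: s_def)
  have close: "dist (x + a *\<^sub>R u + b *\<^sub>R v) x < d" if "0 \<le> a" "a \<le> s" "0 \<le> b" "b \<le> s" for a b
  proof -
    have "dist (x + a *\<^sub>R u + b *\<^sub>R v) x = norm (a *\<^sub>R u + b *\<^sub>R v)"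
      by (simp add: dist_norm)
    also have "\<dots> \<le> a * norm u + b * norm v"
      using norm_triangle_ineq[of "a *\<^sub>R u" "b *\<^sub>R v"] that by simp
    also have "\<dots> \<le> s * norm u + s * norm v"
      using that by (intro add_mono mult_right_mono) auto
    also have "\<dots> \<le> s * N" using s by (simp add: N_def algebra_simps)
    also have "\<dots> = d / 2" using pos by (simp add: s_def)
    also have "\<dots> < d" using dp by simp
    finally show ?thesis .
  qed
  have sub: "x + a *\<^sub>R u + b *\<^sub>R v \<in> S" if "0 \<le> a" "a \<le> s" "0 \<le> b" "b \<le> s" for a b
    using close[OF that] d3 by (auto simp: d_def dist_commute)
  have sub': "x + a *\<^sub>R v + b *\<^sub>R u \<in> S" if "0 \<le> a" "a \<le> s" "0 \<le> b" "b \<le> s" for a b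
    using sub[OF that(3,4,1,2)] by (simp add: algebra_simps)
  obtain a b where ab: "0 \<le> a" "a \<le> s" "0 \<le> b" "b \<le> s"
    "f (x + s *\<^sub>R u + s *\<^sub>R v) - f (x + s *\<^sub>R u) - f (x + s *\<^sub>R v) + f x = s * s * ?F (x + a *\<^sub>R u + b *\<^sub>R v)"
    using second_difference[OF assms(2) s sub] by blast
  obtain a' b' where ab': "0 \<le> a'" "a' \<le> s" "0 \<le> b'" "b' \<le> s"
    "f (x + s *\<^sub>R v + s *\<^sub>R u) - f (x + s *\<^sub>R v) - f (x + s *\<^sub>R u) + f x = s * s * ?G (x + a' *\<^sub>R v + b' *\<^sub>R u)"
    using second_difference[OF assms(2) s sub'] by blast
  \<comment> \<open>both are the same second difference, read in the two orders\<close>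
  have "s * s * ?F (x + a *\<^sub>R u + b *\<^sub>R v) = s * s * ?G (x + b' *\<^sub>R u + a' *\<^sub>R v)"
    using ab(5) ab'(5) by (simp add: algebra_simps)
  then have "?F (x + a *\<^sub>R u + b *\<^sub>R v) = ?G (x + b' *\<^sub>R u + a' *\<^sub>R v)" using s by simp
  moreover have "\<bar>?F (x + a *\<^sub>R u + b *\<^sub>R v) - ?F x\<bar> < e" "\<bar>?G (x + b' *\<^sub>R u + a' *\<^sub>R v) - ?G x\<bar> < e"
    using d(3,4) close ab ab' by (auto simp: d_def)
  ultimately have "\<bar>?F x - ?G x\<bar> < 2 * e" by arith
  then show False by (simp add: e_def)
qed

text \<open>
  Components reduce the vector-valued case to the real one.
\<close>

lemma symmetric_second_derivative:
  fixes f :: "'e::euclidean_space \<Rightarrow> 'f::euclidean_space"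
  assumes S: "open S" and f: "smooth_on S f" and x: "x \<in> S"
  shows "frechet_derivative (\<lambda>z. frechet_derivative f (at z) u) (at x) v =
         frechet_derivative (\<lambda>z. frechet_derivative f (at z) v) (at x) u"
proof (rule euclidean_eqI)
  fix b :: 'f assume "b \<in> Basis"
  let ?fb = "\<lambda>z. f z \<bullet> b"
  have comp: "frechet_derivative (\<lambda>z. g z \<bullet> b) (at z) w = frechet_derivative g (at z) w \<bullet> b"
    if "smooth_on S g" "z \<in> S" for g :: "'e \<Rightarrow> 'f" and z w
    using frechet_derivative_eqI[OF bounded_linear.has_derivative[OF bounded_linear_inner_left
          smooth_on_has_derivative[OF that]]] by simp
  have fb: "smooth_on S ?fb"
    using smooth_on_bounded_linear[OF S bounded_linear_inner_left f] .
  have two: "frechet_derivative (\<lambda>z. frechet_derivative f (at z) u) (at x) v \<bullet> b =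
      frechet_derivative (\<lambda>z. frechet_derivative ?fb (at z) u) (at x) v" for u v
  proof -
    have "frechet_derivative (\<lambda>z. frechet_derivative f (at z) u) (at x) v \<bullet> b =
        frechet_derivative (\<lambda>z. frechet_derivative f (at z) u \<bullet> b) (at x) v"
      by (simp add: comp smooth_on_frechet f x)
    also have "((\<lambda>z. frechet_derivative ?fb (at z) u) has_derivative
        frechet_derivative (\<lambda>z. frechet_derivative f (at z) u \<bullet> b) (at x)) (at x)"
      by (rule has_derivative_transform_within_open[OF smooth_on_has_derivative[OF
              smooth_on_bounded_linear[OF S bounded_linear_inner_left smooth_on_frechet[OF f]] x] S x])
        (simp add: comp f)
    from frechet_derivative_eqI[OF this, symmetric]
    have "frechet_derivative (\<lambda>z. frechet_derivative f (at z) u \<bullet> b) (at x) v =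
       frechet_derivative (\<lambda>z. frechet_derivative ?fb (at z) u) (at x) v" by simp
    finally show ?thesis .
  qed
  show "frechet_derivative (\<lambda>z. frechet_derivative f (at z) u) (at x) v \<bullet> b =
        frechet_derivative (\<lambda>z. frechet_derivative f (at z) v) (at x) u \<bullet> b"
    using symmetric_second_derivative_real[OF S fb x] by (simp add: two)
qed

lemma frechet_derivative_cong:
  assumes "open S" "x \<in> S" "\<And>z. z \<in> S \<Longrightarrow> f z = g z"
  shows "frechet_derivative f (at x) = frechet_derivative g (at x)"
proof -
  have "(f has_derivative D) (at x) \<longleftrightarrow> (g has_derivative D) (at x)" for D
    using has_derivative_transform_within_open[OF _ assms(1,2), of f D UNIV g]
      has_derivative_transform_within_open[OF _ assms(1,2), of g D UNIV f] assms(3) by auto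
  then show ?thesis by (simp add: frechet_derivative_def)
qed

section \<open>Naturality of the Lie and exterior derivatives\<close>

lemma bilinear_basis_expansion:
  fixes F :: "'e::euclidean_space \<Rightarrow> 'e \<Rightarrow> real"
  assumes "bilinear F"
  shows "F a b = (\<Sum>c\<in>Basis. \<Sum>d\<in>Basis. (a \<bullet> c) * (b \<bullet> d) * F c d)"
proof -
  have "F a b = (\<Sum>c\<in>Basis. (a \<bullet> c) * F c b)"
    using linear_basis_expansion[of "\<lambda>a. F a b" a] assms by (simp add: bilinear_def)
  also have "\<dots> = (\<Sum>c\<in>Basis. (a \<bullet> c) * (\<Sum>d\<in>Basis. (b \<bullet> d) * F c d))"
    using linear_basis_expansion[of "F _" b] assms by (simp add: bilinear_def)
  finally show ?thesis by (simp add: sum_distrib_left mult.assoc)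
qed

text \<open>
  The Leibniz rule for a family of bilinear forms. Expansion in a basis reduces it to products of
  real functions, so only the coefficients \<open>\<lambda>x. F x a b\<close> have to be differentiable.
\<close>

lemma has_derivative_bilinear_family:
  fixes F :: "'w::euclidean_space \<Rightarrow> 'e::euclidean_space \<Rightarrow> 'e \<Rightarrow> real"
  assumes W: "open W" "z \<in> W" and bil: "\<And>x. x \<in> W \<Longrightarrow> bilinear (F x)"
    and F: "\<And>a b. (\<lambda>x. F x a b) differentiable (at z)"
    and \<alpha>: "(\<alpha> has_derivative \<alpha>') (at z)" and \<beta>: "(\<beta> has_derivative \<beta>') (at z)"
  shows "((\<lambda>x. F x (\<alpha> x) (\<beta> x)) has_derivative
     (\<lambda>w. frechet_derivative (\<lambda>x. F x (\<alpha> z) (\<beta> z)) (at z) w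
          + F z (\<alpha>' w) (\<beta> z) + F z (\<alpha> z) (\<beta>' w))) (at z)"
proof -
  define G where "G c d = frechet_derivative (\<lambda>x. F x c d) (at z)" for c d
  have G: "((\<lambda>x. F x c d) has_derivative G c d) (at z)" for c d
    using F by (simp add: G_def frechet_derivative_works)
  note expand = bilinear_basis_expansion[OF bil]
  have D: "((\<lambda>x. F x (\<alpha> x) (\<beta> x)) has_derivative
      (\<lambda>w. \<Sum>c\<in>Basis. \<Sum>d\<in>Basis. (\<alpha> z \<bullet> c) * (\<beta> z \<bullet> d) * G c d w
          + ((\<alpha> z \<bullet> c) * (\<beta>' w \<bullet> d) + (\<alpha>' w \<bullet> c) * (\<beta> z \<bullet> d)) * F z c d)) (at z)"
    if \<alpha>: "(\<alpha> has_derivative \<alpha>') (at z)" and \<beta>: "(\<beta> has_derivative \<beta>') (at z)" for \<alpha> \<beta> \<alpha>' \<beta>'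
  proof (rule has_derivative_transform_within_open[OF _ W])
    show "((\<lambda>x. \<Sum>c\<in>Basis. \<Sum>d\<in>Basis. (\<alpha> x \<bullet> c) * (\<beta> x \<bullet> d) * F x c d) has_derivative
      (\<lambda>w. \<Sum>c\<in>Basis. \<Sum>d\<in>Basis. (\<alpha> z \<bullet> c) * (\<beta> z \<bullet> d) * G c d w
          + ((\<alpha> z \<bullet> c) * (\<beta>' w \<bullet> d) + (\<alpha>' w \<bullet> c) * (\<beta> z \<bullet> d)) * F z c d)) (at z)"
      by (intro has_derivative_sum has_derivative_mult has_derivative_inner_left \<alpha> \<beta> G)
  qed (simp add: expand[symmetric])
  have "frechet_derivative (\<lambda>x. F x (\<alpha> z) (\<beta> z)) (at z) w =
      (\<Sum>c\<in>Basis. \<Sum>d\<in>Basis. (\<alpha> z \<bullet> c) * (\<beta> z \<bullet> d) * G c d w)" for w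
    using D[OF has_derivative_const has_derivative_const, of "\<alpha> z" "\<beta> z"] frechet_derivative_eqI
    by fastforce
  moreover have "F z (\<alpha>' w) (\<beta> z) = (\<Sum>c\<in>Basis. \<Sum>d\<in>Basis. (\<alpha>' w \<bullet> c) * (\<beta> z \<bullet> d) * F z c d)"
    "F z (\<alpha> z) (\<beta>' w) = (\<Sum>c\<in>Basis. \<Sum>d\<in>Basis. (\<alpha> z \<bullet> c) * (\<beta>' w \<bullet> d) * F z c d)" for w
    by (rule expand[OF W(2)])+
  ultimately have "(\<lambda>w. frechet_derivative (\<lambda>x. F x (\<alpha> z) (\<beta> z)) (at z) w
          + F z (\<alpha>' w) (\<beta> z) + F z (\<alpha> z) (\<beta>' w)) =
      (\<lambda>w. \<Sum>c\<in>Basis. \<Sum>d\<in>Basis. (\<alpha> z \<bullet> c) * (\<beta> z \<bullet> d) * G c d w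
          + ((\<alpha> z \<bullet> c) * (\<beta>' w \<bullet> d) + (\<alpha>' w \<bullet> c) * (\<beta> z \<bullet> d)) * F z c d)"
    by (simp add: sum.distrib algebra_simps)
  then show ?thesis using D[OF \<alpha> \<beta>] by simp
qed

lemma has_derivative_frechet_apply:
  fixes T :: "'e::euclidean_space \<Rightarrow> 'f::real_normed_vector"
  assumes W: "open W" "z \<in> W" and T: "smooth_on W T" and \<xi>: "(\<xi> has_derivative \<xi>') (at z)"
  shows "((\<lambda>x. frechet_derivative T (at x) (\<xi> x)) has_derivative
     (\<lambda>w. frechet_derivative (\<lambda>x. frechet_derivative T (at x) (\<xi> z)) (at z) w
          + frechet_derivative T (at z) (\<xi>' w))) (at z)"
proof -
  define G where "G b = frechet_derivative (\<lambda>x. frechet_derivative T (at x) b) (at z)" for b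
  have G: "((\<lambda>x. frechet_derivative T (at x) b) has_derivative G b) (at z)" for b
    unfolding G_def by (intro smooth_on_has_derivative[OF _ W(2)] smooth_on_frechet T)
  note expand = linear_basis_expansion[OF smooth_on_linear_derivative[OF T]]
  have D: "((\<lambda>x. frechet_derivative T (at x) (\<xi> x)) has_derivative
      (\<lambda>w. \<Sum>b\<in>Basis. (\<xi> z \<bullet> b) *\<^sub>R G b w + (\<xi>' w \<bullet> b) *\<^sub>R frechet_derivative T (at z) b)) (at z)"
    if \<xi>: "(\<xi> has_derivative \<xi>') (at z)" for \<xi> \<xi>'
  proof (rule has_derivative_transform_within_open[OF _ W])
    show "((\<lambda>x. \<Sum>b\<in>Basis. (\<xi> x \<bullet> b) *\<^sub>R frechet_derivative T (at x) b) has_derivative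
      (\<lambda>w. \<Sum>b\<in>Basis. (\<xi> z \<bullet> b) *\<^sub>R G b w + (\<xi>' w \<bullet> b) *\<^sub>R frechet_derivative T (at z) b)) (at z)"
      by (intro has_derivative_sum has_derivative_scaleR has_derivative_inner_left \<xi> G)
  qed (simp add: expand[symmetric])
  have "frechet_derivative (\<lambda>x. frechet_derivative T (at x) (\<xi> z)) (at z) w =
      (\<Sum>b\<in>Basis. (\<xi> z \<bullet> b) *\<^sub>R G b w)" for w
    using D[OF has_derivative_const, of "\<xi> z"] frechet_derivative_eqI by fastforce
  moreover have "frechet_derivative T (at z) (\<xi>' w) =
      (\<Sum>b\<in>Basis. (\<xi>' w \<bullet> b) *\<^sub>R frechet_derivative T (at z) b)" for w
    by (rule expand[OF W(2)])
  ultimately show ?thesis using D[OF \<xi>] by (simp add: sum.distrib)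
qed

text \<open>
  A change of coordinates \<open>T\<close> relates the components of a form in two charts in this way. It lets
  the vanishing of a Lie or exterior derivative be verified in one chart and concluded in
  all others.
\<close>

locale pulled_back_form =
  fixes W :: "'e::euclidean_space set" and W' :: "'e set" and T :: "'e \<Rightarrow> 'e"
    and \<omega> \<omega>' :: "'e \<Rightarrow> 'e \<Rightarrow> 'e \<Rightarrow> real"
  assumes W: "open W" "open W'" and T: "smooth_on W T" "T ` W \<subseteq> W'"
    and bil: "\<And>y. y \<in> W' \<Longrightarrow> bilinear (\<omega>' y)"
    and smooth: "\<And>u v. smooth_on W' (\<lambda>y. \<omega>' y u v)"
    and pull: "\<And>x u v. x \<in> W \<Longrightarrow>
      \<omega> x u v = \<omega>' (T x) (frechet_derivative T (at x) u) (frechet_derivative T (at x) v)"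
begin

abbreviation "DT \<equiv> \<lambda>x. frechet_derivative T (at x)"
abbreviation "D2T \<equiv> \<lambda>x u. frechet_derivative (\<lambda>x. frechet_derivative T (at x) u) (at x)"

lemma pulled_back_derivative:
  assumes z: "z \<in> W"
  shows "frechet_derivative (\<lambda>x. \<omega> x u v) (at z) w =
    frechet_derivative (\<lambda>y. \<omega>' y (DT z u) (DT z v)) (at (T z)) (DT z w)
    + \<omega>' (T z) (D2T z u w) (DT z v) + \<omega>' (T z) (DT z u) (D2T z v w)"
proof -
  have Tz: "T z \<in> W'" using T z by blast
  have D: "((\<lambda>x. \<omega>' (T x) a b) has_derivative
       (\<lambda>w. frechet_derivative (\<lambda>y. \<omega>' y a b) (at (T z)) (DT z w))) (at z)" for a b
    using has_derivative_compose[OF smooth_on_has_derivative[OF T(1) z]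
        smooth_on_has_derivative[OF smooth Tz]] .
  then have diff: "(\<lambda>x. \<omega>' (T x) a b) differentiable (at z)" for a b
    unfolding differentiable_def by blast
  have "((\<lambda>x. \<omega>' (T x) (DT x u) (DT x v)) has_derivative
     (\<lambda>w. frechet_derivative (\<lambda>x. \<omega>' (T x) (DT z u) (DT z v)) (at z) w
          + \<omega>' (T z) (D2T z u w) (DT z v) + \<omega>' (T z) (DT z u) (D2T z v w))) (at z)"
    by (rule has_derivative_bilinear_family[OF W(1) z])
      (use bil T diff in \<open>auto intro!: smooth_on_has_derivative[OF _ z] smooth_on_frechet\<close>)
  then have "((\<lambda>x. \<omega> x u v) has_derivative
     (\<lambda>w. frechet_derivative (\<lambda>x. \<omega>' (T x) (DT z u) (DT z v)) (at z) w
          + \<omega>' (T z) (D2T z u w) (DT z v) + \<omega>' (T z) (DT z u) (D2T z v w))) (at z)"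
    by (rule has_derivative_transform_within_open[OF _ W(1) z]) (simp add: pull)
  then show ?thesis
    by (simp add: frechet_derivative_eqI[OF D] frechet_derivative_eqI)
qed

lemma bilinear_pulled_back:
  assumes z: "z \<in> W"
  shows "bilinear (\<omega> z)"
proof -
  have "linear (DT z)" using smooth_on_linear_derivative[OF T(1) z] .
  moreover have "bilinear (\<omega>' (T z))" using z T(2) bil by blast
  moreover have "\<omega> z = (\<lambda>u v. \<omega>' (T z) (DT z u) (DT z v))"
    using pull[OF z] by (intro ext)
  ultimately show ?thesis
    unfolding bilinear_def linear_iff by simp
qed

lemma smooth_pulled_back: "smooth_on W (\<lambda>z. \<omega> z u v)"
proof (rule smooth_on_cong[OF W(1)])
  show "smooth_on W (\<lambda>z. \<Sum>c\<in>Basis. \<Sum>d\<in>Basis. (DT z u \<bullet> c) * (DT z v \<bullet> d) * \<omega>' (T z) c d)"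
    by (intro smooth_intros W smooth_on_bounded_linear[OF W(1) bounded_linear_inner_left]
        smooth_on_frechet T smooth_on_compose[OF W T(2,1) smooth])
  fix z assume z: "z \<in> W"
  then have "bilinear (\<omega>' (T z))" using T(2) bil by blast
  from bilinear_basis_expansion[OF this, of "DT z u" "DT z v"]
  show "(\<Sum>c\<in>Basis. \<Sum>d\<in>Basis. (DT z u \<bullet> c) * (DT z v \<bullet> d) * \<omega>' (T z) c d) = \<omega> z u v"
    by (simp only: pull[OF z])
qed

lemma bilinear_rules:
  assumes "z \<in> W"
  shows "\<omega>' (T z) (a + b) c = \<omega>' (T z) a c + \<omega>' (T z) b c"
    "\<omega>' (T z) c (a + b) = \<omega>' (T z) c a + \<omega>' (T z) c b"
proof -
  have "bilinear (\<omega>' (T z))" using assms T(2) bil by blast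
  then show "\<omega>' (T z) (a + b) c = \<omega>' (T z) a c + \<omega>' (T z) b c"
    "\<omega>' (T z) c (a + b) = \<omega>' (T z) c a + \<omega>' (T z) c b"
    by (simp_all add: bilinear_ladd bilinear_radd)
qed

lemma D2T_commute: "z \<in> W \<Longrightarrow> D2T z u v = D2T z v u"
  using symmetric_second_derivative[OF W(1) T(1)] .

text \<open>
  Differentiating \<open>X' \<circ> T = DT X\<close> gives a second derivative of \<open>T\<close> along \<open>X\<close> and \<open>u\<close>; by symmetry it is
  the one that arises from differentiating \<open>DT u\<close> along \<open>X\<close> in the pulled back form.
\<close>

lemma lie_derivative_form_pulled_back:
  assumes X: "smooth_on W X" and X': "smooth_on W' X'"
    and rel: "\<And>x. x \<in> W \<Longrightarrow> X' (T x) = DT x (X x)" and z: "z \<in> W"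
  shows "lie_derivative_form X \<omega> z u v = lie_derivative_form X' \<omega>' (T z) (DT z u) (DT z v)"
proof -
  have Tz: "T z \<in> W'" using T z by blast
  have X'DT: "frechet_derivative X' (at (T z)) (DT z w) =
      D2T z (X z) w + DT z (frechet_derivative X (at z) w)" for w
  proof -
    have "((\<lambda>x. X' (T x)) has_derivative
        (\<lambda>w. D2T z (X z) w + DT z (frechet_derivative X (at z) w))) (at z)"
      by (rule has_derivative_transform_within_open[OF has_derivative_frechet_apply[OF W(1) z T(1)
              smooth_on_has_derivative[OF X z]] W(1) z]) (simp add: rel)
    from has_derivative_unique[OF this has_derivative_compose[OF smooth_on_has_derivative[OF T(1) z]
          smooth_on_has_derivative[OF X' Tz]]]
    show ?thesis by metis
  qed
  show ?thesis
    unfolding lie_derivative_form_def pulled_back_derivative[OF z] X'DT pull[OF z] rel[OF z]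
      bilinear_rules[OF z] D2T_commute[OF z, of u "X z"] D2T_commute[OF z, of v "X z"]
    by (simp only: add_ac)
qed

text \<open>
  Each second derivative of \<open>T\<close> occurs twice, with opposite signs because the form is alternating.
\<close>

lemma exterior_derivative_pulled_back:
  assumes alt: "\<And>y u. y \<in> W' \<Longrightarrow> \<omega>' y u u = 0" and z: "z \<in> W"
  shows "exterior_derivative \<omega> z u v w = exterior_derivative \<omega>' (T z) (DT z u) (DT z v) (DT z w)"
proof -
  have alt: "\<omega>' (T z) a a = 0" for a using alt T(2) z by blast
  have anti: "\<omega>' (T z) a b = - \<omega>' (T z) b a" for a b
    using alt[of "a + b"] alt[of a] alt[of b] unfolding bilinear_rules[OF z] by linarith
  show ?thesis
    unfolding exterior_derivative_def pulled_back_derivative[OF z]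
    using D2T_commute[OF z, of v u] D2T_commute[OF z, of w u] D2T_commute[OF z, of w v]
      anti[of "DT z v" "D2T z w u"] anti[of "DT z u" "D2T z w v"] anti[of "DT z w" "D2T z u v"]
      anti[of "D2T z v u" "DT z w"] anti[of "D2T z u w" "DT z v"]
      anti[of "D2T z v w" "DT z u"]
    by simp
qed

end

section \<open>Charts, components of tensors, and the slit tangent bundle\<close>

text \<open>
  What is used of the charts is the same for the base manifold and for the slit tangent bundle,
  and does not involve a topology of the underlying set.
\<close>

locale smooth_atlas =
  fixes A :: "('a, 'e::euclidean_space) chart set"
  assumes inj: "k \<in> A \<Longrightarrow> inj_on (snd k) (fst k)"
    and open_overlap: "k \<in> A \<Longrightarrow> l \<in> A \<Longrightarrow> open (snd k ` (fst k \<inter> fst l))"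
    and smooth_transition:
      "k \<in> A \<Longrightarrow> l \<in> A \<Longrightarrow> smooth_on (snd k ` (fst k \<inter> fst l)) (transition k l)"
begin

lemma open_chart: "k \<in> A \<Longrightarrow> open (snd k ` fst k)"
  using open_overlap[of k k] by simp

lemma cinv_chart: "k \<in> A \<Longrightarrow> p \<in> fst k \<Longrightarrow> cinv k (snd k p) = p"
  by (simp add: cinv_def inj)

lemma transition_chart: "k \<in> A \<Longrightarrow> p \<in> fst k \<Longrightarrow> transition k l (snd k p) = snd l p"
  by (simp add: transition_def cinv_chart)

lemma transition_image: "k \<in> A \<Longrightarrow> transition k l ` snd k ` (fst k \<inter> fst l) \<subseteq> snd l ` fst l"
  by (auto simp: transition_chart)

lemma has_derivative_transition:
  assumes "k \<in> A" "l \<in> A" "p \<in> fst k" "p \<in> fst l"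
  shows "(transition k l has_derivative frechet_derivative (transition k l) (at (snd k p)))
    (at (snd k p))"
  by (rule smooth_on_has_derivative[OF smooth_transition[OF assms(1,2)]]) (use assms in auto)

lemma linear_transition:
  assumes "k \<in> A" "l \<in> A" "p \<in> fst k" "p \<in> fst l"
  shows "linear (frechet_derivative (transition k l) (at (snd k p)))"
  using has_derivative_linear[OF has_derivative_transition[OF assms]] .

lemma transition_self:
  assumes "k \<in> A" "p \<in> fst k"
  shows "frechet_derivative (transition k k) (at (snd k p)) u = u"
proof -
  have "frechet_derivative (transition k k) (at (snd k p)) =
      frechet_derivative (\<lambda>z. z) (at (snd k p))"
    by (rule frechet_derivative_cong[OF open_chart[OF assms(1)]])
      (use assms in \<open>auto simp: transition_chart\<close>)
  then show ?thesis by simp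
qed

text \<open>
  The chain rule for \<open>transition k m = transition l m \<circ> transition k l\<close>, an identity that
  holds near \<open>p\<close> only; it is what makes families of components consistent.
\<close>

lemma transition_cocycle:
  assumes "k \<in> A" "l \<in> A" "m \<in> A" "p \<in> fst k" "p \<in> fst l" "p \<in> fst m"
  shows "frechet_derivative (transition l m) (at (snd l p))
      (frechet_derivative (transition k l) (at (snd k p)) u) =
    frechet_derivative (transition k m) (at (snd k p)) u"
proof -
  let ?O = "snd k ` (fst k \<inter> fst l) \<inter> snd k ` (fst k \<inter> fst m)"
  have "((\<lambda>z. transition l m (transition k l z)) has_derivative
      (\<lambda>u. frechet_derivative (transition l m) (at (snd l p))
            (frechet_derivative (transition k l) (at (snd k p)) u))) (at (snd k p))"
    by (rule has_derivative_compose[OF has_derivative_transition])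
      (use assms has_derivative_transition[of l m p] in \<open>auto simp: transition_chart\<close>)
  then have "(transition k m has_derivative
      (\<lambda>u. frechet_derivative (transition l m) (at (snd l p))
            (frechet_derivative (transition k l) (at (snd k p)) u))) (at (snd k p))"
  proof (rule has_derivative_transform_within_open)
    show "open ?O" using assms open_overlap by blast
    show "snd k p \<in> ?O" using assms by blast
    fix z assume "z \<in> ?O"
    then obtain q where "z = snd k q" "q \<in> fst k" "q \<in> fst l"
      using assms(1) inj by blast
    then show "transition l m (transition k l z) = transition k m z"
      using assms by (simp add: transition_chart)
  qed
  then show ?thesis by (simp add: frechet_derivative_eqI)
qed

lemma tangent_of_apply:
  "k \<in> A \<Longrightarrow> l \<in> A \<Longrightarrow> p \<in> fst l \<Longrightarrow>
    tangent_of A k p u l = frechet_derivative (transition k l) (at (snd k p)) u"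
  by (simp add: tangent_of_def)

lemma tangent_of_self: "k \<in> A \<Longrightarrow> p \<in> fst k \<Longrightarrow> tangent_of A k p u k = u"
  by (simp add: tangent_of_apply transition_self)

lemma tangent_of_in: "k \<in> A \<Longrightarrow> p \<in> fst k \<Longrightarrow> tangent_of A k p u \<in> tangent_space A p"
  unfolding tangent_space_def by (auto simp: tangent_of_def intro: transition_cocycle[symmetric])

lemma tangent_space_apply:
  "v \<in> tangent_space A p \<Longrightarrow> k \<in> A \<Longrightarrow> l \<in> A \<Longrightarrow> p \<in> fst k \<Longrightarrow> p \<in> fst l \<Longrightarrow>
    v l = frechet_derivative (transition k l) (at (snd k p)) (v k)"
  unfolding tangent_space_def by blast

lemma tangent_space_outside:
  "v \<in> tangent_space A p \<Longrightarrow> k \<notin> A \<or> p \<notin> fst k \<Longrightarrow> v k = 0"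
  unfolding tangent_space_def by blast

lemma tangent_of_component:
  assumes "v \<in> tangent_space A p" "k \<in> A" "p \<in> fst k"
  shows "tangent_of A k p (v k) = v"
proof
  fix l
  show "tangent_of A k p (v k) l = v l"
    using tangent_space_apply[OF assms(1,2) _ assms(3), of l] tangent_space_outside[OF assms(1), of l]
    by (simp add: tangent_of_def)
qed

lemma zero_in_tangent_space: "(\<lambda>_. 0) \<in> tangent_space A p"
  using linear_0[OF linear_transition] by (auto simp: tangent_space_def)

lemma tangent_of_zero: "k \<in> A \<Longrightarrow> p \<in> fst k \<Longrightarrow> tangent_of A k p 0 = (\<lambda>_. 0)"
  using tangent_of_component[OF zero_in_tangent_space, of k] by simp

lemma tangent_of_transition:
  assumes "k \<in> A" "l \<in> A" "p \<in> fst k" "p \<in> fst l"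
  shows "tangent_of A l p (frechet_derivative (transition k l) (at (snd k p)) u) =
    tangent_of A k p u"
  using tangent_of_component[OF tangent_of_in[OF assms(1,3)] assms(2,4), of u] assms
  by (simp add: tangent_of_apply)

lemma field_rep_transition:
  assumes "k \<in> A" "l \<in> A" "p \<in> fst k" "p \<in> fst l" "X p \<in> tangent_space A p"
  shows "field_rep l X (transition k l (snd k p)) =
    frechet_derivative (transition k l) (at (snd k p)) (field_rep k X (snd k p))"
  using assms tangent_space_apply by (auto simp: field_rep_def transition_chart cinv_chart)

lemma form_on_tangent_space:
  assumes "k \<in> A" "p \<in> fst k" "X \<in> tangent_space A p" "Y \<in> tangent_space A p"
  shows "\<omega> p X Y = form_rep A k \<omega> (snd k p) (X k) (Y k)"
  using assms by (simp add: form_rep_def cinv_chart tangent_of_component)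

lemma smooth_on_transported_field:
  assumes k: "k \<in> A" and l: "l \<in> A" and u: "smooth_on (snd k ` fst k) u"
  shows "smooth_on (snd l ` (fst l \<inter> fst k))
    (\<lambda>z. frechet_derivative (transition k l) (at (transition l k z)) (u (transition l k z)))"
proof -
  note * = open_overlap[OF l k] open_overlap[OF k l] smooth_transition[OF l k]
  have sub: "transition l k ` snd l ` (fst l \<inter> fst k) \<subseteq> snd k ` (fst k \<inter> fst l)"
    using l by (auto simp: transition_chart)
  have "smooth_on (snd k ` (fst k \<inter> fst l)) (\<lambda>z. frechet_derivative (transition k l) (at z) (u z))"
    by (intro smooth_on_frechet_apply * smooth_transition k l smooth_on_subset[OF _ u]) auto
  then show ?thesis
    by (rule smooth_on_compose[OF *(1,2) sub *(3)])
qed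

end

lemma smooth_atlas_manifold:
  assumes "paracompact_manifold M A"
  shows "smooth_atlas A"
proof
  fix k l assume k: "k \<in> A" and l: "l \<in> A"
  have chart: "is_chart M k" "is_chart M l" and comp: "smoothly_compatible k l"
    using assms k l by (auto simp: paracompact_manifold_def)
  have hom: "homeomorphic_map (subtopology M (fst k)) (top_of_set (snd k ` fst k)) (snd k)"
    and op: "openin M (fst k)" "openin M (fst l)" "open (snd k ` fst k)"
    using chart by (auto simp: is_chart_def)
  have "topspace (subtopology M (fst k)) = fst k"
    using op openin_subset by fastforce
  then show "inj_on (snd k) (fst k)"
    using hom homeomorphic_imp_injective_map by force
  have "openin (subtopology M (fst k)) (fst k \<inter> fst l)"
    using op by (simp add: openin_subtopology_Int2)
  then have "openin (top_of_set (snd k ` fst k)) (snd k ` (fst k \<inter> fst l))"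
    using hom homeomorphic_imp_open_map open_map_def by blast
  then show "open (snd k ` (fst k \<inter> fst l))"
    using op(3) openin_open_trans by blast
  show "smooth_on (snd k ` (fst k \<inter> fst l)) (transition k l)"
    using comp by (simp add: smoothly_compatible_def)
qed

locale base_atlas = smooth_atlas A for A :: "('a, 'n::finite) mchart set"
begin

lemma slit_atlas_chart: "k \<in> A \<Longrightarrow> slit_chart A k \<in> slit_atlas A"
  by (simp add: slit_atlas_def)

lemma slit_atlas_cases:
  assumes "K \<in> slit_atlas A"
  obtains k where "k \<in> A" "K = slit_chart A k"
  using assms by (auto simp: slit_atlas_def)

lemma slit_chart_simps:
  "fst (slit_chart A k) = slit_tangent A (fst k)"
  "snd (slit_chart A k) (p, v) = (snd k p, v k)"
  by (simp_all add: slit_chart_def)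

lemma slit_tangent_Int: "slit_tangent A U \<inter> slit_tangent A V = slit_tangent A (U \<inter> V)"
  by (auto simp: slit_tangent_def)

text \<open>
  A tangent vector is determined by its component in one chart, which may be any vector; so the
  image of an induced chart is a full product with the punctured vector space.
\<close>

lemma slit_image:
  assumes k: "k \<in> A" and U: "U \<subseteq> fst k"
  shows "snd (slit_chart A k) ` slit_tangent A U = (snd k ` U) \<times> (- {0})"
proof (intro equalityI subsetI)
  fix z assume "z \<in> snd (slit_chart A k) ` slit_tangent A U"
  then obtain p v where *: "p \<in> U" "v \<in> tangent_space A p" "v \<noteq> (\<lambda>_. 0)" "z = (snd k p, v k)"
    by (auto simp: slit_tangent_def slit_chart_simps)
  have "v k \<noteq> 0"
    using tangent_of_component[OF *(2) k] tangent_of_zero[OF k, of p] * U by force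
  with * show "z \<in> (snd k ` U) \<times> (- {0})" by auto
next
  fix z assume "z \<in> (snd k ` U) \<times> (- {0::(real, 'n) vec})"
  then obtain p y where *: "p \<in> U" "y \<noteq> 0" "z = (snd k p, y)" by auto
  have "tangent_of A k p y k = y" using tangent_of_self k U * by blast
  then have "(p, tangent_of A k p y) \<in> slit_tangent A U" "snd (slit_chart A k) (p, tangent_of A k p y) = z"
    using * tangent_of_in[OF k] U by (auto simp: slit_tangent_def slit_chart_simps)
  then show "z \<in> snd (slit_chart A k) ` slit_tangent A U" by (metis image_eqI)
qed

lemma slit_overlap:
  "k \<in> A \<Longrightarrow> snd (slit_chart A k) ` (fst (slit_chart A k) \<inter> fst (slit_chart A l)) =
    (snd k ` (fst k \<inter> fst l)) \<times> (- {0})"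
  by (simp add: slit_chart_simps slit_tangent_Int slit_image)

lemma inj_slit_chart: "k \<in> A \<Longrightarrow> inj_on (snd (slit_chart A k)) (fst (slit_chart A k))"
proof (rule inj_onI)
  fix q q' assume k: "k \<in> A" and q: "q \<in> fst (slit_chart A k)" "q' \<in> fst (slit_chart A k)"
    and eq: "snd (slit_chart A k) q = snd (slit_chart A k) q'"
  obtain p v p' v' where qq: "q = (p, v)" "q' = (p', v')" by (metis surj_pair)
  have *: "p \<in> fst k" "p' \<in> fst k" "v \<in> tangent_space A p" "v' \<in> tangent_space A p'"
    using q by (auto simp: qq slit_chart_simps slit_tangent_def)
  have "p = p'" using eq * inj[OF k] by (auto simp: qq slit_chart_simps inj_on_def)
  then show "q = q'"
    using eq * tangent_of_component[OF _ k] by (auto simp: qq slit_chart_simps) metis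
qed

lemma slit_transition:
  assumes k: "k \<in> A" and l: "l \<in> A"
    and z: "z \<in> (snd k ` (fst k \<inter> fst l)) \<times> (- {0})"
  shows "transition (slit_chart A k) (slit_chart A l) z =
    (transition k l (fst z), frechet_derivative (transition k l) (at (fst z)) (snd z))"
proof -
  from z obtain q where q: "q \<in> fst (slit_chart A k)" "q \<in> fst (slit_chart A l)" 
      and qz: "z = snd (slit_chart A k) q"
    unfolding slit_overlap[OF k, symmetric] by blast
  obtain p v where pv: "q = (p, v)" by (metis surj_pair)
  have *: "p \<in> fst k" "p \<in> fst l" "v \<in> tangent_space A p"
    using q by (auto simp: pv slit_chart_simps slit_tangent_def)
  have "transition (slit_chart A k) (slit_chart A l) z = snd (slit_chart A l) q"
    using inj_slit_chart[OF k] q(1) by (simp add: qz transition_def cinv_def)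
  then show ?thesis
    using * k l tangent_space_apply[OF *(3) k l] by (simp add: qz pv slit_chart_simps transition_chart)
qed

text \<open>
  Writing \<open>D\<tau>(x) y\<close> as a sum over a basis separates the dependence on \<open>x\<close> from the linear one
  on \<open>y\<close>; the same device gives smoothness below.
\<close>

lemma slit_transition_derivative:
  assumes k: "k \<in> A" and l: "l \<in> A"
    and z: "z \<in> (snd k ` (fst k \<inter> fst l)) \<times> (- {0})"
  shows "(transition (slit_chart A k) (slit_chart A l) has_derivative
    (\<lambda>w. (frechet_derivative (transition k l) (at (fst z)) (fst w),
      \<Sum>b\<in>Basis. (snd z \<bullet> b) *\<^sub>R frechet_derivative
           (\<lambda>x. frechet_derivative (transition k l) (at x) b) (at (fst z)) (fst w) +
        (snd w \<bullet> b) *\<^sub>R frechet_derivative (transition k l) (at (fst z)) b))) (at z)"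
proof -
  let ?O = "snd k ` (fst k \<inter> fst l)"
  note sm = smooth_transition[OF k l]
  have x: "fst z \<in> ?O" using z by auto
  have f: "(fst has_derivative fst) (at z)" "(snd has_derivative snd) (at z)"
    by (auto intro!: derivative_eq_intros)
  have 1: "((\<lambda>z. transition k l (fst z)) has_derivative
      (\<lambda>w. frechet_derivative (transition k l) (at (fst z)) (fst w))) (at z)"
    by (rule has_derivative_compose[OF f(1) smooth_on_has_derivative[OF sm x]])
  have 2: "((\<lambda>z. frechet_derivative (transition k l) (at (fst z)) b) has_derivative
      (\<lambda>w. frechet_derivative (\<lambda>x. frechet_derivative (transition k l) (at x) b) (at (fst z)) (fst w)))
      (at z)" for b
    by (rule has_derivative_compose[OF f(1) smooth_on_has_derivative[OF smooth_on_frechet[OF sm] x]])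
  have "((\<lambda>z. (transition k l (fst z),
        \<Sum>b\<in>Basis. (snd z \<bullet> b) *\<^sub>R frechet_derivative (transition k l) (at (fst z)) b)) has_derivative
    (\<lambda>w. (frechet_derivative (transition k l) (at (fst z)) (fst w),
      \<Sum>b\<in>Basis. (snd z \<bullet> b) *\<^sub>R frechet_derivative
           (\<lambda>x. frechet_derivative (transition k l) (at x) b) (at (fst z)) (fst w) +
        (snd w \<bullet> b) *\<^sub>R frechet_derivative (transition k l) (at (fst z)) b))) (at z)"
    by (intro has_derivative_Pair 1 has_derivative_sum has_derivative_scaleR
        has_derivative_inner_left f 2)
  then show ?thesis
  proof (rule has_derivative_transform_within_open[OF _ _ z])
    show "open (?O \<times> - {0::(real, 'n) vec})"
      by (intro open_Times open_overlap k l) auto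
    fix z' assume z': "z' \<in> ?O \<times> - {0::(real, 'n) vec}"
    then have "linear (frechet_derivative (transition k l) (at (fst z')))"
      by (intro smooth_on_linear_derivative[OF sm]) auto
    from linear_basis_expansion[OF this, of "snd z'"]
    show "(transition k l (fst z'),
        \<Sum>b\<in>Basis. (snd z' \<bullet> b) *\<^sub>R frechet_derivative (transition k l) (at (fst z')) b) =
      transition (slit_chart A k) (slit_chart A l) z'"
      unfolding slit_transition[OF k l z'] by simp
  qed
qed

text \<open>
  Second derivatives of \<open>\<tau>\<close> are multiplied by the \<open>x\<close>-component of the argument. Hence
  verticality is independent of the chart, and \<open>\<Delta>\<close> is a well-defined field.
\<close>

lemma slit_transition_vertical:
  assumes k: "k \<in> A" and l: "l \<in> A"
    and z: "z \<in> (snd k ` (fst k \<inter> fst l)) \<times> (- {0})"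
  shows "frechet_derivative (transition (slit_chart A k) (slit_chart A l)) (at z) (0, b) =
    (0, frechet_derivative (transition k l) (at (fst z)) b)"
proof -
  have lin: "linear (frechet_derivative (transition k l) (at (fst z)))"
    "linear (frechet_derivative (\<lambda>x. frechet_derivative (transition k l) (at x) b) (at (fst z)))" for b
    using smooth_on_linear_derivative[OF smooth_transition[OF k l], of "fst z"]
      smooth_on_linear_derivative[OF smooth_on_frechet[OF smooth_transition[OF k l]], of "fst z"] z
    by auto
  show ?thesis
    using linear_basis_expansion[OF lin(1), of b]
    by (simp add: frechet_derivative_eqI[OF slit_transition_derivative[OF assms]]
        linear_0[OF lin(1)] linear_0[OF lin(2)])
qed

lemma smooth_slit_transition:
  assumes k: "k \<in> A" and l: "l \<in> A"
  shows "smooth_on ((snd k ` (fst k \<inter> fst l)) \<times> (- {0}))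
    (transition (slit_chart A k) (slit_chart A l))"
proof -
  let ?O = "snd k ` (fst k \<inter> fst l)" and ?W = "(snd k ` (fst k \<inter> fst l)) \<times> (- {0::(real, 'n) vec})"
  note sm = smooth_transition[OF k l]
  have W: "open ?W" by (intro open_Times open_overlap k l) auto
  have comp: "smooth_on ?W (\<lambda>z. f (fst z))" if "smooth_on ?O f" for f :: "_ \<Rightarrow> (real, 'n) vec"
    by (rule smooth_on_compose[OF W open_overlap[OF k l] _ _ that])
      (auto intro!: smooth_intros W)
  have "smooth_on ?W (\<lambda>z. (transition k l (fst z),
        \<Sum>b\<in>Basis. (snd z \<bullet> b) *\<^sub>R frechet_derivative (transition k l) (at (fst z)) b))"
    by (intro smooth_intros W comp sm smooth_on_frechet
        smooth_on_bounded_linear[OF _ bounded_linear_inner_left])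
  then show ?thesis
  proof (rule smooth_on_cong[OF W, rotated])
    fix z' assume z': "z' \<in> ?W"
    then have "linear (frechet_derivative (transition k l) (at (fst z')))"
      by (intro smooth_on_linear_derivative[OF sm]) auto
    from linear_basis_expansion[OF this, of "snd z'"]
    show "(transition k l (fst z'),
        \<Sum>b\<in>Basis. (snd z' \<bullet> b) *\<^sub>R frechet_derivative (transition k l) (at (fst z')) b) =
      transition (slit_chart A k) (slit_chart A l) z'"
      unfolding slit_transition[OF k l z'] by simp
  qed
qed

sublocale slit: smooth_atlas "slit_atlas A"
proof
  fix K L assume "K \<in> slit_atlas A" "L \<in> slit_atlas A"
  then obtain k l where kl: "k \<in> A" "l \<in> A" "K = slit_chart A k" "L = slit_chart A l"
    by (metis slit_atlas_cases)
  show "inj_on (snd K) (fst K)" by (simp add: kl inj_slit_chart)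
  show "open (snd K ` (fst K \<inter> fst L))"
    using kl by (auto simp: slit_overlap intro!: open_Times open_overlap)
  show "smooth_on (snd K ` (fst K \<inter> fst L)) (transition K L)"
    using kl by (simp add: slit_overlap smooth_slit_transition)
qed

lemma slit_chart_image: "k \<in> A \<Longrightarrow> snd (slit_chart A k) ` fst (slit_chart A k) = (snd k ` fst k) \<times> (- {0})"
  by (simp add: slit_chart_simps slit_image)

lemma vertical_transition:
  assumes "K \<in> slit_atlas A" "L \<in> slit_atlas A" "q \<in> fst K" "q \<in> fst L" "fst a = 0"
  shows "fst (frechet_derivative (transition K L) (at (snd K q)) a) = 0"
proof -
  obtain k l where kl: "k \<in> A" "l \<in> A" "K = slit_chart A k" "L = slit_chart A l"
    using assms by (metis slit_atlas_cases)
  have "snd K q \<in> (snd k ` (fst k \<inter> fst l)) \<times> (- {0})"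
    using assms kl slit_overlap[of k l] by blast
  from slit_transition_vertical[OF kl(1,2) this, of "snd a"] show ?thesis
    using assms(5) by (cases a) (simp add: kl)
qed

lemma liouville_in_tangent_space: "liouville A q \<in> tangent_space (slit_atlas A) q"
proof -
  have "liouville A q L = frechet_derivative (transition K L) (at (snd K q)) (liouville A q K)"
    if KL: "K \<in> slit_atlas A" "L \<in> slit_atlas A" "q \<in> fst K" "q \<in> fst L" for K L
  proof -
    obtain k l where kl: "k \<in> A" "l \<in> A" "K = slit_chart A k" "L = slit_chart A l"
      using KL by (metis slit_atlas_cases)
    have z: "snd K q \<in> (snd k ` (fst k \<inter> fst l)) \<times> (- {0})"
      using KL kl slit_overlap[of k l] by blast
    have "snd (snd L q) = frechet_derivative (transition k l) (at (fst (snd K q))) (snd (snd K q))"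
      using slit_transition[OF kl(1,2) z] slit.transition_chart[of K q L] KL
      unfolding kl(3,4) by (metis snd_conv)
    then show ?thesis
      using KL slit_transition_vertical[OF kl(1,2) z, of "snd (snd K q)"]
      by (simp add: liouville_def kl)
  qed
  moreover have "liouville A q K = 0" if "K \<notin> slit_atlas A \<or> q \<notin> fst K" for K
    using that by (auto simp: liouville_def)
  ultimately show ?thesis unfolding tangent_space_def by blast
qed

end

section \<open>Coordinate expressions for a spray\<close>

definition pdx :: "'n::finite \<Rightarrow> ('n coords \<Rightarrow> real) \<Rightarrow> 'n coords \<Rightarrow> real" where
  "pdx j f z = frechet_derivative f (at z) (axis j 1, 0)"

lemma linear_axis_expansion:
  fixes f :: "(real, 'n::finite) vec \<Rightarrow> 'b::real_vector"
  assumes "linear f"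
  shows "f a = (\<Sum>i\<in>UNIV. a $ i *\<^sub>R f (axis i 1))"
proof -
  have "f a = f (\<Sum>i\<in>UNIV. a $ i *\<^sub>R axis i 1)"
    using basis_expansion[of a] by (simp add: scalar_mult_eq_scaleR)
  then show ?thesis by (simp add: linear_sum[OF assms] linear_cmul[OF assms])
qed

lemma linear_coords_split:
  fixes L :: "'n::finite coords \<Rightarrow> real"
  assumes "linear L"
  shows "L w = (\<Sum>j\<in>UNIV. fst w $ j * L (axis j 1, 0)) + (\<Sum>j\<in>UNIV. snd w $ j * L (0, axis j 1))"
proof -
  have lin: "linear (\<lambda>a. L (a, 0))" "linear (\<lambda>b. L (0, b))"
    using linear_compose[OF _ assms, of "\<lambda>a. (a, 0)"] linear_compose[OF _ assms, of "\<lambda>b. (0, b)"]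
    by (auto simp: o_def linear_iff)
  have "L w = L (fst w, 0) + L (0, snd w)"
    using linear_add[OF assms, of "(fst w, 0)" "(0, snd w)"] by simp
  then show ?thesis
    using linear_axis_expansion[OF lin(1), of "fst w"] linear_axis_expansion[OF lin(2), of "snd w"]
    by simp
qed

lemma frechet_derivative_coords:
  assumes "f differentiable (at z)"
  shows "frechet_derivative f (at z) w =
    (\<Sum>j\<in>UNIV. fst w $ j * pdx j f z) + (\<Sum>j\<in>UNIV. snd w $ j * dy j f z)"
  using linear_coords_split[OF linear_frechet_derivative[OF assms], of w]
  by (simp add: pdx_def dy_def)

lemma frechet_derivative_snd_nth:
  assumes "X differentiable (at z)"
  shows "frechet_derivative (\<lambda>z. snd (X z) $ l) (at z) w = snd (frechet_derivative X (at z) w) $ l"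
proof -
  have "bounded_linear (\<lambda>a. snd a $ l)"
    using bounded_linear_compose[OF bounded_linear_vec_nth bounded_linear_snd] .
  from frechet_derivative_eqI[OF bounded_linear.has_derivative[OF this
        assms[unfolded frechet_derivative_works]]]
  show ?thesis by simp
qed

lemma sum_axis: "(\<Sum>i\<in>UNIV. axis k (1::real) $ i * f i) = f k"
proof -
  have "(\<Sum>i\<in>UNIV. axis k 1 $ i * f i) = (\<Sum>i\<in>UNIV. if k = i then f i else 0)"
    by (rule sum.cong) (auto simp: axis_def)
  then show ?thesis by simp
qed

text \<open>
  The last assumption is \<open>[\<Delta>, \<Gamma>] = \<Gamma>\<close> in coordinates: the coefficients \<open>\<Gamma>\<^sup>i\<close> are homogeneous of
  degree 2 in \<open>y\<close>, in the infinitesimal form of Euler's relation.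
\<close>

locale spray_chart =
  fixes D :: "'n::finite coords set" and S :: "'n coords \<Rightarrow> 'n coords"
  assumes open_D: "open D" and smooth_S: "smooth_on D S"
    and fst_S: "z \<in> D \<Longrightarrow> fst (S z) = snd z"
    and homogeneous_S: "z \<in> D \<Longrightarrow> snd (frechet_derivative S (at z) (0, snd z)) = 2 *\<^sub>R snd (S z)"
begin

abbreviation "G \<equiv> spray_coeff S"
abbreviation "C \<equiv> conn S"

lemma smooth_G: "smooth_on D (G i)"
  unfolding spray_coeff_def[abs_def] by (intro smooth_intros open_D smooth_S)

lemma conn_eq: "C i j = dy j (G i)"
  by (simp add: conn_def fun_eq_iff)

lemma smooth_C: "smooth_on D (C i j)"
  unfolding conn_eq by (intro smooth_on_dy smooth_G)

lemma snd_S: "snd (S z) $ i = - 2 * G i z"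
  by (simp add: spray_coeff_def)

lemma snd_derivative_S:
  assumes "z \<in> D"
  shows "snd (frechet_derivative S (at z) w) $ i = - 2 * frechet_derivative (G i) (at z) w"
proof -
  have "((\<lambda>z. - (1 / 2) * snd (S z) $ i) has_derivative
      (\<lambda>w. - (1 / 2) * frechet_derivative (\<lambda>z. snd (S z) $ i) (at z) w)) (at z)"
    by (intro has_derivative_mult_right smooth_on_has_derivative[OF _ assms] smooth_intros
        open_D smooth_S)
  then have "frechet_derivative (G i) (at z) w =
      - (1 / 2) * frechet_derivative (\<lambda>z. snd (S z) $ i) (at z) w"
    unfolding spray_coeff_def[abs_def] by (simp add: frechet_derivative_eqI)
  then show ?thesis
    using frechet_derivative_snd_nth[OF smooth_on_differentiable[OF smooth_S assms]] by simp
qed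

lemma fst_derivative_S:
  assumes "z \<in> D"
  shows "fst (frechet_derivative S (at z) w) = snd w"
proof -
  have 1: "((\<lambda>z. fst (S z)) has_derivative (\<lambda>w. fst (frechet_derivative S (at z) w))) (at z)"
    by (intro has_derivative_fst smooth_on_has_derivative[OF smooth_S assms])
  have 2: "((\<lambda>z. fst (S z)) has_derivative snd) (at z)"
    by (rule has_derivative_transform_within_open[of snd, OF _ open_D assms])
      (auto simp: fst_S intro!: derivative_eq_intros)
  show ?thesis using fun_cong[OF has_derivative_unique[OF 1 2], of w] .
qed

lemma euler_G:
  assumes "z \<in> D"
  shows "(\<Sum>j\<in>UNIV. snd z $ j * C i j z) = 2 * G i z"
  using snd_derivative_S[OF assms, of "(0, snd z)" i] homogeneous_S[OF assms]
    frechet_derivative_coords[OF smooth_on_differentiable[OF smooth_G assms], of i "(0, snd z)"]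
  by (simp add: snd_S conn_eq)

lemma euler_G_derivative:
  assumes "z \<in> D"
  shows "(\<Sum>l\<in>UNIV. snd w $ l * C i l z) +
    (\<Sum>l\<in>UNIV. snd z $ l * frechet_derivative (C i l) (at z) w) =
    2 * frechet_derivative (G i) (at z) w"
proof -
  have "((\<lambda>z. \<Sum>l\<in>UNIV. snd z $ l * C i l z) has_derivative
     (\<lambda>w. \<Sum>l\<in>UNIV. snd z $ l * frechet_derivative (C i l) (at z) w + snd w $ l * C i l z)) (at z)"
    by (intro has_derivative_sum has_derivative_mult smooth_on_has_derivative[OF smooth_C assms]
        bounded_linear.has_derivative[OF bounded_linear_vec_nth] has_derivative_snd
        has_derivative_ident)
  then have 1: "((\<lambda>z. 2 * G i z) has_derivative
     (\<lambda>w. \<Sum>l\<in>UNIV. snd z $ l * frechet_derivative (C i l) (at z) w + snd w $ l * C i l z)) (at z)"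
    by (rule has_derivative_transform_within_open[OF _ open_D assms]) (rule euler_G)
  have 2: "((\<lambda>z. 2 * G i z) has_derivative (\<lambda>w. 2 * frechet_derivative (G i) (at z) w)) (at z)"
    by (intro has_derivative_mult_right smooth_on_has_derivative[OF smooth_G assms])
  have "(\<Sum>l\<in>UNIV. snd z $ l * frechet_derivative (C i l) (at z) w + snd w $ l * C i l z) =
      2 * frechet_derivative (G i) (at z) w"
    using fun_cong[OF has_derivative_unique[OF 1 2], of w] .
  then show ?thesis by (simp add: sum.distrib add.commute)
qed

text \<open>
  The vertical derivative of Euler's relation for \<open>\<Gamma>\<^sup>i\<close>, combined with the symmetry of
  \<open>\<partial>\<Gamma>\<^sup>i\<^sub>j / \<partial>y\<^sup>k\<close> in \<open>j\<close> and \<open>k\<close>: the functions \<open>\<Gamma>\<^sup>i\<^sub>j\<close> are homogeneous of degree 1.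
\<close>

lemma euler_C:
  assumes "z \<in> D"
  shows "frechet_derivative (C i j) (at z) (0, snd z) = C i j z"
proof -
  have "dy j (C i k) z = dy k (C i j) z" for k
    using symmetric_second_derivative[OF open_D smooth_G assms, of i]
    unfolding conn_eq dy_def by blast
  then have "frechet_derivative (C i j) (at z) (0, snd z) =
      (\<Sum>k\<in>UNIV. snd z $ k * dy j (C i k) z)"
    using frechet_derivative_coords[OF smooth_on_differentiable[OF smooth_C assms], of i j "(0, snd z)"]
    by simp
  then show ?thesis
    using euler_G_derivative[OF assms, of "(0, axis j 1)" i] sum_axis[of j "\<lambda>l. C i l z"]
    by (simp add: dy_def conn_eq)
qed

lemma H_field_eq: "H_field S i z = (axis i 1, \<chi> j. - C j i z)"
proof -
  have "(\<Sum>j\<in>UNIV. C j i z *\<^sub>R V_field j z) = (0, \<chi> j. C j i z)"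
  proof (rule prod_eqI)
    show "snd (\<Sum>j\<in>UNIV. C j i z *\<^sub>R V_field j z) = snd (0, \<chi> j. C j i z)"
      using basis_expansion[of "\<chi> j. C j i z"]
      by (simp add: V_field_def snd_sum scalar_mult_eq_scaleR)
  qed (simp add: V_field_def fst_sum)
  then show ?thesis by (simp add: H_field_def vec_eq_iff)
qed

lemma smooth_H_field: "smooth_on D (H_field S i)"
  unfolding H_field_def[abs_def] V_field_def
  by (intro smooth_intros open_D smooth_C)

lemma curv_eq:
  assumes "z \<in> D"
  shows "curv S l i j z =
    frechet_derivative (C l j) (at z) (H_field S i z) - frechet_derivative (C l i) (at z) (H_field S j z)"
proof -
  have "snd (frechet_derivative (H_field S i) (at z) w) $ l = - frechet_derivative (C l i) (at z) w" for i w
  proof -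
    have "((\<lambda>z. - C l i z) has_derivative (\<lambda>w. - frechet_derivative (C l i) (at z) w)) (at z)"
      by (intro has_derivative_minus smooth_on_has_derivative[OF smooth_C assms])
    then show ?thesis
      using frechet_derivative_snd_nth[OF smooth_on_differentiable[OF smooth_H_field assms], of i l w]
      by (simp add: H_field_eq frechet_derivative_eqI)
  qed
  then show ?thesis by (simp add: curv_def lie_bracket_def)
qed

lemma spray_horizontal:
  assumes "z \<in> D"
  shows "(\<Sum>l\<in>UNIV. snd z $ l *\<^sub>R H_field S l z) = S z"
proof (rule prod_eqI)
  show "fst (\<Sum>l\<in>UNIV. snd z $ l *\<^sub>R H_field S l z) = fst (S z)"
    using basis_expansion[of "snd z"]
    by (simp add: H_field_eq fst_sum fst_S[OF assms] scalar_mult_eq_scaleR)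
  show "snd (\<Sum>l\<in>UNIV. snd z $ l *\<^sub>R H_field S l z) = snd (S z)"
    using euler_G[OF assms]
    by (simp add: H_field_eq snd_sum vec_eq_iff snd_S sum_negf)
qed

text \<open>
  \<open>R\<^sup>k\<^sub>j\<close> is \<open>y\<^sup>l H\<^sub>j(\<Gamma>\<^sup>k\<^sub>l) - y\<^sup>l H\<^sub>l(\<Gamma>\<^sup>k\<^sub>j)\<close>. The operator \<open>y\<^sup>l H\<^sub>l\<close> is the spray itself, and the
  differentiated Euler relation expresses \<open>y\<^sup>l H\<^sub>j(\<Gamma>\<^sup>k\<^sub>l)\<close> by first derivatives of \<open>\<Gamma>\<^sup>k\<close>.
\<close>

lemma riem_eq:
  assumes "z \<in> D"
  shows "riem S k j z = 2 * pdx j (G k) z - (\<Sum>l\<in>UNIV. C k l z * C l j z)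
    - frechet_derivative (C k j) (at z) (S z)"
proof -
  have lin: "linear (frechet_derivative (C k j) (at z))"
    using smooth_on_linear_derivative[OF smooth_C assms] .
  have "(\<Sum>l\<in>UNIV. snd z $ l * frechet_derivative (C k j) (at z) (H_field S l z)) =
      frechet_derivative (C k j) (at z) (S z)"
    unfolding spray_horizontal[OF assms, symmetric]
    by (simp add: linear_sum[OF lin] linear_cmul[OF lin])
  moreover have "frechet_derivative (G k) (at z) (H_field S j z) =
      pdx j (G k) z - (\<Sum>l\<in>UNIV. C k l z * C l j z)"
    using frechet_derivative_coords[OF smooth_on_differentiable[OF smooth_G assms], of k "H_field S j z"]
      sum_axis[of j "\<lambda>i. pdx i (G k) z"]
    by (simp add: H_field_eq conn_eq sum_negf mult.commute)
  then have "(\<Sum>l\<in>UNIV. snd z $ l * frechet_derivative (C k l) (at z) (H_field S j z)) =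
      2 * pdx j (G k) z - (\<Sum>l\<in>UNIV. C k l z * C l j z)"
    using euler_G_derivative[OF assms, of "H_field S j z" k]
    by (simp add: H_field_eq sum_negf mult.commute)
  ultimately show ?thesis
    by (simp add: riem_def curv_eq[OF assms] algebra_simps sum_subtractf)
qed

end

text \<open>
  \<open>W\<^sup>l\<^sub>j\<close> differs from \<open>R\<^sup>l\<^sub>j\<close> by a multiple of \<open>\<delta>\<^sup>l\<^sub>j\<close>, which contributes a multiple of the symmetric \<open>h\<^sub>i\<^sub>j\<close>,
  and by a multiple of \<open>y\<^sup>l\<close>, which \<open>h\<close> annihilates.
\<close>

lemma weyl_symmetry_iff:
  assumes sym: "\<And>i j. h j i z = h i j z" and y: "\<And>i. (\<Sum>j\<in>UNIV. h i j z * snd z $ j) = 0"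
  shows "(\<Sum>l\<in>UNIV. h i l z * weyl S l j z) = (\<Sum>l\<in>UNIV. h j l z * weyl S l i z) \<longleftrightarrow>
    (\<Sum>l\<in>UNIV. h i l z * riem S l j z) = (\<Sum>l\<in>UNIV. h j l z * riem S l i z)"
proof -
  define c where "c = 1 / (real CARD('a) - 1) * (\<Sum>m\<in>UNIV. riem S m m z)"
  have "(\<Sum>l\<in>UNIV. h i l z * weyl S l j z) = (\<Sum>l\<in>UNIV. h i l z * riem S l j z) - c * h i j z" for i j
  proof -
    define d where "d = 1 / (real CARD('a) + 1) * (\<Sum>m\<in>UNIV. dy m (trfree S m j) z)"
    have "(\<Sum>l\<in>UNIV. h i l z * weyl S l j z) =
        (\<Sum>l\<in>UNIV. h i l z * riem S l j z - c * (h i l z * (if l = j then 1 else 0))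
            - d * (h i l z * snd z $ l))"
      by (rule sum.cong) (simp_all add: weyl_def trfree_def c_def d_def algebra_simps)
    also have "\<dots> = (\<Sum>l\<in>UNIV. h i l z * riem S l j z) - c * (\<Sum>l\<in>UNIV. h i l z * (if l = j then 1 else 0))
            - d * (\<Sum>l\<in>UNIV. h i l z * snd z $ l)"
      by (simp only: sum_subtractf sum_distrib_left)
    finally show ?thesis using y by (simp add: if_distrib cong: if_cong)
  qed
  then show ?thesis using sym[of j i] by simp
qed

section \<open>Forms that vanish on vertical vectors\<close>

text \<open>
  Such a form is determined by the components \<open>h\<^sub>i\<^sub>j = \<omega>(\<partial>/\<partial>x\<^sup>i, V\<^sub>j)\<close> and
  \<open>m\<^sub>i\<^sub>j = \<omega>(\<partial>/\<partial>x\<^sup>i, \<partial>/\<partial>x\<^sup>j)\<close>. The coordinate frame serves better than the horizontal one here,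
  because its vectors are constant and the operators on forms are defined by constant arguments.
\<close>

locale isotropic_form =
  fixes D :: "'n::finite coords set" and B :: "'n coords \<Rightarrow> 'n coords \<Rightarrow> 'n coords \<Rightarrow> real"
  assumes open_dom: "open D"
    and bilinear_B: "z \<in> D \<Longrightarrow> bilinear (B z)"
    and alternating_B: "z \<in> D \<Longrightarrow> B z u u = 0"
    and smooth_B: "smooth_on D (\<lambda>z. B z u v)"
    and isotropic_B: "z \<in> D \<Longrightarrow> B z (0, b) (0, d) = 0"
begin

abbreviation "h i j z \<equiv> B z (axis i 1, 0) (0, axis j 1)"
abbreviation "m i j z \<equiv> B z (axis i 1, 0) (axis j 1, 0)"

lemma linear_B: "z \<in> D \<Longrightarrow> linear (B z u)" "z \<in> D \<Longrightarrow> linear (\<lambda>u. B z u v)"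
  using bilinear_B unfolding bilinear_def by blast+

lemma antisymmetric_B:
  assumes "z \<in> D"
  shows "B z u v = - B z v u"
proof -
  have "B z (u + v) (u + v) = B z u u + B z u v + (B z v u + B z v v)"
    using bilinear_B[OF assms] by (simp add: bilinear_ladd bilinear_radd)
  then show ?thesis using alternating_B[OF assms] by simp
qed

lemma linear_inclusions:
  "linear (\<lambda>a::(real, 'n) vec. (a, 0::(real, 'n) vec))"
  "linear (\<lambda>d::(real, 'n) vec. (0::(real, 'n) vec, d))"
  by (simp_all add: linear_iff)

lemma horizontal_vertical:
  assumes "z \<in> D"
  shows "B z (a, c) (0, d) = (\<Sum>i\<in>UNIV. \<Sum>j\<in>UNIV. a $ i * d $ j * h i j z)"
proof -
  note bil = bilinear_B[OF assms]
  have lin: "linear (\<lambda>a. B z (a, 0) v)" "linear (\<lambda>d. B z u (0, d))" for u v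
    using linear_compose[OF linear_inclusions(1) linear_B(2)[OF assms]]
      linear_compose[OF linear_inclusions(2) linear_B(1)[OF assms]]
    by (simp_all add: o_def)
  have "B z (a, c) (0, d) = B z (a, 0) (0, d) + B z (0, c) (0, d)"
    using bilinear_ladd[OF bil, of "(a, 0)" "(0, c)"] by simp
  also have "\<dots> = (\<Sum>i\<in>UNIV. a $ i * B z (axis i 1, 0) (0, d))"
    using isotropic_B[OF assms] linear_axis_expansion[OF lin(1), of a] by simp
  also have "\<dots> = (\<Sum>i\<in>UNIV. a $ i * (\<Sum>j\<in>UNIV. d $ j * h i j z))"
    using linear_axis_expansion[OF lin(2), of _ d] by simp
  finally show ?thesis by (simp add: sum_distrib_left mult.assoc)
qed

lemma horizontal_horizontal:
  assumes "z \<in> D"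
  shows "B z (a, 0) (b, 0) = (\<Sum>i\<in>UNIV. \<Sum>j\<in>UNIV. a $ i * b $ j * m i j z)"
proof -
  have lin: "linear (\<lambda>a. B z (a, 0) v)" "linear (\<lambda>d. B z u (d, 0))" for u v
    using linear_compose[OF linear_inclusions(1) linear_B(2)[OF assms]]
      linear_compose[OF linear_inclusions(1) linear_B(1)[OF assms]]
    by (simp_all add: o_def)
  have "B z (a, 0) (b, 0) = (\<Sum>i\<in>UNIV. a $ i * B z (axis i 1, 0) (b, 0))"
    using linear_axis_expansion[OF lin(1), of a] by simp
  also have "\<dots> = (\<Sum>i\<in>UNIV. a $ i * (\<Sum>j\<in>UNIV. b $ j * m i j z))"
    using linear_axis_expansion[OF lin(2), of _ b] by simp
  finally show ?thesis by (simp add: sum_distrib_left mult.assoc)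
qed

lemma component_expansion:
  assumes "z \<in> D"
  shows "B z u v =
    (\<Sum>i\<in>UNIV. \<Sum>j\<in>UNIV. (fst u $ i * snd v $ j - fst v $ i * snd u $ j) * h i j z)
    + (\<Sum>i\<in>UNIV. \<Sum>j\<in>UNIV. fst u $ i * fst v $ j * m i j z)"
proof -
  note bil = bilinear_B[OF assms]
  have "B z u v = B z (fst u, 0) (fst v, 0) + B z (fst u, 0) (0, snd v)
      + (B z (0, snd u) (fst v, 0) + B z (0, snd u) (0, snd v))"
    using bilinear_ladd[OF bil, of "(fst u, 0)" "(0, snd u)" v]
      bilinear_radd[OF bil, of "(fst u, 0)" "(fst v, 0)" "(0, snd v)"]
      bilinear_radd[OF bil, of "(0, snd u)" "(fst v, 0)" "(0, snd v)"] by simp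
  also have "B z (0, snd u) (fst v, 0) = - B z (fst v, 0) (0, snd u)"
    using antisymmetric_B[OF assms] .
  finally show ?thesis
    unfolding horizontal_vertical[OF assms, of "fst u" 0 "snd v"]
      horizontal_vertical[OF assms, of "fst v" 0 "snd u"]
      horizontal_horizontal[OF assms, of "fst u" "fst v"] isotropic_B[OF assms]
    by (simp add: left_diff_distrib sum_subtractf)
qed

lemma vertical_first:
  assumes "z \<in> D"
  shows "B z (0, b) v = - (\<Sum>i\<in>UNIV. \<Sum>j\<in>UNIV. fst v $ i * b $ j * h i j z)"
  using antisymmetric_B[OF assms, of "(0, b)" v] horizontal_vertical[OF assms, of "fst v" "snd v" b]
  by simp

lemma derivative_linear:
  assumes "z \<in> D"
  shows "linear (\<lambda>u. frechet_derivative (\<lambda>z. B z u v) (at z) w)"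
    "linear (\<lambda>v. frechet_derivative (\<lambda>z. B z u v) (at z) w)"
proof -
  have d: "((\<lambda>z. B z u v) has_derivative frechet_derivative (\<lambda>z. B z u v) (at z)) (at z)" for u v
    using smooth_on_has_derivative[OF smooth_B assms] .
  have eq: "frechet_derivative f (at z) w = r" 
    if "(g has_derivative g') (at z)" "\<And>x. x \<in> D \<Longrightarrow> g x = f x" "g' w = r"
    for f g :: "'n coords \<Rightarrow> real" and g' r
    using frechet_derivative_eqI[OF has_derivative_transform_within_open[OF that(1) open_dom assms that(2)]]
      that(3) by simp
  show "linear (\<lambda>u. frechet_derivative (\<lambda>z. B z u v) (at z) w)"
    by (intro linearI eq[OF has_derivative_add[OF d d]] eq[OF has_derivative_scaleR_right[OF d]])
      (auto simp: bilinear_ladd[OF bilinear_B] bilinear_lmul[OF bilinear_B])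
  show "linear (\<lambda>v. frechet_derivative (\<lambda>z. B z u v) (at z) w)"
    by (intro linearI eq[OF has_derivative_add[OF d d]] eq[OF has_derivative_scaleR_right[OF d]])
      (auto simp: bilinear_radd[OF bilinear_B] bilinear_rmul[OF bilinear_B])
qed

lemma derivative_horizontal_vertical:
  assumes "z \<in> D"
  shows "frechet_derivative (\<lambda>z. B z u (0, d)) (at z) (0, b) =
    (\<Sum>i\<in>UNIV. \<Sum>j\<in>UNIV. \<Sum>l\<in>UNIV. fst u $ i * d $ j * b $ l * dy l (h i j) z)"
proof -
  have "((\<lambda>z. \<Sum>i\<in>UNIV. \<Sum>j\<in>UNIV. fst u $ i * d $ j * h i j z) has_derivative
    (\<lambda>w. \<Sum>i\<in>UNIV. \<Sum>j\<in>UNIV. fst u $ i * d $ j * frechet_derivative (h i j) (at z) w)) (at z)"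
    by (intro has_derivative_sum has_derivative_mult_right
        smooth_on_has_derivative[OF smooth_B assms])
  then have "((\<lambda>z. B z u (0, d)) has_derivative
    (\<lambda>w. \<Sum>i\<in>UNIV. \<Sum>j\<in>UNIV. fst u $ i * d $ j * frechet_derivative (h i j) (at z) w)) (at z)"
    by (rule has_derivative_transform_within_open[OF _ open_dom assms])
      (use horizontal_vertical[of _ "fst u" "snd u" d] in simp)
  from frechet_derivative_eqI[OF this] show ?thesis
    using frechet_derivative_coords[OF smooth_on_differentiable[OF smooth_B assms], of _ _ "(0, b)"]
    by (simp add: sum_distrib_left mult.assoc)
qed

text \<open>
  The form vanishes identically on vertical pairs, so the term that differentiates along \<open>u\<close> is
  absent, and \<open>u\<close> enters only through its projection to the base. A horizontal \<open>u\<close> can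
  therefore be replaced by an arbitrary one.
\<close>

lemma exterior_derivative_vertical:
  assumes "z \<in> D"
  shows "exterior_derivative B z u (0, b) (0, d) =
    (\<Sum>i\<in>UNIV. \<Sum>j\<in>UNIV. \<Sum>l\<in>UNIV. fst u $ i * b $ j * d $ l * (dy l (h i j) z - dy j (h i l) z))"
proof -
  have "frechet_derivative (\<lambda>z. B z (0, b) (0, d)) (at z) u = frechet_derivative (\<lambda>z. 0) (at z) u"
    by (rule fun_cong[OF frechet_derivative_cong[OF open_dom assms]]) (rule isotropic_B)
  moreover have "(\<Sum>i\<in>UNIV. \<Sum>j\<in>UNIV. \<Sum>l\<in>UNIV. fst u $ i * d $ j * b $ l * dy l (h i j) z) =
      (\<Sum>i\<in>UNIV. \<Sum>j\<in>UNIV. \<Sum>l\<in>UNIV. fst u $ i * b $ j * d $ l * dy j (h i l) z)"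
    by (rule sum.cong[OF refl], subst sum.swap) (simp add: mult.assoc mult.left_commute)
  ultimately show ?thesis
    unfolding exterior_derivative_def derivative_horizontal_vertical[OF assms]
    by (simp add: right_diff_distrib sum_subtractf)
qed

end

lemma isotropic_form_eqI:
  assumes B: "isotropic_form D B" and B': "isotropic_form D B'" and z: "z \<in> D"
    and h: "\<And>i j. B z (axis i 1, 0) (0, axis j 1) = B' z (axis i 1, 0) (0, axis j 1)"
    and m: "\<And>i j. B z (axis i 1, 0) (axis j 1, 0) = B' z (axis i 1, 0) (axis j 1, 0)"
  shows "B z u v = B' z u v"
  using isotropic_form.component_expansion[OF B z, of u v]
    isotropic_form.component_expansion[OF B' z, of u v] by (simp only: h m)


section \<open>The Lie derivative along a spray\<close>

locale spray_form = spray_chart D S + isotropic_form D B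
  for D :: "'n::finite coords set" and S B
begin

lemma derivative_S_vertical: "z \<in> D \<Longrightarrow>
  frechet_derivative S (at z) (0, axis j 1) = (axis j 1, \<chi> k. - 2 * C k j z)"
  by (rule prod_eqI)
    (simp_all add: fst_derivative_S vec_eq_iff snd_derivative_S conn_def dy_def)

lemma derivative_S_horizontal: "z \<in> D \<Longrightarrow>
  frechet_derivative S (at z) (axis j 1, 0) = (0, \<chi> k. - 2 * pdx j (G k) z)"
  by (rule prod_eqI)
    (simp_all add: fst_derivative_S vec_eq_iff snd_derivative_S pdx_def)

lemma axis_vertical:
  "z \<in> D \<Longrightarrow> B z (axis i 1, c) (0, d) = (\<Sum>k\<in>UNIV. d $ k * h i k z)"
  using sum_axis[of i "\<lambda>i. \<Sum>k\<in>UNIV. d $ k * h i k z"]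
    horizontal_vertical[of z "axis i 1" c d]
  by (simp add: sum_distrib_left mult.assoc)

lemma axis_axis:
  assumes "z \<in> D"
  shows "B z (axis i 1, 0) (axis j 1, d) = m i j z + (\<Sum>k\<in>UNIV. d $ k * h i k z)"
  using bilinear_radd[OF bilinear_B[OF assms], of "(axis i 1, 0)" "(axis j 1, 0)" "(0, d)"]
    axis_vertical[OF assms, of i 0 d]
  by simp

lemma lie_vertical_vertical:
  assumes "z \<in> D"
  shows "lie_derivative_form S B z (0, axis i 1) (0, axis j 1) = h i j z - h j i z"
proof -
  have "frechet_derivative (\<lambda>z. B z (0, axis i 1) (0, axis j 1)) (at z) =
      frechet_derivative (\<lambda>z. 0) (at z)"
    by (rule frechet_derivative_cong[OF open_D assms]) (rule isotropic_B)
  moreover have "B z (0, axis i 1) (axis j 1, d) = - h j i z" for d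
    using antisymmetric_B[OF assms, of "(0, axis i 1)" "(axis j 1, d)"]
      axis_vertical[OF assms, of j d "axis i 1"] axis_vertical[OF assms, of j 0 "axis i 1"] by simp
  moreover have "B z (axis i 1, d) (0, axis j 1) = h i j z" for d
    using axis_vertical[OF assms, of i d "axis j 1"] axis_vertical[OF assms, of i 0 "axis j 1"] by simp
  ultimately show ?thesis
    by (simp add: lie_derivative_form_def derivative_S_vertical[OF assms])
qed

text \<open>
  The derivative of the spray maps \<open>V\<^sub>j\<close> to \<open>\<partial>/\<partial>x\<^sup>j - 2 \<Gamma>\<^sup>k\<^sub>j V\<^sub>k\<close>, which brings in \<open>m\<^sub>i\<^sub>j\<close>.
\<close>

lemma lie_horizontal_vertical:
  assumes "z \<in> D"
  shows "lie_derivative_form S B z (axis i 1, 0) (0, axis j 1) =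
    frechet_derivative (h i j) (at z) (S z) + m i j z - 2 * (\<Sum>k\<in>UNIV. h i k z * C k j z)"
  unfolding lie_derivative_form_def derivative_S_vertical[OF assms] derivative_S_horizontal[OF assms]
    isotropic_B[OF assms] axis_axis[OF assms, of i j "\<chi> k. - 2 * C k j z"]
  by (simp add: sum_negf sum_distrib_left mult.assoc mult.commute mult.left_commute)

lemma lie_horizontal_horizontal:
  assumes "z \<in> D"
  shows "lie_derivative_form S B z (axis i 1, 0) (axis j 1, 0) =
    frechet_derivative (m i j) (at z) (S z)
    + 2 * (\<Sum>k\<in>UNIV. h j k z * pdx i (G k) z) - 2 * (\<Sum>k\<in>UNIV. h i k z * pdx j (G k) z)"
proof -
  have "B z (0, d) (axis j 1, 0) = - (\<Sum>k\<in>UNIV. d $ k * h j k z)" for d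
    using antisymmetric_B[OF assms, of "(0, d)" "(axis j 1, 0)"] axis_vertical[OF assms, of j 0 d]
    by simp
  then show ?thesis
    unfolding lie_derivative_form_def derivative_S_horizontal[OF assms]
      axis_vertical[OF assms, of i 0 "\<chi> k. - 2 * pdx j (G k) z"]
    by (simp add: sum_negf sum_distrib_left mult.assoc mult.commute mult.left_commute)
qed

lemma lie_derivative_eqI:
  assumes z: "z \<in> D"
    and "\<And>i j. lie_derivative_form S B z (0, axis i 1) (0, axis j 1) = 0"
    and "\<And>i j. lie_derivative_form S B z (axis i 1, 0) (0, axis j 1) = 0"
    and "\<And>i j. lie_derivative_form S B z (axis i 1, 0) (axis j 1, 0) = 0"
  shows "lie_derivative_form S B z u v = 0"
proof -
  let ?L = "lie_derivative_form S B z"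
  have l1: "linear (\<lambda>u. ?L u v)" for v
    by (rule linearI) (simp_all add: lie_derivative_form_def
        linear_add[OF linear_B(1)[OF z]] linear_add[OF linear_B(2)[OF z]]
        linear_cmul[OF linear_B(1)[OF z]] linear_cmul[OF linear_B(2)[OF z]]
        linear_add[OF derivative_linear(1)[OF z]] linear_cmul[OF derivative_linear(1)[OF z]]
        linear_add[OF smooth_on_linear_derivative[OF smooth_S z]]
        linear_cmul[OF smooth_on_linear_derivative[OF smooth_S z]] algebra_simps)
  have l2: "linear (\<lambda>v. ?L u v)" for u
    by (rule linearI) (simp_all add: lie_derivative_form_def
        linear_add[OF linear_B(1)[OF z]] linear_add[OF linear_B(2)[OF z]]
        linear_cmul[OF linear_B(1)[OF z]] linear_cmul[OF linear_B(2)[OF z]]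
        linear_add[OF derivative_linear(2)[OF z]] linear_cmul[OF derivative_linear(2)[OF z]]
        linear_add[OF smooth_on_linear_derivative[OF smooth_S z]]
        linear_cmul[OF smooth_on_linear_derivative[OF smooth_S z]] algebra_simps)
  have anti: "?L u v = - ?L v u" for u v
  proof -
    have "frechet_derivative (\<lambda>z. B z u v) (at z) = frechet_derivative (\<lambda>z. - B z v u) (at z)"
      by (rule frechet_derivative_cong[OF open_D z]) (rule antisymmetric_B)
    also have "\<dots> = (\<lambda>w. - frechet_derivative (\<lambda>z. B z v u) (at z) w)"
      by (intro frechet_derivative_eqI has_derivative_minus smooth_on_has_derivative[OF smooth_B z])
    finally show ?thesis
      using antisymmetric_B[OF z, of "frechet_derivative S (at z) u" v]
        antisymmetric_B[OF z, of u "frechet_derivative S (at z) v"]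
      by (simp add: lie_derivative_form_def)
  qed
  have v: "?L (axis i 1, 0) v = 0" "?L (0, axis i 1) v = 0" for i v
    using linear_coords_split[OF l2, of "(axis i 1, 0)" v] linear_coords_split[OF l2, of "(0, axis i 1)" v]
      anti[of "(0, axis i 1)" "(axis _ 1, 0)"] assms by simp_all
  show ?thesis using linear_coords_split[OF l1[of v], of u] v by simp
qed

text \<open>
  The formula for \<open>m\<close> says that \<open>\<omega>\<close> vanishes on horizontal pairs. When it is differentiated along
  the spray, \<open>\<nabla>h = 0\<close> removes the derivatives of \<open>h\<close>. Of the resulting terms quadratic in the
  connection, those of the form \<open>h\<^sub>l\<^sub>k \<Gamma>\<^sup>l\<^sub>i \<Gamma>\<^sup>k\<^sub>j\<close> are symmetric in \<open>i, j\<close> and cancel; the others are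
  those of \<open>R\<close>.
\<close>

lemma lie_horizontal_riem:
  assumes z: "z \<in> D" and sym: "\<And>z i j. z \<in> D \<Longrightarrow> h j i z = h i j z"
    and nabla: "\<And>i j. nabla S h i j z = 0"
    and m: "\<And>z i j. z \<in> D \<Longrightarrow>
      m i j z = (\<Sum>k\<in>UNIV. h i k z * C k j z) - (\<Sum>k\<in>UNIV. h j k z * C k i z)"
  shows "lie_derivative_form S B z (axis i 1, 0) (axis j 1, 0) =
    (\<Sum>l\<in>UNIV. h j l z * riem S l i z) - (\<Sum>l\<in>UNIV. h i l z * riem S l j z)"
proof -
  have dh: "frechet_derivative (h i k) (at z) (S z) =
     (\<Sum>l\<in>UNIV. h l k z * C l i z) + (\<Sum>l\<in>UNIV. h i l z * C l k z)" for i k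
    using nabla[of i k] by (simp add: nabla_def mult.commute)
  define P where "P i j = (\<Sum>k\<in>UNIV. h i k z * frechet_derivative (C k j) (at z) (S z))" for i j
  define Q where "Q i j = (\<Sum>k\<in>UNIV. \<Sum>l\<in>UNIV. h l k z * C l i z * C k j z)" for i j
  define R where "R i j = (\<Sum>k\<in>UNIV. \<Sum>l\<in>UNIV. h i l z * C l k z * C k j z)" for i j
  have d: "((\<lambda>z. \<Sum>k\<in>UNIV. h i k z * C k j z) has_derivative
      (\<lambda>w. \<Sum>k\<in>UNIV. h i k z * frechet_derivative (C k j) (at z) w
          + frechet_derivative (h i k) (at z) w * C k j z)) (at z)" for i j
    by (intro has_derivative_sum has_derivative_mult smooth_on_has_derivative[OF _ z] smooth_B smooth_C)
  have "(m i j has_derivative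
      (\<lambda>w. (\<Sum>k\<in>UNIV. h i k z * frechet_derivative (C k j) (at z) w
          + frechet_derivative (h i k) (at z) w * C k j z)
         - (\<Sum>k\<in>UNIV. h j k z * frechet_derivative (C k i) (at z) w
          + frechet_derivative (h j k) (at z) w * C k i z))) (at z)"
    by (rule has_derivative_transform_within_open[OF has_derivative_diff[OF d d] open_D z])
      (rule m[symmetric])
  then have "frechet_derivative (m i j) (at z) (S z) =
      (\<Sum>k\<in>UNIV. h i k z * frechet_derivative (C k j) (at z) (S z)
          + ((\<Sum>l\<in>UNIV. h l k z * C l i z) + (\<Sum>l\<in>UNIV. h i l z * C l k z)) * C k j z)
       - (\<Sum>k\<in>UNIV. h j k z * frechet_derivative (C k i) (at z) (S z)
          + ((\<Sum>l\<in>UNIV. h l k z * C l j z) + (\<Sum>l\<in>UNIV. h j l z * C l k z)) * C k i z)"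
    by (simp only: frechet_derivative_eqI dh)
  then have dm: "frechet_derivative (m i j) (at z) (S z) =
      P i j + Q i j + R i j - (P j i + Q j i + R j i)"
    by (simp add: P_def Q_def R_def sum.distrib distrib_right sum_distrib_right)
  have "Q i j = Q j i"
  proof -
    have "Q i j = (\<Sum>l\<in>UNIV. \<Sum>k\<in>UNIV. h l k z * C l i z * C k j z)"
      unfolding Q_def by (rule sum.swap)
    also have "\<dots> = Q j i"
      unfolding Q_def using sym[OF z] by (simp add: mult.commute mult.left_commute)
    finally show ?thesis .
  qed
  moreover have "(\<Sum>l\<in>UNIV. h i l z * riem S l j z) =
      2 * (\<Sum>k\<in>UNIV. h i k z * pdx j (G k) z) - R i j - P i j" for i j
  proof -
    have "R i j = (\<Sum>l\<in>UNIV. \<Sum>k\<in>UNIV. h i l z * C l k z * C k j z)"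
      unfolding R_def by (rule sum.swap)
    then show ?thesis
      by (simp add: P_def riem_eq[OF z] right_diff_distrib sum_subtractf sum_distrib_left
          mult.assoc mult.left_commute)
  qed
  ultimately show ?thesis unfolding lie_horizontal_horizontal[OF z] dm by simp
qed

end

section \<open>The 2-form of a Helmholtz tensor and its projective invariance\<close>

text \<open>
  The form \<open>h\<^sub>i\<^sub>j dx\<^sup>i \<and> \<phi>\<^sup>j\<close> as a function of the coordinate representatives alone, so that it can be
  differentiated in a chart.
\<close>

definition hform ::
    "('n::finite coords \<Rightarrow> 'n coords) \<Rightarrow> ('n \<Rightarrow> 'n \<Rightarrow> 'n coords \<Rightarrow> real) \<Rightarrow>
     'n coords \<Rightarrow> 'n coords \<Rightarrow> 'n coords \<Rightarrow> real" where
  "hform S h z u v = (\<Sum>i\<in>UNIV. \<Sum>j\<in>UNIV. h i j z *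
     (dx_form i u * phi_form S j z v - dx_form i v * phi_form S j z u))"

lemma phi_form_vertical: "phi_form S j z (0, b) = b $ j"
  by (simp add: phi_form_def dx_form_def)

lemma phi_form_axis: "phi_form S j z (axis i 1, 0) = conn S j i z"
  using sum_axis[of i "\<lambda>k. conn S j k z"] by (simp add: phi_form_def dx_form_def mult.commute)

lemma linear_dx_form: "linear (dx_form i)"
  by (simp add: linear_iff dx_form_def)

lemma linear_phi_form: "linear (phi_form S j z)"
  by (simp add: linear_iff phi_form_def dx_form_def sum.distrib sum_distrib_left algebra_simps)

lemma bilinear_hform: "bilinear (hform S h z)"
proof -
  note l = linear_add[OF linear_dx_form] linear_add[OF linear_phi_form]
    linear_cmul[OF linear_dx_form] linear_cmul[OF linear_phi_form]
  have "linear (\<lambda>v. hform S h z u v)" "linear (\<lambda>u. hform S h z u v)" for u v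
    unfolding hform_def
    by (intro linear_compose_sum ballI linearI; simp add: l algebra_simps)+
  then show ?thesis by (simp add: bilinear_def)
qed

context spray_chart
begin

lemma smooth_phi_form: "smooth_on D (\<lambda>z. phi_form S j z u)"
  unfolding phi_form_def by (intro smooth_intros open_D smooth_C)

lemma isotropic_hform:
  assumes "\<And>i j. smooth_on D (h i j)"
  shows "isotropic_form D (hform S h)"
proof
  show "smooth_on D (\<lambda>z. hform S h z u v)" for u v
    unfolding hform_def by (intro smooth_intros open_D smooth_phi_form assms)
  show "hform S h z (0, b) (0, d) = 0" for z b d
    by (simp add: hform_def dx_form_def)
  show "hform S h z u u = 0" for z u
    by (simp add: hform_def)
qed (simp_all add: open_D bilinear_hform)

lemma hform_hv: "hform S h z (axis i 1, 0) (0, axis j 1) = h i j z"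
proof -
  have "hform S h z (axis i 1, 0) (0, axis j 1) =
      (\<Sum>i'\<in>UNIV. axis i 1 $ i' * (\<Sum>j'\<in>UNIV. axis j 1 $ j' * h i' j' z))"
    by (simp add: hform_def dx_form_def phi_form_vertical sum_distrib_left
        mult.assoc mult.commute mult.left_commute)
  then show ?thesis by (simp only: sum_axis)
qed

lemma hform_hh: "hform S h z (axis i 1, 0) (axis j 1, 0) =
  (\<Sum>k\<in>UNIV. h i k z * C k j z) - (\<Sum>k\<in>UNIV. h j k z * C k i z)"
proof -
  have "hform S h z (axis i 1, 0) (axis j 1, 0) =
      (\<Sum>i'\<in>UNIV. axis i 1 $ i' * (\<Sum>k\<in>UNIV. h i' k z * C k j z)) -
      (\<Sum>i'\<in>UNIV. axis j 1 $ i' * (\<Sum>k\<in>UNIV. h i' k z * C k i z))"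
    by (simp add: hform_def dx_form_def phi_form_axis sum_distrib_left sum_subtractf right_diff_distrib
        mult.assoc mult.commute mult.left_commute)
  then show ?thesis by (simp only: sum_axis)
qed

lemma phi_form_spray: "z \<in> D \<Longrightarrow> phi_form S j z (S z) = 0"
  using euler_G[of z j] by (simp add: phi_form_def dx_form_def fst_S snd_S mult.commute)

end

text \<open>
  The Helmholtz conditions that involve no spray. Locally along the fibres they mean that \<open>h\<^sub>i\<^sub>j\<close> is
  \<open>\<partial>\<^sup>2F / \<partial>y\<^sup>i\<partial>y\<^sup>j\<close> for a function \<open>F\<close> that is homogeneous of degree 1 in \<open>y\<close>.
\<close>

locale vertical_hessian =
  fixes D :: "'n::finite coords set" and h :: "'n \<Rightarrow> 'n \<Rightarrow> 'n coords \<Rightarrow> real"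
  assumes open_hD: "open D"
    and smooth_h: "smooth_on D (h i j)"
    and symmetric_h: "z \<in> D \<Longrightarrow> h j i z = h i j z"
    and null_h: "z \<in> D \<Longrightarrow> (\<Sum>j\<in>UNIV. h i j z * snd z $ j) = 0"
    and vertical_h: "z \<in> D \<Longrightarrow> dy l (h i j) z = dy j (h i l) z"
begin

lemma null_h_left: "z \<in> D \<Longrightarrow> (\<Sum>i\<in>UNIV. h i j z * snd z $ i) = 0"
  using null_h[of z j] symmetric_h[of z] by (simp cong: sum.cong)

text \<open>
  Differentiating \<open>h\<^sub>i\<^sub>k y\<^sup>k = 0\<close> in direction \<open>V\<^sub>j\<close> gives \<open>h\<^sub>i\<^sub>j = - y\<^sup>k V\<^sub>j(h\<^sub>i\<^sub>k)\<close>, and the derivative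
  indices may be exchanged: \<open>h\<close> is homogeneous of degree \<open>-1\<close>.
\<close>

lemma euler_h:
  assumes z: "z \<in> D"
  shows "frechet_derivative (h i j) (at z) (0, snd z) = - h i j z"
proof -
  have "((\<lambda>z. \<Sum>k\<in>UNIV. h i k z * snd z $ k) has_derivative
     (\<lambda>w. \<Sum>k\<in>UNIV. h i k z * snd w $ k + frechet_derivative (h i k) (at z) w * snd z $ k)) (at z)"
    by (intro has_derivative_sum has_derivative_mult smooth_on_has_derivative[OF smooth_h z]
        bounded_linear.has_derivative[OF bounded_linear_vec_nth] has_derivative_snd
        has_derivative_ident)
  then have 1: "((\<lambda>z. 0) has_derivative
     (\<lambda>w. \<Sum>k\<in>UNIV. h i k z * snd w $ k + frechet_derivative (h i k) (at z) w * snd z $ k)) (at z)"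
    by (rule has_derivative_transform_within_open[OF _ open_hD z]) (rule null_h)
  have "(\<Sum>k\<in>UNIV. h i k z * axis j 1 $ k + dy j (h i k) z * snd z $ k) = 0"
    using fun_cong[OF has_derivative_unique[OF 1 has_derivative_const], of "(0, axis j 1)"]
    by (simp add: dy_def)
  moreover have "(\<Sum>k\<in>UNIV. h i k z * axis j 1 $ k) = h i j z"
    using sum_axis[of j "\<lambda>k. h i k z"] by (simp add: mult.commute)
  moreover have "frechet_derivative (h i j) (at z) (0, snd z) = (\<Sum>k\<in>UNIV. dy j (h i k) z * snd z $ k)"
    using frechet_derivative_coords[OF smooth_on_differentiable[OF smooth_h z], of i j "(0, snd z)"]
      vertical_h[OF z, of _ i j] by (simp add: mult.commute)
  ultimately show ?thesis by (simp add: sum.distrib)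
qed

end

locale projective_change =
  s: spray_chart D S + s': spray_chart D S' for D :: "'n::finite coords set" and S S' +
  fixes P :: "'n coords \<Rightarrow> real"
  assumes smooth_P: "smooth_on D P"
    and euler_P: "z \<in> D \<Longrightarrow> frechet_derivative P (at z) (0, snd z) = P z"
    and change: "z \<in> D \<Longrightarrow> S' z = S z - (2 * P z) *\<^sub>R (0, snd z)"
begin

lemma conn_change:
  assumes z: "z \<in> D"
  shows "conn S' i j z = conn S i j z + dy j P z * snd z $ i + P z * axis j 1 $ i"
proof -
  have "((\<lambda>z. spray_coeff S i z + P z * snd z $ i) has_derivative
      (\<lambda>w. frechet_derivative (spray_coeff S i) (at z) w +
         (P z * snd w $ i + frechet_derivative P (at z) w * snd z $ i))) (at z)"
    by (intro has_derivative_add has_derivative_mult smooth_on_has_derivative[OF s.smooth_G z]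
        smooth_on_has_derivative[OF smooth_P z]
        bounded_linear.has_derivative[OF bounded_linear_vec_nth] has_derivative_snd
        has_derivative_ident)
  then have "(spray_coeff S' i has_derivative
      (\<lambda>w. frechet_derivative (spray_coeff S i) (at z) w +
         (P z * snd w $ i + frechet_derivative P (at z) w * snd z $ i))) (at z)"
    by (rule has_derivative_transform_within_open[OF _ s.open_D z])
      (simp add: spray_coeff_def change field_simps)
  from frechet_derivative_eqI[OF this] show ?thesis by (simp add: conn_def dy_def)
qed

lemma derivative_change:
  assumes z: "z \<in> D"
  shows "frechet_derivative S' (at z) w = frechet_derivative S (at z) w
    - ((2 * P z) *\<^sub>R (0, snd w) + (2 * frechet_derivative P (at z) w) *\<^sub>R (0, snd z))"
proof -
  have "((\<lambda>z. S z - (2 * P z) *\<^sub>R (0, snd z)) has_derivative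
      (\<lambda>w. frechet_derivative S (at z) w
    - ((2 * P z) *\<^sub>R (0, snd w) + (2 * frechet_derivative P (at z) w) *\<^sub>R (0, snd z)))) (at z)"
    by (intro has_derivative_diff has_derivative_scaleR has_derivative_mult_right
        smooth_on_has_derivative[OF s.smooth_S z] smooth_on_has_derivative[OF smooth_P z]
        has_derivative_Pair has_derivative_const has_derivative_snd has_derivative_ident)
  then have "(S' has_derivative (\<lambda>w. frechet_derivative S (at z) w
    - ((2 * P z) *\<^sub>R (0, snd w) + (2 * frechet_derivative P (at z) w) *\<^sub>R (0, snd z)))) (at z)"
    by (rule has_derivative_transform_within_open[OF _ s.open_D z]) (simp add: change)
  then show ?thesis by (simp add: frechet_derivative_eqI)
qed

end

locale projective_change_tensor = projective_change D S S' P + vertical_hessian D h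
  for D :: "'n::finite coords set" and S S' P h
begin

text \<open>
  The change of \<open>\<Gamma>\<^sup>k\<^sub>j\<close> is \<open>P \<delta>\<^sup>k\<^sub>j + (\<partial>P/\<partial>y\<^sup>j) y\<^sup>k\<close>, whose second part \<open>h\<close> annihilates.
\<close>

lemma contraction_change:
  assumes z: "z \<in> D"
  shows "(\<Sum>k\<in>UNIV. h i k z * conn S' k j z) = (\<Sum>k\<in>UNIV. h i k z * conn S k j z) + P z * h i j z"
proof -
  have "(\<Sum>k\<in>UNIV. h i k z * conn S' k j z) =
      (\<Sum>k\<in>UNIV. h i k z * conn S k j z + dy j P z * (h i k z * snd z $ k)
          + P z * (axis j 1 $ k * h i k z))"
    by (rule sum.cong) (simp_all add: conn_change[OF z] algebra_simps)
  also have "\<dots> = (\<Sum>k\<in>UNIV. h i k z * conn S k j z) + dy j P z * (\<Sum>k\<in>UNIV. h i k z * snd z $ k)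
          + P z * (\<Sum>k\<in>UNIV. axis j 1 $ k * h i k z)"
    by (simp only: sum.distrib sum_distrib_left)
  finally show ?thesis by (simp add: null_h[OF z] sum_axis)
qed

text \<open>
  By homogeneity of degree \<open>-1\<close>, the term \<open>-2P\<Delta>\<close> in the new spray adds \<open>2P h\<^sub>i\<^sub>j\<close> to its derivative of
  \<open>h\<^sub>i\<^sub>j\<close>, and each of the two connection terms takes away \<open>P h\<^sub>i\<^sub>j\<close>.
\<close>

lemma nabla_change:
  assumes z: "z \<in> D"
  shows "nabla S' h i j z = nabla S h i j z"
proof -
  have sw: "(\<Sum>k\<in>UNIV. conn T k i z * h k j z) = (\<Sum>k\<in>UNIV. h j k z * conn T k i z)" for T i j
    using symmetric_h[OF z] by (simp add: mult.commute)
  have sw': "(\<Sum>k\<in>UNIV. conn T k j z * h i k z) = (\<Sum>k\<in>UNIV. h i k z * conn T k j z)" for T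
    by (simp add: mult.commute)
  have lin: "linear (frechet_derivative (h i j) (at z))"
    using smooth_on_linear_derivative[OF smooth_h z] .
  have "frechet_derivative (h i j) (at z) (S' z) =
      frechet_derivative (h i j) (at z) (S z) + 2 * P z * h i j z"
    unfolding change[OF z] linear_diff[OF lin] linear_cmul[OF lin] euler_h[OF z] by simp
  then show ?thesis
    using symmetric_h[OF z, of i j]
    by (simp add: nabla_def sw sw' contraction_change[OF z])
qed

text \<open>
  Only \<open>m\<^sub>i\<^sub>j\<close> could change, by \<open>P h\<^sub>i\<^sub>j - P h\<^sub>j\<^sub>i = 0\<close>.
\<close>

lemma hform_change:
  assumes z: "z \<in> D"
  shows "hform S' h z u v = hform S h z u v"
  by (rule isotropic_form_eqI[OF s'.isotropic_hform s.isotropic_hform z])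
    (simp_all add: smooth_h s.hform_hv s'.hform_hv s.hform_hh s'.hform_hh contraction_change[OF z]
      symmetric_h[OF z])

end

context spray_form
begin

text \<open>
  The Lie derivative on \<open>(V\<^sub>i, V\<^sub>j)\<close> gives the symmetry of \<open>h\<close>. That on \<open>(\<partial>/\<partial>x\<^sup>i, V\<^sub>j)\<close> is
  \<open>\<Gamma>(h\<^sub>i\<^sub>j) + m\<^sub>i\<^sub>j - 2 h\<^sub>i\<^sub>k \<Gamma>\<^sup>k\<^sub>j\<close>: its symmetric part is \<open>\<nabla>h\<close>, and its antisymmetric part says that \<open>\<omega>\<close>
  vanishes on horizontal pairs, which leaves \<open>\<omega> = h\<^sub>i\<^sub>j dx\<^sup>i \<and> \<phi>\<^sup>j\<close>.
\<close>

lemma helmholtz_of_form: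
  assumes lie: "\<And>z u v. z \<in> D \<Longrightarrow> lie_derivative_form S B z u v = 0"
    and liouville: "\<And>z v. z \<in> D \<Longrightarrow> B z (0, snd z) v = 0"
    and ext: "\<And>z i b d. z \<in> D \<Longrightarrow> exterior_derivative B z (H_field S i z) (0, b) (0, d) = 0"
  shows "vertical_hessian D h"
    and "z \<in> D \<Longrightarrow> nabla S h i j z = 0"
    and "z \<in> D \<Longrightarrow> (\<Sum>l\<in>UNIV. h i l z * riem S l j z) = (\<Sum>l\<in>UNIV. h j l z * riem S l i z)"
    and "z \<in> D \<Longrightarrow> B z u v = hform S h z u v"
proof -
  have sym: "h j i z = h i j z" if "z \<in> D" for z i j
    using lie[OF that, of "(0, axis i 1)" "(0, axis j 1)"] lie_vertical_vertical[OF that, of i j] by simp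
  have hv: "frechet_derivative (h i j) (at z) (S z) + m i j z = 2 * (\<Sum>k\<in>UNIV. h i k z * C k j z)"
    if "z \<in> D" for z i j
    using lie[OF that, of "(axis i 1, 0)" "(0, axis j 1)"] lie_horizontal_vertical[OF that, of i j] by simp
  have hji: "frechet_derivative (h j i) (at z) = frechet_derivative (h i j) (at z)" if "z \<in> D" for z i j
    by (rule frechet_derivative_cong[OF open_D that]) (rule sym)
  have anti: "m j i z = - m i j z" if "z \<in> D" for z i j
    using antisymmetric_B[OF that] .
  have m: "m i j z = (\<Sum>k\<in>UNIV. h i k z * C k j z) - (\<Sum>k\<in>UNIV. h j k z * C k i z)"
    if "z \<in> D" for z i j
    using hv[OF that, of i j] hv[OF that, of j i] hji[OF that, of i j] anti[OF that, of i j] by simp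
  have nabla: "nabla S h i j z = 0" if "z \<in> D" for z i j
  proof -
    have "(\<Sum>k\<in>UNIV. C k i z * h k j z) = (\<Sum>k\<in>UNIV. h j k z * C k i z)"
      using sym[OF that] by (intro sum.cong) (auto simp: mult.commute)
    moreover have "(\<Sum>k\<in>UNIV. C k j z * h i k z) = (\<Sum>k\<in>UNIV. h i k z * C k j z)"
      by (simp add: mult.commute)
    ultimately show ?thesis
      using hv[OF that, of i j] m[OF that, of i j] by (simp add: nabla_def)
  qed
  show "z \<in> D \<Longrightarrow> nabla S h i j z = 0" by (rule nabla)
  show "(\<Sum>l\<in>UNIV. h i l z * riem S l j z) = (\<Sum>l\<in>UNIV. h j l z * riem S l i z)" if "z \<in> D"
    using lie_horizontal_riem[OF that sym nabla[OF that] m, of i j]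
      lie[OF that, of "(axis i 1, 0)" "(axis j 1, 0)"] by simp
  show "B z u v = hform S h z u v" if "z \<in> D"
    by (rule isotropic_form_eqI[OF isotropic_form_axioms isotropic_hform[OF smooth_B] that])
      (simp_all only: hform_hv hform_hh m[OF that])
  show "vertical_hessian D h"
  proof
    show "dy l (h i j) z = dy j (h i l) z" if z: "z \<in> D" for z i j l
    proof -
      have "(\<Sum>i'\<in>UNIV. axis i 1 $ i' * (\<Sum>j'\<in>UNIV. axis j 1 $ j' * (\<Sum>l'\<in>UNIV. axis l 1 $ l' *
          (dy l' (h i' j') z - dy j' (h i' l') z)))) = 0"
        using ext[OF z, of i "axis j 1" "axis l 1"]
        by (simp add: exterior_derivative_vertical[OF z] H_field_eq sum_distrib_left mult.assoc)
      then show ?thesis by (simp only: sum_axis)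
    qed
    show "(\<Sum>j\<in>UNIV. h i j z * snd z $ j) = 0" if z: "z \<in> D" for z i
      using axis_vertical[OF z, of i 0 "snd z"] antisymmetric_B[OF z, of "(axis i 1, 0)" "(0, snd z)"]
        liouville[OF z] by (simp add: mult.commute)
  qed (simp_all add: open_D smooth_B sym)
qed

end

locale helmholtz_chart = spray_chart D S + vertical_hessian D h
  for D :: "'n::finite coords set" and S h +
  assumes nabla_h: "z \<in> D \<Longrightarrow> nabla S h i j z = 0"
    and riem_h: "z \<in> D \<Longrightarrow>
      (\<Sum>l\<in>UNIV. h i l z * riem S l j z) = (\<Sum>l\<in>UNIV. h j l z * riem S l i z)"
begin

sublocale form: spray_form D S "hform S h"
  by (intro spray_form.intro spray_chart_axioms isotropic_hform smooth_h)

lemma lie_derivative_hform: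
  assumes z: "z \<in> D"
  shows "lie_derivative_form S (hform S h) z u v = 0"
proof (rule form.lie_derivative_eqI[OF z])
  have hh: "(\<lambda>z. hform S h z (axis i 1, 0) (0, axis j 1)) = h i j" for i j
    by (simp add: hform_hv)
  have sw: "(\<Sum>k\<in>UNIV. C k i z * h k j z) = (\<Sum>k\<in>UNIV. h j k z * C k i z)"
     "(\<Sum>k\<in>UNIV. C k j z * h i k z) = (\<Sum>k\<in>UNIV. h i k z * C k j z)" for i j
    using symmetric_h[OF z] by (simp_all add: mult.commute)
  show "lie_derivative_form S (hform S h) z (0, axis i 1) (0, axis j 1) = 0" for i j
    by (simp add: form.lie_vertical_vertical[OF z] hform_hv symmetric_h[OF z])
  show "lie_derivative_form S (hform S h) z (axis i 1, 0) (0, axis j 1) = 0" for i j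
    using nabla_h[OF z, of i j]
    by (simp add: form.lie_horizontal_vertical[OF z] hform_hv hform_hh nabla_def sw)
  show "lie_derivative_form S (hform S h) z (axis i 1, 0) (axis j 1, 0) = 0" for i j
    using form.lie_horizontal_riem[OF z, of i j] nabla_h[OF z] riem_h[OF z, of i j]
    by (simp add: hh hform_hv hform_hh symmetric_h)
qed

lemma hform_liouville:
  assumes z: "z \<in> D"
  shows "hform S h z (0, snd z) v = 0"
proof -
  have "hform S h z (0, snd z) v = (\<Sum>i\<in>UNIV. - dx_form i v * (\<Sum>j\<in>UNIV. h i j z * snd z $ j))"
    by (simp add: hform_def dx_form_def phi_form_vertical sum_distrib_left mult.left_commute)
  then show ?thesis by (simp add: null_h[OF z])
qed

text \<open>
  Both contractions vanish: \<open>\<phi>\<^sup>j\<close> on the spray, which is horizontal, and \<open>h\<close> with \<open>dx(\<Gamma>) = y\<close>.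
\<close>

lemma hform_spray:
  assumes z: "z \<in> D"
  shows "hform S h z (S z) v = 0"
proof -
  have "hform S h z (S z) v = (\<Sum>i\<in>UNIV. \<Sum>j\<in>UNIV. h i j z * snd z $ i * phi_form S j z v)"
    by (simp add: hform_def phi_form_spray[OF z] mult.assoc) (simp add: dx_form_def fst_S[OF z])
  also have "\<dots> = (\<Sum>j\<in>UNIV. \<Sum>i\<in>UNIV. h i j z * snd z $ i * phi_form S j z v)"
    by (rule sum.swap)
  also have "\<dots> = 0"
    by (simp add: sum_distrib_right[symmetric] null_h_left[OF z])
  finally show ?thesis .
qed

text \<open>
  \<open>h\<close> is homogeneous of degree \<open>-1\<close> and the connection coefficients of degree \<open>1\<close>, so the flow of
  \<open>\<Delta>\<close> preserves the form.
\<close>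

lemma hform_homogeneous:
  assumes z: "z \<in> D"
  shows "frechet_derivative (\<lambda>z. hform S h z u v) (at z) (0, snd z) =
    - hform S h z (0, snd u) v - hform S h z u (0, snd v)"
proof -
  have dm: "frechet_derivative (\<lambda>z. hform S h z (axis i 1, 0) (axis j 1, 0)) (at z) (0, snd z) = 0" for i j
  proof -
    have d: "((\<lambda>z. \<Sum>k\<in>UNIV. h i k z * C k j z) has_derivative
      (\<lambda>w. \<Sum>k\<in>UNIV. h i k z * frechet_derivative (C k j) (at z) w
          + frechet_derivative (h i k) (at z) w * C k j z)) (at z)" for i j
      by (intro has_derivative_sum has_derivative_mult smooth_on_has_derivative[OF _ z] smooth_h smooth_C)
    from frechet_derivative_eqI[OF has_derivative_diff[OF d[of i j] d[of j i]]]
    show ?thesis by (simp add: hform_hh euler_h[OF z] euler_C[OF z])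
  qed
  have "((\<lambda>z. (\<Sum>i\<in>UNIV. \<Sum>j\<in>UNIV. (fst u $ i * snd v $ j - fst v $ i * snd u $ j) * h i j z)
    + (\<Sum>i\<in>UNIV. \<Sum>j\<in>UNIV. fst u $ i * fst v $ j * hform S h z (axis i 1, 0) (axis j 1, 0)))
    has_derivative (\<lambda>w.
    (\<Sum>i\<in>UNIV. \<Sum>j\<in>UNIV. (fst u $ i * snd v $ j - fst v $ i * snd u $ j) *
       frechet_derivative (h i j) (at z) w)
    + (\<Sum>i\<in>UNIV. \<Sum>j\<in>UNIV. fst u $ i * fst v $ j *
       frechet_derivative (\<lambda>z. hform S h z (axis i 1, 0) (axis j 1, 0)) (at z) w))) (at z)"
    by (intro has_derivative_add has_derivative_sum has_derivative_mult_right
       smooth_on_has_derivative[OF _ z] smooth_h form.smooth_B)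
  then have "((\<lambda>z. hform S h z u v) has_derivative (\<lambda>w.
    (\<Sum>i\<in>UNIV. \<Sum>j\<in>UNIV. (fst u $ i * snd v $ j - fst v $ i * snd u $ j) *
       frechet_derivative (h i j) (at z) w)
    + (\<Sum>i\<in>UNIV. \<Sum>j\<in>UNIV. fst u $ i * fst v $ j *
       frechet_derivative (\<lambda>z. hform S h z (axis i 1, 0) (axis j 1, 0)) (at z) w))) (at z)"
  proof (rule has_derivative_transform_within_open[OF _ open_D z])
    show "(\<Sum>i\<in>UNIV. \<Sum>j\<in>UNIV. (fst u $ i * snd v $ j - fst v $ i * snd u $ j) * h i j x)
      + (\<Sum>i\<in>UNIV. \<Sum>j\<in>UNIV. fst u $ i * fst v $ j * hform S h x (axis i 1, 0) (axis j 1, 0)) =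
      hform S h x u v" if "x \<in> D" for x
      using form.component_expansion[OF that, of u v] by (simp only: hform_hv)
  qed
  from frechet_derivative_eqI[OF this] show ?thesis
    using form.vertical_first[OF z, of "snd u" v]
      form.horizontal_vertical[OF z, of "fst u" "snd u" "snd v"]
    by (simp add: dm euler_h[OF z] hform_hv sum_subtractf sum_negf algebra_simps)
qed

end

text \<open>
  Since the form depends only on the projective class and \<open>\<Delta>\<close> is characteristic, changing the
  spray adds to the Lie derivative a multiple of the Lie derivative along \<open>\<Delta>\<close>, which vanishes.
\<close>

lemma lie_derivative_change:
  assumes "helmholtz_chart D S h" and "projective_change D S S' P" and z: "z \<in> D"
  shows "lie_derivative_form S' (hform S' h) z u v = 0"
proof -
  interpret helmholtz_chart D S h by fact
  interpret pc: projective_change D S S' P by fact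
  interpret pt: projective_change_tensor D S S' P h
    by (intro projective_change_tensor.intro pc.projective_change_axioms vertical_hessian_axioms)
  let ?B = "hform S h z"
  have lin1: "linear (?B u)" and lin2: "linear (\<lambda>u. ?B u v)" for u v
    using bilinear_hform[of S h z] unfolding bilinear_def by blast+
  have lin3: "linear (frechet_derivative (\<lambda>z. hform S h z u v) (at z))"
    using smooth_on_linear_derivative[OF form.smooth_B z] .
  have right: "?B u (0, snd z) = 0" for u
    using form.antisymmetric_B[OF z, of u "(0, snd z)"] hform_liouville[OF z] by simp
  have eq: "frechet_derivative (\<lambda>z. hform S' h z u v) (at z) = frechet_derivative (\<lambda>z. hform S h z u v) (at z)"
    by (rule frechet_derivative_cong[OF open_D z]) (rule pt.hform_change)
  have "frechet_derivative (\<lambda>z. hform S h z u v) (at z) (S' z) =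
      frechet_derivative (\<lambda>z. hform S h z u v) (at z) (S z)
      + 2 * P z * (?B (0, snd u) v + ?B u (0, snd v))"
    unfolding pc.change[OF z] linear_diff[OF lin3] linear_cmul[OF lin3] hform_homogeneous[OF z]
    by (simp add: algebra_simps)
  moreover have "?B (frechet_derivative S' (at z) u) v =
      ?B (frechet_derivative S (at z) u) v - 2 * P z * ?B (0, snd u) v"
    unfolding pc.derivative_change[OF z] linear_diff[OF lin2] linear_add[OF lin2] linear_cmul[OF lin2]
    by (simp add: hform_liouville[OF z])
  moreover have "?B u (frechet_derivative S' (at z) v) =
      ?B u (frechet_derivative S (at z) v) - 2 * P z * ?B u (0, snd v)"
    unfolding pc.derivative_change[OF z] linear_diff[OF lin1] linear_add[OF lin1] linear_cmul[OF lin1]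
    by (simp add: right)
  ultimately show ?thesis
    using lie_derivative_hform[OF z, of u v]
    by (simp add: lie_derivative_form_def eq pt.hform_change[OF z] algebra_simps)
qed

section \<open>Extension of vector fields by bump functions\<close>

text \<open>
  The derivative of \<open>t\<^sup>-\<^sup>n exp(-1/t)\<close> is again a combination of such functions, so the family
  \<open>flat n\<close> gives all derivatives of \<open>flat 0\<close> at once.
\<close>

definition flat :: "nat \<Rightarrow> real \<Rightarrow> real" where
  "flat n t = (if 0 < t then inverse t ^ n * exp (- inverse t) else 0)"

lemma flat_tendsto_0: "((\<lambda>t. flat n t) \<longlongrightarrow> 0) (at 0)"
proof -
  have "((\<lambda>t. inverse t ^ n / exp (inverse t)) \<longlongrightarrow> (0::real)) (at_right 0)"
    by (rule filterlim_compose[OF tendsto_power_div_exp_0 filterlim_inverse_at_top_right])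
  then have "(flat n \<longlongrightarrow> 0) (at_right 0)"
    by (rule Lim_transform_eventually)
      (auto simp: flat_def eventually_at_filter exp_minus field_simps)
  moreover have "(flat n \<longlongrightarrow> 0) (at_left 0)"
    by (rule Lim_transform_eventually[OF tendsto_const])
      (auto simp: flat_def eventually_at_filter)
  ultimately show ?thesis by (simp add: filterlim_split_at)
qed

lemma flat_has_derivative:
  "(flat n has_real_derivative (flat (n + 2) t - real n * flat (n + 1) t)) (at t)"
proof -
  consider "t < 0" | "t = 0" | "t > 0" by linarith
  then show ?thesis
  proof cases
    case 1
    have "(flat n has_real_derivative 0) (at t)"
      by (rule has_field_derivative_transform_within_open[of "\<lambda>_. 0" _ _ "{..<0}"])
        (use 1 in \<open>auto simp: flat_def\<close>)
    with 1 show ?thesis by (simp add: flat_def)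
  next
    case 2
    have "(\<lambda>h. (flat n (0 + h) - flat n 0) / h) = flat (Suc n)"
      by (auto simp: flat_def field_simps)
    then have "(flat n has_real_derivative 0) (at 0)"
      using flat_tendsto_0[of "Suc n"] by (simp add: DERIV_def)
    with 2 show ?thesis by (simp add: flat_def)
  next
    case 3
    have "((\<lambda>t. inverse t ^ n * exp (- inverse t)) has_real_derivative
        (flat (n + 2) t - real n * flat (n + 1) t)) (at t)"
    proof -
      have "((\<lambda>t. inverse t ^ n * exp (- inverse t)) has_real_derivative
          real n * inverse t ^ (n - 1) * (- (inverse t)\<^sup>2) * exp (- inverse t)
          + inverse t ^ n * (exp (- inverse t) * (inverse t)\<^sup>2)) (at t)"
        using 3 by (auto intro!: derivative_eq_intros simp: power2_eq_square)
      moreover have "real n * inverse t ^ (n - 1) * (- (inverse t)\<^sup>2) * exp (- inverse t)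
          + inverse t ^ n * (exp (- inverse t) * (inverse t)\<^sup>2) =
          flat (n + 2) t - real n * flat (n + 1) t"
        using 3 by (cases n) (simp_all add: flat_def power2_eq_square)
      ultimately show ?thesis by simp
    qed
    then show ?thesis
      by (rule has_field_derivative_transform_within_open[of _ _ _ "{0<..}"])
        (use 3 in \<open>auto simp: flat_def\<close>)
  qed
qed

lemma smooth_flat: "smooth_on UNIV (flat n)"
proof -
  have "Ck_on m UNIV (flat n)" for m
  proof (induction m arbitrary: n)
    case 0
    then show ?case
      using flat_has_derivative DERIV_isCont continuous_at_imp_continuous_on by (metis Ck_on.simps(1))
  next
    case (Suc m)
    show ?case
    proof (rule Ck_on_SucI[OF open_UNIV])
      show "(flat n has_derivative (*) (flat (n + 2) t - real n * flat (n + 1) t)) (at t)" for t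
        using flat_has_derivative by (simp add: has_field_derivative_def)
      have "Ck_on m UNIV (\<lambda>t. v *\<^sub>R (flat (n + 2) t + (- real n) *\<^sub>R flat (n + 1) t))" for v
        by (intro Ck_on_bounded_linear[OF _ bounded_linear_scaleR_right] Ck_on_add Suc.IH open_UNIV)
      then show "Ck_on m UNIV (\<lambda>t. (flat (n + 2) t - real n * flat (n + 1) t) * v)" for v
        by (simp add: mult.commute)
    qed
  qed
  then show ?thesis by (simp add: smooth_on_def)
qed

lemma bump_function:
  fixes x :: "'e::euclidean_space"
  assumes "open U" "x \<in> U"
  obtains r \<beta> where "0 < r" "cball x r \<subseteq> U" "smooth_on UNIV \<beta>" "\<beta> x = (1::real)"
    "\<And>y. y \<notin> cball x r \<Longrightarrow> \<beta> y = 0"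
proof -
  obtain r where r: "0 < r" "cball x r \<subseteq> U"
    using assms open_contains_cball by blast
  define \<beta> where "\<beta> y = inverse (flat 0 (r\<^sup>2)) * flat 0 (r\<^sup>2 - (y - x) \<bullet> (y - x))" for y
  have "smooth_on UNIV (\<lambda>y. (y - x) \<bullet> (y - x))"
    unfolding smooth_on_def
    by (intro allI Ck_on_bounded_bilinear[OF open_UNIV bounded_bilinear_inner])
      (use smooth_on_diff[OF open_UNIV smooth_on_ident smooth_on_const] in
        \<open>auto simp: smooth_on_def\<close>)
  then have "smooth_on UNIV (\<lambda>y. r\<^sup>2 - (y - x) \<bullet> (y - x))"
    by (intro smooth_intros open_UNIV)
  from smooth_on_compose[OF open_UNIV open_UNIV _ this smooth_flat]
  have "smooth_on UNIV \<beta>"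
    unfolding \<beta>_def[abs_def] by (intro smooth_intros open_UNIV) auto
  moreover have "\<beta> x = 1" using r by (simp add: \<beta>_def flat_def)
  moreover have "\<beta> y = 0" if "y \<notin> cball x r" for y
  proof -
    have "r < norm (y - x)" using that by (simp add: dist_norm norm_minus_commute)
    then have "r\<^sup>2 < (norm (y - x))\<^sup>2" using r by (intro power_strict_mono) auto
    then show ?thesis by (simp add: \<beta>_def flat_def power2_norm_eq_inner)
  qed
  ultimately show ?thesis using that r by blast
qed

locale manifold = base_atlas A for A :: "('a, 'n::finite) mchart set" +
  fixes M :: "'a topology"
  assumes manifold: "paracompact_manifold M A"
begin

lemma chart_facts:
  assumes "k \<in> A"
  shows "openin M (fst k)" "fst k \<subseteq> topspace M" "open (snd k ` fst k)"
    "homeomorphic_map (subtopology M (fst k)) (top_of_set (snd k ` fst k)) (snd k)"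
  using manifold assms openin_subset by (auto simp: paracompact_manifold_def is_chart_def)

lemma topspace_subtopology_chart: "k \<in> A \<Longrightarrow> topspace (subtopology M (fst k)) = fst k"
  using chart_facts(2)[of k] by auto

text \<open>
  Compact subsets are closed since the manifold is Hausdorff.
\<close>

lemma closed_preimage_compact:
  assumes k: "k \<in> A" and C: "compact C" "C \<subseteq> snd k ` fst k"
  shows "closedin M {p \<in> fst k. snd k p \<in> C}"
proof -
  let ?C = "{p \<in> fst k. snd k p \<in> C}"
  have "snd k ` ?C = C" using C by blast
  moreover have "compactin (top_of_set (snd k ` fst k)) C"
    using C by (simp add: compactin_subtopology)
  ultimately have "compactin (subtopology M (fst k)) ?C"
    using homeomorphic_map_compactness[OF chart_facts(4)[OF k], of ?C]
    unfolding topspace_subtopology_chart[OF k] by auto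
  then have "compactin M ?C" by (simp add: compactin_subtopology)
  then show ?thesis
    using manifold compactin_imp_closedin by (auto simp: paracompact_manifold_def)
qed

lemma open_chart_image:
  assumes l: "l \<in> A" and "closedin M C"
  shows "open (snd l ` (fst l - C))"
proof -
  have "openin M (fst l - C)" using chart_facts(1)[OF l] assms by (simp add: openin_diff)
  then have "openin (subtopology M (fst l)) (fst l - C)"
    by (metis Diff_subset inf.absorb_iff2 openin_subtopology_Int2)
  then have "openin (top_of_set (snd l ` fst l)) (snd l ` (fst l - C))"
    using chart_facts(4)[OF l] homeomorphic_imp_open_map open_map_def by blast
  then show ?thesis using chart_facts(3)[OF l] openin_open_trans by blast
qed

lemma slit_chart_subset: "k \<in> A \<Longrightarrow> fst (slit_chart A k) \<subseteq> slit_tangent A (topspace M)"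
  using chart_facts(2)[of k] by (auto simp: slit_chart_simps slit_tangent_def)

lemma slit_tangent_covered:
  assumes "q \<in> slit_tangent A (topspace M)"
  obtains l where "l \<in> A" "q \<in> fst (slit_chart A l)"
proof -
  obtain p v where q: "q = (p, v)" "p \<in> topspace M" using assms by (auto simp: slit_tangent_def)
  then obtain l where "l \<in> A" "p \<in> fst l" using manifold unfolding paracompact_manifold_def by blast
  then show ?thesis using assms q by (intro that[of l]) (auto simp: slit_chart_simps slit_tangent_def)
qed

text \<open>
  The properties of the form speak of vector fields on the whole slit tangent bundle; to use them at
  a point, a field given in one chart has to be extended without changing its value there.
  The cut-off function is lifted from the base, where the support of a bump function in a chart is
  compact and hence closed in the whole manifold; so the extension by zero is smooth.
\<close>

lemma vector_field_extension:
  assumes k: "k \<in> A" and q: "q \<in> fst (slit_chart A k)"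
    and u: "smooth_on (snd (slit_chart A k) ` fst (slit_chart A k)) u"
  obtains X where "vector_field (slit_atlas A) (slit_tangent A (topspace M)) X"
    "X q (slit_chart A k) = u (snd (slit_chart A k) q)"
    "\<And>q'. X q' = (\<lambda>_. 0) \<or> (q' \<in> fst (slit_chart A k) \<and>
        (\<exists>c. X q' (slit_chart A k) = c *\<^sub>R u (snd (slit_chart A k) q')))"
proof -
  let ?K = "slit_chart A k"
  note K = slit_atlas_chart[OF k]
  have x: "fst (snd ?K q) \<in> snd k ` fst k"
  proof -
    have "snd ?K q \<in> (snd k ` fst k) \<times> (- {0})"
      unfolding slit_chart_image[OF k, symmetric] using q by (rule imageI)
    then show ?thesis by (simp add: mem_Times_iff)
  qed
  obtain r \<beta> where \<beta>: "0 < r" "cball (fst (snd ?K q)) r \<subseteq> snd k ` fst k" "smooth_on UNIV \<beta>"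
    "\<beta> (fst (snd ?K q)) = (1::real)" "\<And>y. y \<notin> cball (fst (snd ?K q)) r \<Longrightarrow> \<beta> y = 0"
    using bump_function[OF chart_facts(3)[OF k] x] by blast
  define w where "w z = \<beta> (fst z) *\<^sub>R u z" for z
  define X where "X q' = (if q' \<in> fst ?K then tangent_of (slit_atlas A) ?K q' (w (snd ?K q')) else (\<lambda>_. 0))" for q'
  define C where "C = {p \<in> fst k. snd k p \<in> cball (fst (snd ?K q)) r}"
  have C: "closedin M C"
    unfolding C_def using \<beta>(2) by (intro closed_preimage_compact[OF k]) auto
  have "smooth_on (snd ?K ` fst ?K) (\<lambda>z. \<beta> (fst z))"
    by (rule smooth_on_compose[OF slit.open_chart[OF K] open_UNIV _ _ \<beta>(3)])
      (auto intro!: smooth_intros slit.open_chart[OF K])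
  then have w: "smooth_on (snd ?K ` fst ?K) w"
    unfolding w_def[abs_def] by (intro smooth_intros slit.open_chart[OF K] u)
  have "smooth_on (snd L ` (fst L \<inter> slit_tangent A (topspace M))) (field_rep L X)"
    if "L \<in> slit_atlas A" for L
  proof -
    obtain l where l: "l \<in> A" "L = slit_chart A l" using \<open>L \<in> slit_atlas A\<close> by (rule slit_atlas_cases)
    let ?E1 = "snd L ` (fst L \<inter> fst ?K)" and ?E2 = "(snd l ` (fst l - C)) \<times> (- {0::(real, 'n) vec})"
    have E2: "?E2 = snd L ` slit_tangent A (fst l - C)"
      using slit_image[OF l(1), of "fst l - C"] l(2) by simp
    have "snd L ` (fst L \<inter> slit_tangent A (topspace M)) = snd L ` fst L"
      using slit_chart_subset[OF l(1)] l(2) by (simp add: Int_absorb2)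
    also have "\<dots> = ?E1 \<union> ?E2"
      unfolding E2 image_Un[symmetric]
      by (rule arg_cong[where f = "image _"])
        (auto simp: l(2) slit_chart_simps slit_tangent_def C_def)
    finally have E: "snd L ` (fst L \<inter> slit_tangent A (topspace M)) = ?E1 \<union> ?E2" .
    have op: "open ?E1" "open ?E2"
      using slit.open_overlap[OF \<open>L \<in> slit_atlas A\<close> K] open_chart_image[OF l(1) C]
      by (auto intro: open_Times)
    \<comment> \<open>over the overlap of the charts: the transported field\<close>
    have "smooth_on ?E1 (field_rep L X)"
    proof (rule smooth_on_cong[OF op(1) _ slit.smooth_on_transported_field[OF K \<open>L \<in> slit_atlas A\<close> w]])
      fix z assume "z \<in> ?E1"
      then obtain q' where "z = snd L q'" "q' \<in> fst L" "q' \<in> fst ?K" by blast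
      then show "frechet_derivative (transition ?K L) (at (transition L ?K z)) (w (transition L ?K z)) =
          field_rep L X z"
        using K that by (simp add: X_def field_rep_def slit.transition_chart slit.cinv_chart
            slit.tangent_of_apply)
    qed
    \<comment> \<open>away from the support: zero\<close>
    moreover have "smooth_on ?E2 (field_rep L X)"
    proof (rule smooth_on_cong[OF op(2) _ smooth_on_const])
      fix z assume "z \<in> ?E2"
      then obtain p v where z: "z = snd L (p, v)" "(p, v) \<in> fst L" "p \<notin> C"
        unfolding E2 by (auto simp: l(2) slit_chart_simps slit_tangent_def)
      have "X (p, v) = (\<lambda>_. 0)"
      proof (cases "(p, v) \<in> fst ?K")
        case True
        then have "snd k p \<notin> cball (fst (snd ?K q)) r"
          using z(3) by (auto simp: C_def slit_chart_simps slit_tangent_def)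
        then have "w (snd ?K (p, v)) = 0" by (simp add: w_def \<beta>(5) slit_chart_simps)
        then show ?thesis using slit.tangent_of_zero[OF K] True by (simp add: X_def)
      qed (simp add: X_def)
      then show "0 = field_rep L X z"
        using that z by (simp add: field_rep_def slit.cinv_chart)
    qed
    ultimately show ?thesis unfolding E using op by (intro smooth_on_Un)
  qed
  moreover have "X q' \<in> tangent_space (slit_atlas A) q'" for q'
    using slit.tangent_of_in[OF K] slit.zero_in_tangent_space by (simp add: X_def)
  ultimately have "vector_field (slit_atlas A) (slit_tangent A (topspace M)) X"
    by (simp add: vector_field_def)
  moreover have "X q ?K = u (snd ?K q)"
    using q by (simp add: X_def slit.tangent_of_self[OF K] w_def \<beta>(4))
  moreover have "X q' = (\<lambda>_. 0) \<or> (q' \<in> fst ?K \<and> (\<exists>c. X q' ?K = c *\<^sub>R u (snd ?K q')))" for q'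
    by (auto simp: X_def slit.tangent_of_self[OF K] w_def)
  ultimately show ?thesis by (rule that)
qed

end

section \<open>Sprays and forms in an induced chart\<close>

lemma span_vertical:
  fixes a :: "'n::finite coords"
  shows "a \<in> span (range (\<lambda>i. V_field i z)) \<longleftrightarrow> fst a = 0"
proof
  have "subspace {a :: 'n coords. fst a = 0}" by (auto simp: subspace_def)
  moreover have "range (\<lambda>i. V_field i z) \<subseteq> {a. fst a = 0}" by (auto simp: V_field_def)
  ultimately show "a \<in> span (range (\<lambda>i. V_field i z)) \<Longrightarrow> fst a = 0"
    using span_minimal by blast
next
  assume "fst a = 0"
  then have "a = (\<Sum>i\<in>UNIV. snd a $ i *\<^sub>R V_field i z)"
    using basis_expansion[of "snd a"]
    by (intro prod_eqI) (simp_all add: V_field_def fst_sum snd_sum scalar_mult_eq_scaleR)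
  moreover have "(\<Sum>i\<in>UNIV. snd a $ i *\<^sub>R V_field i z) \<in> span (range (\<lambda>i. V_field i z))"
    by (intro span_sum span_scale span_base) auto
  ultimately show "a \<in> span (range (\<lambda>i. V_field i z))" by simp
qed

lemma helmholtz_form_eq:
  "helmholtz_form A \<Gamma> k h q X Y =
    hform (field_rep (slit_chart A k) \<Gamma>) h (snd (slit_chart A k) q) (X (slit_chart A k)) (Y (slit_chart A k))"
  by (simp add: helmholtz_form_def hform_def Let_def)

context manifold
begin

lemma chart_domain:
  "k \<in> A \<Longrightarrow> fst (slit_chart A k) \<inter> slit_tangent A (topspace M) = fst (slit_chart A k)"
  using slit_chart_subset[of k] by blast

lemma field_rep_liouville:
  assumes "k \<in> A" "z \<in> snd (slit_chart A k) ` fst (slit_chart A k)"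
  shows "field_rep (slit_chart A k) (liouville A) z = (0, snd z)"
  using assms slit_atlas_chart[OF assms(1)]
  by (auto simp: field_rep_def liouville_def slit.cinv_chart)

lemma spray_chart_rep:
  assumes \<Gamma>: "spray M A \<Gamma>" and k: "k \<in> A"
  shows "spray_chart (snd (slit_chart A k) ` fst (slit_chart A k)) (field_rep (slit_chart A k) \<Gamma>)"
proof
  let ?K = "slit_chart A k" let ?D = "snd ?K ` fst ?K" let ?S = "field_rep ?K \<Gamma>"
  note K = slit_atlas_chart[OF k]
  show D: "open ?D" using slit.open_chart[OF K] .
  show "smooth_on ?D ?S"
    using \<Gamma> K chart_domain[OF k] unfolding spray_def vector_field_def by metis
  show "fst (?S z) = snd z" if "z \<in> ?D" for z
    using \<Gamma> K that by (auto simp: spray_def)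
  show "snd (frechet_derivative ?S (at z) (0, snd z)) = 2 *\<^sub>R snd (?S z)" if z: "z \<in> ?D" for z
  proof -
    have "frechet_derivative (field_rep ?K (liouville A)) (at z) =
        frechet_derivative (\<lambda>z. (0, snd z)) (at z)"
      by (rule frechet_derivative_cong[OF D z]) (rule field_rep_liouville[OF k])
    also have "\<dots> = (\<lambda>w. (0, snd w))"
      by (intro frechet_derivative_eqI has_derivative_Pair has_derivative_const has_derivative_snd
          has_derivative_ident)
    finally have DL: "frechet_derivative (field_rep ?K (liouville A)) (at z) = (\<lambda>w. (0, snd w))" .
    have "lie_bracket (field_rep ?K (liouville A)) ?S z = ?S z"
      using \<Gamma> K z unfolding spray_def by blast
    then have "frechet_derivative ?S (at z) (0, snd z) - (0, snd (?S z)) = ?S z"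
      unfolding lie_bracket_def DL field_rep_liouville[OF k z] .
    then have "snd (frechet_derivative ?S (at z) (0, snd z) - (0, snd (?S z))) = snd (?S z)" by simp
    then show ?thesis by (simp add: scaleR_2 algebra_simps)
  qed
qed

lemma projective_change_rep:
  assumes \<Gamma>: "spray M A \<Gamma>" and \<Gamma>': "\<Gamma>' \<in> projective_class M A \<Gamma>" and k: "k \<in> A"
  obtains P where "projective_change (snd (slit_chart A k) ` fst (slit_chart A k))
    (field_rep (slit_chart A k) \<Gamma>) (field_rep (slit_chart A k) \<Gamma>') P"
proof -
  let ?K = "slit_chart A k" let ?D = "snd ?K ` fst ?K"
  note K = slit_atlas_chart[OF k]
  from \<Gamma>' obtain P where sp: "spray M A \<Gamma>'"
    and P: "smooth_function (slit_atlas A) (slit_tangent A (topspace M)) P"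
      "\<And>K z. K \<in> slit_atlas A \<Longrightarrow> z \<in> snd K ` fst K \<Longrightarrow>
         frechet_derivative (function_rep K P) (at z) (field_rep K (liouville A) z) = function_rep K P z"
      "\<And>q K. q \<in> slit_tangent A (topspace M) \<Longrightarrow> K \<in> slit_atlas A \<Longrightarrow>
         \<Gamma>' q K = \<Gamma> q K - (2 * P q) *\<^sub>R liouville A q K"
    unfolding projective_class_def mem_Collect_eq by (elim conjE exE) (rule that; blast)
  have "projective_change ?D (field_rep ?K \<Gamma>) (field_rep ?K \<Gamma>') (function_rep ?K P)"
  proof (intro projective_change.intro spray_chart_rep \<Gamma> sp k projective_change_axioms.intro)
    show "smooth_on ?D (function_rep ?K P)"
      using P(1) K chart_domain[OF k] unfolding smooth_function_def by metis
    fix z assume z: "z \<in> ?D"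
    show "frechet_derivative (function_rep ?K P) (at z) (0, snd z) = function_rep ?K P z"
      using P(2)[OF K z] field_rep_liouville[OF k z] by simp
    from z obtain q where q: "q \<in> fst ?K" "z = snd ?K q" by blast
    then have "q \<in> slit_tangent A (topspace M)" using slit_chart_subset[OF k] by blast
    from P(3)[OF this K] show "field_rep ?K \<Gamma>' z = field_rep ?K \<Gamma> z - (2 * function_rep ?K P z) *\<^sub>R (0, snd z)"
      using q K slit_chart_image[OF k]
      by (simp add: field_rep_def function_rep_def slit.cinv_chart liouville_def)
  qed
  then show ?thesis by (rule that)
qed

lemma spray_in_projective_class:
  assumes "spray M A \<Gamma>"
  shows "\<Gamma> \<in> projective_class M A \<Gamma>"
  unfolding projective_class_def
  using assms by (auto intro!: exI[of _ "\<lambda>_. 0"]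
      simp: smooth_function_def function_rep_def[abs_def] smooth_on_const)

lemma vertical_extension:
  assumes k: "k \<in> A" and q: "q \<in> fst (slit_chart A k)"
  obtains X where "vertical_field A (topspace M) X" "X q (slit_chart A k) = (0, b)"
proof -
  obtain X where X: "vector_field (slit_atlas A) (slit_tangent A (topspace M)) X"
    "X q (slit_chart A k) = (0, b)"
    "\<And>q'. X q' = (\<lambda>_. 0) \<or> (q' \<in> fst (slit_chart A k) \<and>
        (\<exists>c. X q' (slit_chart A k) = c *\<^sub>R (0, b)))"
    using vector_field_extension[OF k q smooth_on_const[of _ "(0, b)"]] by blast
  have "X q' \<in> vertical_space A q'" if "q' \<in> slit_tangent A (topspace M)" for q'
  proof -
    have "X q' \<in> tangent_space (slit_atlas A) q'"
      using X(1) that by (simp add: vector_field_def)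
    moreover obtain l where "l \<in> A" "q' \<in> fst (slit_chart A l)"
      using slit_tangent_covered[OF \<open>q' \<in> slit_tangent A (topspace M)\<close>] .
    then have "\<exists>l\<in>A. q' \<in> fst (slit_chart A l) \<and> fst (X q' (slit_chart A l)) = 0"
      using X(3)[of q'] k by auto
    ultimately show ?thesis
      unfolding vertical_space_def span_vertical by (auto intro: slit_atlas_chart)
  qed
  with X show ?thesis by (intro that[of X]) (auto simp: vertical_field_def)
qed

text \<open>
  Where the extended field does not vanish it is a multiple of \<open>H\<^sub>i\<close> in the chart it was built from;
  the transformation of the horizontal distribution between charts is thus avoided.
\<close>

lemma horizontal_extension:
  assumes \<Gamma>: "spray M A \<Gamma>" and k: "k \<in> A" and q: "q \<in> fst (slit_chart A k)"
  obtains X where "horizontal_field A \<Gamma> (topspace M) X"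
    "X q (slit_chart A k) = H_field (field_rep (slit_chart A k) \<Gamma>) i (snd (slit_chart A k) q)"
proof -
  let ?K = "slit_chart A k" let ?H = "H_field (field_rep ?K \<Gamma>) i"
  interpret s: spray_chart "snd ?K ` fst ?K" "field_rep ?K \<Gamma>" by (rule spray_chart_rep[OF \<Gamma> k])
  obtain X where X: "vector_field (slit_atlas A) (slit_tangent A (topspace M)) X"
    "X q ?K = ?H (snd ?K q)"
    "\<And>q'. X q' = (\<lambda>_. 0) \<or> (q' \<in> fst ?K \<and> (\<exists>c. X q' ?K = c *\<^sub>R ?H (snd ?K q')))"
    using vector_field_extension[OF k q s.smooth_H_field[of i]] by blast
  have "X q' \<in> horizontal_space A \<Gamma> q'" if "q' \<in> slit_tangent A (topspace M)" for q'
  proof -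
    have t: "X q' \<in> tangent_space (slit_atlas A) q'"
      using X(1) that by (simp add: vector_field_def)
    have "\<exists>l\<in>A. q' \<in> fst (slit_chart A l) \<and> X q' (slit_chart A l) \<in>
        span (range (\<lambda>i. H_field (field_rep (slit_chart A l) \<Gamma>) i (snd (slit_chart A l) q')))"
    proof (cases "X q' = (\<lambda>_. 0)")
      case True
      moreover obtain l where "l \<in> A" "q' \<in> fst (slit_chart A l)"
        using slit_tangent_covered[OF \<open>q' \<in> slit_tangent A (topspace M)\<close>] .
      ultimately show ?thesis by (auto intro!: bexI[of _ l] span_zero)
    next
      case False
      then obtain c where "q' \<in> fst ?K" "X q' ?K = c *\<^sub>R ?H (snd ?K q')" using X(3)[of q'] by blast
      moreover have "c *\<^sub>R ?H (snd ?K q') \<in>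
          span (range (\<lambda>i. H_field (field_rep ?K \<Gamma>) i (snd ?K q')))"
        by (intro span_scale span_base rangeI)
      ultimately show ?thesis using k by (intro bexI[of _ k]) auto
    qed
    with t show ?thesis
      unfolding horizontal_space_def by (auto intro: slit_atlas_chart)
  qed
  with X show ?thesis by (intro that[of X]) (auto simp: horizontal_field_def)
qed

section \<open>From the form to the tensor\<close>

text \<open>
  The work in a chart is done by \<open>helmholtz_of_form\<close>. It remains to read the four properties at
  a point, extending vertical and horizontal vectors to fields, and to pass from \<open>\<Gamma>\<close> to the other
  sprays of the class in \<open>\<nabla>h = 0\<close>.
\<close>

lemma helmholtz_of_properties:
  assumes \<Gamma>: "spray M A \<Gamma>"
    and form: "two_form (slit_atlas A) (slit_tangent A (topspace M)) \<omega>"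
    and props: "helmholtz_properties A \<Gamma> (topspace M) \<omega>" and k: "k \<in> A"
  shows "\<exists>h. helmholtz M A \<Gamma> k h \<and>
    (\<forall>q\<in>slit_tangent A (fst k).
       \<forall>X\<in>tangent_space (slit_atlas A) q. \<forall>Y\<in>tangent_space (slit_atlas A) q.
         \<omega> q X Y = helmholtz_form A \<Gamma> k h q X Y)"
proof -
  define K where "K = slit_chart A k"
  define D where "D = snd K ` fst K"
  define S where "S = field_rep K \<Gamma>"
  define B where "B = form_rep (slit_atlas A) K \<omega>"
  have K: "K \<in> slit_atlas A" by (simp add: K_def slit_atlas_chart k)
  have dom: "fst K \<inter> slit_tangent A (topspace M) = fst K" by (simp add: K_def chart_domain[OF k])
  have sub: "q \<in> slit_tangent A (topspace M)" if "q \<in> fst K" for q using that dom by blast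
  have comp: "\<omega> q X Y = B (snd K q) (X K) (Y K)"
    if "q \<in> fst K" "X \<in> tangent_space (slit_atlas A) q" "Y \<in> tangent_space (slit_atlas A) q" for q X Y
    unfolding B_def by (rule slit.form_on_tangent_space[OF K that])
  have vt: "X q \<in> tangent_space (slit_atlas A) q"
    if "vertical_field A (topspace M) X" "q \<in> fst K" for X q
    using that sub by (simp add: vertical_field_def vector_field_def)
  interpret spray_chart D S unfolding D_def S_def K_def by (rule spray_chart_rep[OF \<Gamma> k])
  have "isotropic_form D B"
  proof
    note rep = bspec[OF form[unfolded two_form_def] K, unfolded dom, folded D_def B_def]
    show "bilinear (B z)" "B z u u = 0" if "z \<in> D" for z u using rep that by blast+
    show "smooth_on D (\<lambda>z. B z u v)" for u v using rep by blast
    fix z b d assume "z \<in> D"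
    then obtain q where q: "q \<in> fst K" "z = snd K q" by (auto simp: D_def)
    obtain X Y where X: "vertical_field A (topspace M) X" "X q K = (0, b)"
      and Y: "vertical_field A (topspace M) Y" "Y q K = (0, d)"
      using vertical_extension[OF k] q(1) unfolding K_def by metis
    have "\<omega> q (X q) (Y q) = 0"
      using props X(1) Y(1) sub[OF q(1)] by (auto simp: helmholtz_properties_def)
    then show "B z (0, b) (0, d) = 0"
      using comp[OF q(1) vt[OF X(1) q(1)] vt[OF Y(1) q(1)]] X(2) Y(2) q(2) by simp
  qed (rule open_D)
  then interpret spray_form D S B
    by (intro spray_form.intro spray_chart_axioms)
  have lie: "lie_derivative_form S B z u v = 0" if "z \<in> D" for z u v
    using props K that dom unfolding helmholtz_properties_def D_def S_def B_def by metis
  have liouville: "B z (0, snd z) v = 0" if z: "z \<in> D" for z v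
  proof -
    obtain q where q: "q \<in> fst K" "z = snd K q" using z by (auto simp: D_def)
    have "liouville A q \<in> projective_distribution A \<Gamma> q"
      unfolding projective_distribution_def using liouville_in_tangent_space
      by (intro CollectI conjI exI[of _ 1] exI[of _ 0]) auto
    then have "liouville A q \<in> characteristic_space (slit_atlas A) \<omega> q"
      using props sub[OF q(1)] by (auto simp: helmholtz_properties_def)
    then have "\<omega> q (liouville A q) (tangent_of (slit_atlas A) K q v) = 0"
      using slit.tangent_of_in[OF K q(1)] by (auto simp: characteristic_space_def)
    then show ?thesis
      using comp[OF q(1) liouville_in_tangent_space slit.tangent_of_in[OF K q(1), of v]] q K
      by (simp add: slit.tangent_of_self liouville_def)
  qed
  have ext: "exterior_derivative B z (H_field S i z) (0, b) (0, d) = 0" if z: "z \<in> D" for z i b d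
  proof -
    obtain q where q: "q \<in> fst K" "z = snd K q" using z by (auto simp: D_def)
    obtain X Y where X: "vertical_field A (topspace M) X" "X q K = (0, b)"
      and Y: "vertical_field A (topspace M) Y" "Y q K = (0, d)"
      using vertical_extension[OF k] q(1) unfolding K_def by metis
    obtain H where H: "horizontal_field A \<Gamma> (topspace M) H" "H q K = H_field S i z"
      using horizontal_extension[OF \<Gamma> k, of q i] q unfolding K_def S_def by metis
    have "exterior_derivative B z (field_rep K H z) (field_rep K X z) (field_rep K Y z) = 0"
      using props H(1) X(1) Y(1) K z dom unfolding helmholtz_properties_def B_def D_def by metis
    then show ?thesis
      using q K H(2) X(2) Y(2) by (simp add: field_rep_def slit.cinv_chart)
  qed
  interpret vertical_hessian D h by (rule helmholtz_of_form(1)[OF lie liouville ext])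
  have nabla: "nabla S h i j z = 0" if "z \<in> D" for z i j
    by (rule helmholtz_of_form(2)[OF lie liouville ext that])
  have riem: "(\<Sum>l\<in>UNIV. h i l z * riem S l j z) = (\<Sum>l\<in>UNIV. h j l z * riem S l i z)"
    if "z \<in> D" for z i j
    by (rule helmholtz_of_form(3)[OF lie liouville ext that])
  have hform: "B z u v = hform S h z u v" if "z \<in> D" for z u v
    by (rule helmholtz_of_form(4)[OF lie liouville ext that])
  have "nabla (field_rep K \<Gamma>') h i j z = 0" if \<Gamma>': "\<Gamma>' \<in> projective_class M A \<Gamma>" and z: "z \<in> D"
    for \<Gamma>' i j z
  proof -
    obtain P where "projective_change D S (field_rep K \<Gamma>') P"
      using projective_change_rep[OF \<Gamma> \<Gamma>' k] unfolding D_def S_def K_def by blast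
    then interpret projective_change_tensor D S "field_rep K \<Gamma>'" P h
      by (intro projective_change_tensor.intro vertical_hessian_axioms)
    show ?thesis using nabla_change[OF z] nabla[OF z] by simp
  qed
  moreover have "(\<Sum>l\<in>UNIV. h i l z * weyl S l j z) = (\<Sum>l\<in>UNIV. h j l z * weyl S l i z)"
    if z: "z \<in> D" for i j z
    by (rule iffD2[OF weyl_symmetry_iff[of h z i S j, OF symmetric_h[OF z] null_h[OF z]] riem[OF z]])
  ultimately have "helmholtz M A \<Gamma> k h"
    unfolding helmholtz_def Let_def K_def[symmetric] D_def[symmetric] S_def[symmetric]
    using smooth_h symmetric_h null_h vertical_h by blast
  moreover have "\<omega> q X Y = helmholtz_form A \<Gamma> k h q X Y"
    if "q \<in> slit_tangent A (fst k)" "X \<in> tangent_space (slit_atlas A) q" "Y \<in> tangent_space (slit_atlas A) q"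
    for q X Y
  proof -
    have "q \<in> fst K" using that(1) by (simp add: K_def slit_chart_simps)
    then show ?thesis
      using comp[OF _ that(2,3)] hform[of "snd K q" "X K" "Y K"]
      by (simp add: helmholtz_form_eq K_def[symmetric] S_def[symmetric] D_def)
  qed
  ultimately show ?thesis by blast
qed

section \<open>From the tensor to the form\<close>

text \<open>
  In the chart of \<open>k\<close> the form built from \<open>\<Gamma>'\<close> has the right derivatives, by invariance under change of
  the spray; every other chart sees its pull-back.
\<close>

lemma properties_of_helmholtz:
  assumes \<Gamma>: "spray M A \<Gamma>" and k: "k \<in> A" and helm: "helmholtz M A \<Gamma> k h"
    and \<Gamma>': "\<Gamma>' \<in> projective_class M A \<Gamma>"
  shows "two_form (slit_atlas A) (slit_tangent A (fst k)) (helmholtz_form A \<Gamma>' k h)"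
    and "helmholtz_properties A \<Gamma>' (fst k) (helmholtz_form A \<Gamma>' k h)"
proof -
  define K where "K = slit_chart A k"
  define D where "D = snd K ` fst K"
  define S where "S = field_rep K \<Gamma>"
  define S' where "S' = field_rep K \<Gamma>'"
  define \<omega> where "\<omega> = helmholtz_form A \<Gamma>' k h"
  have K: "K \<in> slit_atlas A" by (simp add: K_def slit_atlas_chart k)
  have fstK: "slit_tangent A (fst k) = fst K" by (simp add: K_def slit_chart_simps)
  have sp': "spray M A \<Gamma>'" using \<Gamma>' by (simp add: projective_class_def)
  note hh = helm[unfolded helmholtz_def Let_def K_def[symmetric] D_def[symmetric] S_def[symmetric]]
  interpret spray_chart D S unfolding D_def S_def K_def by (rule spray_chart_rep[OF \<Gamma> k])
  interpret s': spray_chart D S' unfolding D_def S'_def K_def by (rule spray_chart_rep[OF sp' k])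
  interpret vertical_hessian D h
    by unfold_locales (use hh open_D in blast)+
  have hc: "helmholtz_chart D S h"
  proof (unfold_locales)
    fix z i j assume z: "z \<in> D"
    show "nabla S h i j z = 0"
      using hh z spray_in_projective_class[OF \<Gamma>] unfolding S_def by blast
    show "(\<Sum>l\<in>UNIV. h i l z * riem S l j z) = (\<Sum>l\<in>UNIV. h j l z * riem S l i z)"
      using iffD1[OF weyl_symmetry_iff[of h z i S j, OF symmetric_h[OF z] null_h[OF z]]] hh z by blast
  qed
  then interpret helmholtz_chart D S h .
  obtain P where pc: "projective_change D S S' P"
    using projective_change_rep[OF \<Gamma> \<Gamma>' k] unfolding D_def S_def S'_def K_def by blast
  then interpret projective_change_tensor D S S' P h
    by (intro projective_change_tensor.intro vertical_hessian_axioms)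
  interpret form': isotropic_form D "hform S' h" by (rule s'.isotropic_hform[OF smooth_h])
  have comp: "\<omega> q X Y = hform S' h (snd K q) (X K) (Y K)" for q X Y
    by (simp add: \<omega>_def helmholtz_form_eq K_def S'_def)
  \<comment> \<open>the form is defined through the chart of \<open>k\<close>; in another chart it is a pull-back\<close>
  have pulled: "pulled_back_form (snd L ` (fst L \<inter> fst K)) D (transition L K)
      (form_rep (slit_atlas A) L \<omega>) (hform S' h)" if L: "L \<in> slit_atlas A" for L
  proof
    show "open (snd L ` (fst L \<inter> fst K))" "smooth_on (snd L ` (fst L \<inter> fst K)) (transition L K)"
      using slit.open_overlap[OF L K] slit.smooth_transition[OF L K] .
    show "transition L K ` snd L ` (fst L \<inter> fst K) \<subseteq> D"
      using slit.transition_image[OF L] by (simp add: D_def)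
    fix x u v assume "x \<in> snd L ` (fst L \<inter> fst K)"
    then obtain q where q: "q \<in> fst L" "q \<in> fst K" "x = snd L q" by blast
    show "form_rep (slit_atlas A) L \<omega> x u v = hform S' h (transition L K x)
        (frechet_derivative (transition L K) (at x) u) (frechet_derivative (transition L K) (at x) v)"
      using q by (simp add: form_rep_def comp slit.cinv_chart[OF L] slit.transition_chart[OF L]
          slit.tangent_of_apply[OF L K])
  qed (use open_D form'.bilinear_B form'.smooth_B in blast)+
  have vertical: "fst (frechet_derivative (transition L K) (at (snd L q)) (V q L)) = 0"
    if "vertical_field A (fst k) V" "L \<in> slit_atlas A" "q \<in> fst L" "q \<in> fst K" for V L q
  proof -
    have t: "V q \<in> tangent_space (slit_atlas A) q" "V q \<in> vertical_space A q"
      using that fstK by (auto simp: vertical_field_def vector_field_def)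
    then obtain K' where K': "K' \<in> slit_atlas A" "q \<in> fst K'" "fst (V q K') = 0"
      unfolding vertical_space_def span_vertical by blast
    \<comment> \<open>the chart that witnesses verticality need not be one of the two considered\<close>
    have "fst (V q K) = 0"
      using vertical_transition[OF K'(1) K K'(2) that(4) K'(3)]
        slit.tangent_space_apply[OF t(1) K'(1) K K'(2) that(4)] by simp
    then show ?thesis
      using slit.tangent_space_apply[OF t(1) that(2) K that(3,4)] by simp
  qed
  have alt: "hform S' h y u u = 0" for y u by (simp add: hform_def)
  show "two_form (slit_atlas A) (slit_tangent A (fst k)) (helmholtz_form A \<Gamma>' k h)"
    unfolding two_form_def fstK \<omega>_def[symmetric]
  proof (intro ballI conjI allI)
    fix L assume L: "L \<in> slit_atlas A"
    interpret p: pulled_back_form "snd L ` (fst L \<inter> fst K)" D "transition L K"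
      "form_rep (slit_atlas A) L \<omega>" "hform S' h" by (rule pulled[OF L])
    fix u v
    show "smooth_on (snd L ` (fst L \<inter> fst K)) (\<lambda>z. form_rep (slit_atlas A) L \<omega> z u v)"
      by (rule p.smooth_pulled_back)
    fix z assume z: "z \<in> snd L ` (fst L \<inter> fst K)"
    show "bilinear (form_rep (slit_atlas A) L \<omega> z)" by (rule p.bilinear_pulled_back[OF z])
    show "form_rep (slit_atlas A) L \<omega> z u u = 0" by (simp add: p.pull[OF z] alt)
  qed
  have characteristic: "projective_distribution A \<Gamma>' q \<subseteq> characteristic_space (slit_atlas A) \<omega> q" if q: "q \<in> fst K" for q
  proof
    fix Z assume Z: "Z \<in> projective_distribution A \<Gamma>' q"
    let ?z = "snd K q"
    have z: "?z \<in> D" using q by (simp add: D_def)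
    from Z obtain a b where ab: "Z K = a *\<^sub>R liouville A q K + b *\<^sub>R \<Gamma>' q K"
      using K by (auto simp: projective_distribution_def)
    have "liouville A q K = (0, snd ?z)" "\<Gamma>' q K = S' ?z"
      using q K by (simp_all add: liouville_def S'_def field_rep_def slit.cinv_chart)
    then have ZK: "Z K = a *\<^sub>R (0, snd ?z) + b *\<^sub>R (S ?z - (2 * P ?z) *\<^sub>R (0, snd ?z))"
      using ab change[OF z] by simp
    have lin: "linear (\<lambda>u. hform S h ?z u v)" for v
      using bilinear_hform[of S h ?z] unfolding bilinear_def by blast
    have "hform S h ?z (Z K) v = 0" for v
      unfolding ZK linear_add[OF lin] linear_cmul[OF lin] linear_diff[OF lin]
        hform_liouville[OF z] hform_spray[OF z] by simp
    then have "\<omega> q Z Y = 0" for Y by (simp add: comp hform_change[OF z])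
    then show "Z \<in> characteristic_space (slit_atlas A) \<omega> q"
      using Z by (simp add: characteristic_space_def projective_distribution_def)
  qed
  have lie: "lie_derivative_form (field_rep L \<Gamma>') (form_rep (slit_atlas A) L \<omega>) z u v = 0"
    if L: "L \<in> slit_atlas A" and z: "z \<in> snd L ` (fst L \<inter> fst K)" for L z u v
  proof -
    interpret p: pulled_back_form "snd L ` (fst L \<inter> fst K)" D "transition L K"
      "form_rep (slit_atlas A) L \<omega>" "hform S' h" by (rule pulled[OF L])
    have vf: "vector_field (slit_atlas A) (slit_tangent A (topspace M)) \<Gamma>'"
      using sp' by (simp add: spray_def)
    have sub: "fst K \<subseteq> slit_tangent A (topspace M)"
      unfolding K_def by (rule slit_chart_subset[OF k])
    have sm: "smooth_on (snd L ` (fst L \<inter> fst K)) (field_rep L \<Gamma>')"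
      by (rule smooth_on_subset[of _ "snd L ` (fst L \<inter> slit_tangent A (topspace M))"])
        (use vf L sub in \<open>auto simp: vector_field_def\<close>)
    have rel: "S' (transition L K x) = frechet_derivative (transition L K) (at x) (field_rep L \<Gamma>' x)"
      if "x \<in> snd L ` (fst L \<inter> fst K)" for x
    proof -
      obtain q where q: "q \<in> fst L" "q \<in> fst K" "x = snd L q" using \<open>x \<in> _\<close> by blast
      then have "\<Gamma>' q \<in> tangent_space (slit_atlas A) q"
        using vf sub by (auto simp: vector_field_def)
      from slit.field_rep_transition[where X = \<Gamma>', OF L K q(1,2) this] show ?thesis by (simp add: S'_def q(3))
    qed
    have "transition L K z \<in> D" using p.T(2) z by blast
    then show ?thesis
      using p.lie_derivative_form_pulled_back[OF sm s'.smooth_S rel z] lie_derivative_change[OF hc pc]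
      by simp
  qed
  have isotropic: "\<omega> q (V1 q) (V2 q) = 0"
    if "vertical_field A (fst k) V1" "vertical_field A (fst k) V2" "q \<in> fst K" for V1 V2 q
  proof -
    have "fst (V1 q K) = 0" "fst (V2 q K) = 0"
      using vertical[OF that(1) K that(3,3)] vertical[OF that(2) K that(3,3)]
      by (simp_all add: slit.transition_self[OF K that(3)])
    then show ?thesis
      using form'.isotropic_B[of "snd K q" "snd (V1 q K)" "snd (V2 q K)"] that(3)
      by (simp add: comp D_def prod_eq_iff) (metis imageI prod.collapse)
  qed
  have exterior: "exterior_derivative (form_rep (slit_atlas A) L \<omega>) z
      (field_rep L H z) (field_rep L V1 z) (field_rep L V2 z) = 0"
    if V: "vertical_field A (fst k) V1" "vertical_field A (fst k) V2"
      and L: "L \<in> slit_atlas A" and z: "z \<in> snd L ` (fst L \<inter> fst K)" for H V1 V2 L z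
  proof -
    interpret p: pulled_back_form "snd L ` (fst L \<inter> fst K)" D "transition L K"
      "form_rep (slit_atlas A) L \<omega>" "hform S' h" by (rule pulled[OF L])
    obtain q where q: "q \<in> fst L" "q \<in> fst K" "z = snd L q" using z by blast
    have Tz: "transition L K z \<in> D" using p.T(2) z by blast
    let ?DT = "frechet_derivative (transition L K) (at z)"
    have "fst (?DT (V1 q L)) = 0" "fst (?DT (V2 q L)) = 0"
      using vertical[OF V(1) L q(1,2)] vertical[OF V(2) L q(1,2)] q(3) by simp_all
    then obtain b d where bd: "?DT (V1 q L) = (0, b)" "?DT (V2 q L) = (0, d)"
      by (metis prod.collapse)
    have "exterior_derivative (hform S' h) (transition L K z) u (0, b) (0, d) = 0" for u
      using vertical_h[OF Tz] by (simp add: form'.exterior_derivative_vertical[OF Tz] s'.hform_hv)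
    then show ?thesis
      using p.exterior_derivative_pulled_back[OF alt z] q L bd
      by (simp add: field_rep_def slit.cinv_chart)
  qed
  show "helmholtz_properties A \<Gamma>' (fst k) (helmholtz_form A \<Gamma>' k h)"
    unfolding helmholtz_properties_def fstK \<omega>_def[symmetric]
    by (intro conjI allI ballI impI; (elim conjE)?)
      (erule characteristic | erule (1) lie | erule (2) isotropic | erule (3) exterior)+
qed

end

theorem theorem5:
  fixes M :: "'a topology"
    and A :: "('a, real ^ 'n) chart set"
    and \<Gamma> :: "('a, 'n) tpoint \<Rightarrow> ('a, 'n) tvector"
  assumes "paracompact_manifold M A"
    and "CARD('n) \<ge> 3"
    and "spray M A \<Gamma>"
  shows "(\<forall>\<omega>. two_form (slit_atlas A) (slit_tangent A (topspace M)) \<omega> \<and>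
              helmholtz_properties A \<Gamma> (topspace M) \<omega> \<longrightarrow>
            (\<forall>k\<in>A. \<exists>h. helmholtz M A \<Gamma> k h \<and>
               (\<forall>q\<in>slit_tangent A (fst k).
                  \<forall>X\<in>tangent_space (slit_atlas A) q. \<forall>Y\<in>tangent_space (slit_atlas A) q.
                    \<omega> q X Y = helmholtz_form A \<Gamma> k h q X Y))) \<and>
         (\<forall>k\<in>A. \<forall>h. helmholtz M A \<Gamma> k h \<longrightarrow>
            (\<forall>\<Gamma>'\<in>projective_class M A \<Gamma>.
               two_form (slit_atlas A) (slit_tangent A (fst k)) (helmholtz_form A \<Gamma>' k h) \<and>
               helmholtz_properties A \<Gamma>' (fst k) (helmholtz_form A \<Gamma>' k h)))"
proof -
  interpret manifold A M
    using assms(1) smooth_atlas_manifold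
    by (intro manifold.intro base_atlas.intro manifold_axioms.intro)
  show ?thesis
    using helmholtz_of_properties[OF assms(3)] properties_of_helmholtz[OF assms(3)] by blast
qed

end
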